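(* Let $\gamma\in[0,1]$ and $T\in\mathbb N$. Assume that for every $t\in\mathbb N$: (i) $(x,a)\mapsto P(t,x,a,\cdot)$ is weakly continuous, i.e. $\int f\,dP(t,x^n,a^n,\cdot)\to\int f\,dP(t,x^0,a^0,\cdot)$ for all $f\in C_b(\mathbb X)$ whenever $x^n\to x^0$ in $\mathbb X$ and $a^n\to a^0$ in $\mathbb A$; (ii) $\bigcup_{x\in\mathbb X}\mathcal A_t(x)$ is compact and $\mathcal A_t$ is upper hemi-continuous (for every $x$ and every open $U_{\mathbb A}\supseteq\mathcal A_t(x)$ there is an open $U_{\mathbb X}\ni x$ with $\mathcal A_t(z)\subseteq U_{\mathbb A}$ for all $z\in U_{\mathbb X}$); (iii) for every compact $K\subset\mathbb R$, every $(\mu^n)_{n\in\mathbb N}\subset\mathcal P(K)$ converging weakly to $\mu^0\in\mathcal P(K)$ and every $x^n\to x^0$ in $\mathbb X$, $\liminf_{n\to\infty}\sigma_{t,x^n}(\mu^n)\ge\sigma_{t,x^0}(\mu^0)$; (iv) $C_t$ is lower semi-continuous and $\|C_t\|_\infty\le b$, where $b>0$ does not depend on $t$. Then: (a) For every $t\in\{1,\dots,T\}$ and $x\in\mathbb X$, the set $\arg\min_{\lambda\in\varpi_t(x)}G^\lambda_tJ^*_{t+1,T}(x)$ is nonempty and closed, and there is a measurable $\pi^*_t:(\mathbb X,\mathcal B(\mathbb X))\to(\Lambda,\mathcal E(\Lambda))$ such that $$\pi^*_t(x)\in\arg\min_{\lambda\in\varpi_t(x)}G^\lambda_tJ^*_{t+1,T}(x),\qquad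 x\in\mathbb X.\qquad(\ast)$$ (b) If $\mathfrak p^*=(\pi^*_t)_{t\in\{1,\dots,T\}}$ consists of measurable maps satisfying $(\ast)$ for all $t\in\{1,\dots,T\}$ (extended arbitrarily to an element of $\Pi$ for times after $T$), then $J^{\mathfrak p^*}_{t,T}=J^*_{t,T}=\inf_{\mathfrak p\in\Pi}J^{\mathfrak p}_{t,T}$ (pointwise on $\mathbb X$) for $0<t<T$, and $$J^{\mathfrak p^*}_{0,T}=J^*_{0,T}=\inf_{(\mathfrak X^{\mathfrak p},\mathfrak A^{\mathfrak p})\in\Psi}\varsigma^{\mathfrak X^{\mathfrak p}}_{0,T}(\mathfrak C^{\mathfrak p}),$$ where the infimum is over all Markovian policies $\mathfrak p\in\Pi$; i.e. $\mathfrak p^*$ is an optimal Markovian policy.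
   Context: Spaces. $\mathbb N=\{1,2,\dots\}$, $\mathbb N_0=\{0\}\cup\mathbb N$. $\mathbb X$ (states) and $\mathbb A$ (actions) are complete separable metric spaces with Borel $\sigma$-algebras. $\Lambda$ is the set of Borel probability measures on $\mathbb A$ with the weak topology; its Borel $\sigma$-algebra equals $\mathcal E(\Lambda)$, the $\sigma$-algebra generated by the maps $\lambda\mapsto\lambda(B)$, $B\in\mathcal B(\mathbb A)$. $\ell^\infty(\mathbb X,\mathcal B(\mathbb X))$ is the space of bounded Borel functions with sup norm; $O\equiv0$ on $\mathbb X$. For closed $F\subseteq\mathbb R$, $\mathcal P(F)$ is the set of Borel probability measures on $F$ with the weak topology; $\mathcal P_b(\mathbb R)$, $\mathcal P_b(\mathbb R^2)$ are the Borel probability measures with bounded support. $\gamma$ is a fixed discount factor. Probability setting. $(\Omega,\mathscr H,\mathbb P)$ is a complete atomless probability space with filtrations $(\mathscr F_t)_{t\in\mathbb N}$, $(\mathscr G_t)_{t\in\mathbb N}$, $\mathscr F_t\subseteq\mathscr G_t\subseteq\mathscr H$, $\mathscr F_1$ containing all $\mathbb P$-null sets; $\mathscr F_0=\mathscr G_0=\{\emptyset,\Omega\}$ and $\mathscr U_t:=\mathscr G_{t-1}\vee\mathscr F_t$. $L^\infty(\Omega,\mathscr H,\mathbb P)$ carries the essential supremum norm. For bounded real $Y$, $P^{Y|\mathscr U}$ denotes a regular conditional distribution of $Y$ given $\mathscr U$, in a version supported in $[-\|Y\|_\infty,\|Y\|_\infty]$ for every $\omega$; $\mathcal L(Y)$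 is the law of $Y$. Risk measures. A law-invariant convex risk measure (at the level of distributions) is a map $\sigma:\mathcal P_b(\mathbb R)\to(-\infty,\infty]$, not identically $+\infty$, with: (1) $\sigma(\mu*\delta_c)=\sigma(\mu)+c$ for $c\in\mathbb R$; (2) $\mu((-\infty,r])\ge\mu'((-\infty,r])$ for all $r$ implies $\sigma(\mu)\le\sigma(\mu')$; (3) for $\zeta\in\mathcal P_b(\mathbb R^2)$ with first and second marginals $\zeta_0,\zeta_1$, and $\theta\in[0,1]$, if $\zeta_\theta$ is the image of $\zeta$ under $(r_0,r_1)\mapsto(1-\theta)r_0+\theta r_1$, then $\sigma(\zeta_\theta)\le(1-\theta)\sigma(\zeta_0)+\theta\sigma(\zeta_1)$. Fix such $\sigma_0$ and $(\sigma_{t,x})_{(t,x)\in\mathbb N\times\mathbb X}$; it is assumed that for every $t$ and compact $K\subset\mathbb R$, $(x,\mu)\mapsto\sigma_{t,x}(\mu)$ is Borel measurable on $\mathbb X\times\mathcal P(K)$, and that $|\sigma_{t,x}(\delta_0)|\le b_t$ for all $x$, for some $b_t\ge0$. Dynamic risk measure. For an $\mathbb X$-valued $(\mathscr F_t)$-adapted process $\mathfrak X=(X_t)_{t\in\mathbb N}$ and $\mathfrak Z=(Z_t)_{t\in\mathbb N_0}\subset L^\infty(\Omega,\mathscr H,\mathbb P)$: $\varsigma^{\mathfrak X}_{T,x,T}(\mathfrak Z):=\sigma_{T,x}(P^{Z_T|\mathscr U_T})$; for $0<t<T$, $\varsigma^{\mathfrak X}_{t,x,T}(\mathfrak Z):=\sigma_{t,x}(P^{W_t^T|\mathscr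 U_t})$ with $W_t^T:=Z_t+\gamma\,\varsigma^{\mathfrak X}_{t+1,X_{t+1},T}(\mathfrak Z)$; and $\varsigma^{\mathfrak X}_{0,T}(\mathfrak Z):=\sigma_0(\mathcal L(Z_0+\gamma\,\varsigma^{\mathfrak X}_{1,X_1,T}(\mathfrak Z)))$. Actions and policies. For $t\in\mathbb N$, $\mathcal A_t:\mathbb X\to2^{\mathbb A}$ is nonempty closed-valued and weakly measurable ($\{x:\mathcal A_t(x)\cap U\ne\emptyset\}\in\mathcal B(\mathbb X)$ for open $U$). $\varpi_t(x):=\{\lambda\in\Lambda:\lambda(\mathcal A_t(x))=1\}$; $\Pi_t$ is the set of measurable $\pi_t:\mathbb X\to\Lambda$ with $\pi_t(x)\in\varpi_t(x)$ for all $x$; $\Pi$ is the set of Markovian policies $\mathfrak p=(\pi_t)_{t\in\mathbb N}$, $\pi_t\in\Pi_t$. Controlled processes. $P$ is a transition kernel: $P(t,x,a,\cdot)$ is a Borel probability on $\mathbb X$, and $(x,a)\mapsto P(t,x,a,B)$ is measurable for $B\in\mathcal B(\mathbb X)$. $\xi_1$ is a Borel probability on $\mathbb X$. $\Psi$ is a set of pairs $(\mathfrak X,\mathfrak A)$, $\mathfrak X=(X_t)_{t\in\mathbb N}$ $\mathbb X$-valued and $(\mathscr F_t)$-adapted, $\mathfrak A=(A_t)_{t\in\mathbb N}$ $\mathbb A$-valued and $(\mathscr G_t)$-adapted, such that $X_1\sim\xi_1$, $\mathbb P(X_{t+1}\in B|\mathscr G_t)=P(t,X_t,A_t,B)$ a.s.,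 and $\mathbb P(A_t\in\mathcal A_t(X_t),\ t\in\mathbb N)=1$. It is assumed that for each $\mathfrak p=(\pi_t)\in\Pi$ there is a pair in $\Psi$, written $(\mathfrak X^{\mathfrak p},\mathfrak A^{\mathfrak p})$, with $\mathbb P(A_t\in B|\mathscr U_t)=\mathbb P(A_t\in B|\sigma(X_t))=[\pi_t(X_t)](B)$ a.s. for all $t$, $B\in\mathcal B(\mathbb A)$. Costs. $C_t:\mathbb X\times\mathbb A\times\mathbb X\to\mathbb R$ is Borel measurable for $t\in\mathbb N$, $C_0\equiv0$; $\mathfrak C:=(C_t(X_t,A_t,X_{t+1}))_{t\in\mathbb N_0}$ (zero entry at $t=0$), and $\mathfrak C^{\mathfrak p}$ is the same for $(\mathfrak X^{\mathfrak p},\mathfrak A^{\mathfrak p})$. Operators and value functions. For $v\in\ell^\infty(\mathbb X,\mathcal B(\mathbb X))$, $\lambda\in\Lambda$: $\widetilde P^v_{t,x,\lambda}(B):=\int_{\mathbb A}\int_{\mathbb X}1_B(C_t(x,a,y)+\gamma v(y))\,P(t,x,a,dy)\,\lambda(da)$, $B\in\mathcal B(\mathbb R)$; $G^\lambda_tv(x):=\sigma_{t,x}(\widetilde P^v_{t,x,\lambda})$; $H^{\mathfrak p}_tv(x):=G^{\pi_t(x)}_tv(x)$; $S_tv(x):=\inf_{\lambda\in\varpi_t(x)}G^\lambda_tv(x)$; $H_0v:=\sigma_0(\text{law of }\gamma v(Y))$ with $Y\sim\xi_1$. For $t,T\in\mathbb N$: $J^{\mathfrak p}_{t,T}:=O$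 if $t>T$, $J^{\mathfrak p}_{t,T}:=H^{\mathfrak p}_tJ^{\mathfrak p}_{t+1,T}$ if $t\le T$; $J^*_{t,T}:=O$ if $t>T$, $J^*_{t,T}:=S_tJ^*_{t+1,T}$ if $t\le T$ (bounded, Borel under (i)–(iv)); $J^{\mathfrak p}_{0,T}:=H_0J^{\mathfrak p}_{1,T}$, $J^*_{0,T}:=H_0J^*_{1,T}$. *)

theory Defs
  imports "HOL-Probability.Probability"
begin

text \<open>\<^term>\<open>prob_algebra borel\<close> is the space of Borel probability measures with the sigma-algebra
  generated by the evaluations. A probability measure on a closed set \<^term>\<open>F\<close> is represented by
  its extension to the whole space, which gives \<^term>\<open>F\<close> measure 1.\<close>

definition prob_on :: "'a::topological_space set \<Rightarrow> 'a measure set" where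
  "prob_on F = {\<mu> \<in> space (prob_algebra borel). measure \<mu> F = 1}"

definition bounded_support :: "'a::real_normed_vector measure set" where
  "bounded_support = (\<Union>r. prob_on (cball 0 r))"

definition weak_topology :: "'a::topological_space measure topology" where
  "weak_topology = subtopology
     (topology_generated_by
        {{\<mu>. (\<integral>z. f z \<partial>\<mu>) \<in> V} | f V. continuous_on UNIV f \<and> bounded (range f) \<and> open (V :: real set)})
     (space (prob_algebra borel))"

definition borel_of :: "'a topology \<Rightarrow> 'a measure" where
  "borel_of X = sigma (topspace X) {V. openin X V}"

definition lower_semicontinuous :: "('a::topological_space \<Rightarrow> real) \<Rightarrow> bool" where
  "lower_semicontinuous f \<longleftrightarrow> (\<forall>z r. r < f z \<longrightarrow> (\<forall>\<^sub>F z' in nhds z. r < f z'))"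

definition atomless :: "'a measure \<Rightarrow> bool" where
  "atomless M \<longleftrightarrow> (\<forall>A \<in> sets M. 0 < emeasure M A \<longrightarrow>
     (\<exists>B \<in> sets M. B \<subseteq> A \<and> 0 < emeasure M B \<and> emeasure M B < emeasure M A))"

locale law_invariant_convex_risk_measure =
  fixes \<sigma> :: "real measure \<Rightarrow> ereal"
  assumes not_minus_infinity: "\<mu> \<in> bounded_support \<Longrightarrow> \<sigma> \<mu> \<noteq> -\<infinity>"
    and not_identically_infinity: "\<exists>\<mu> \<in> bounded_support. \<sigma> \<mu> \<noteq> \<infinity>"
    and translation: "\<mu> \<in> bounded_support \<Longrightarrow> \<sigma> (\<mu> \<star> return borel c) = \<sigma> \<mu> + ereal c"
    and monotone: "\<lbrakk>\<mu> \<in> bounded_support; \<mu>' \<in> bounded_support;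
        \<And>r. measure \<mu> {..r} \<ge> measure \<mu>' {..r}\<rbrakk> \<Longrightarrow> \<sigma> \<mu> \<le> \<sigma> \<mu>'"
    and convex: "\<lbrakk>(\<zeta> :: (real \<times> real) measure) \<in> bounded_support; 0 \<le> \<theta>; \<theta> \<le> 1\<rbrakk> \<Longrightarrow>
        \<sigma> (distr \<zeta> borel (\<lambda>(r0, r1). (1 - \<theta>) * r0 + \<theta> * r1))
          \<le> ereal (1 - \<theta>) * \<sigma> (distr \<zeta> borel fst) + ereal \<theta> * \<sigma> (distr \<zeta> borel snd)"

text \<open>A version of the regular conditional distribution of \<^term>\<open>Y\<close> given \<^term>\<open>U\<close>, supported in
  \<open>[-\<parallel>Y\<parallel>, \<parallel>Y\<parallel>]\<close> (essential supremum norm) for every outcome.\<close>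

definition is_reg_cond_distr ::
    "'w measure \<Rightarrow> 'w measure \<Rightarrow> ('w \<Rightarrow> real) \<Rightarrow> ('w \<Rightarrow> real measure) \<Rightarrow> bool" where
  "is_reg_cond_distr M U Y \<kappa> \<longleftrightarrow>
     \<kappa> \<in> U \<rightarrow>\<^sub>M prob_algebra borel \<and>
     (\<forall>B \<in> sets borel. AE \<omega> in M.
        measure (\<kappa> \<omega>) B = real_cond_exp M U (indicator {\<omega>' \<in> space M. Y \<omega>' \<in> B}) \<omega>) \<and>
     (\<forall>\<omega> \<in> space M. measure (\<kappa> \<omega>) {r. ereal \<bar>r\<bar> \<le> esssup M (\<lambda>\<omega>'. ereal \<bar>Y \<omega>'\<bar>)} = 1)"

definition reg_cond_distr ::
    "'w measure \<Rightarrow> 'w measure \<Rightarrow> ('w \<Rightarrow> real) \<Rightarrow> 'w \<Rightarrow> real measure" where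
  "reg_cond_distr M U Y = (SOME \<kappa>. is_reg_cond_distr M U Y \<kappa>)"

definition U_alg ::
    "'w measure \<Rightarrow> (nat \<Rightarrow> 'w measure) \<Rightarrow> (nat \<Rightarrow> 'w measure) \<Rightarrow> nat \<Rightarrow> 'w measure" where
  "U_alg M F G t = sigma (space M) (sets (G (t - 1)) \<union> sets (F t))"

text \<open>The dynamic risk measure at a time \<^term>\<open>t\<close> with \<open>1 \<le> t \<le> T\<close>. Its values are finite on bounded
  processes, so that \<^const>\<open>real_of_ereal\<close> only changes the type.\<close>

function dyn_risk ::
    "'w measure \<Rightarrow> (nat \<Rightarrow> 'w measure) \<Rightarrow> (nat \<Rightarrow> 'w measure) \<Rightarrow> real \<Rightarrow>
     (nat \<Rightarrow> 'x \<Rightarrow> real measure \<Rightarrow> ereal) \<Rightarrow> (nat \<Rightarrow> 'w \<Rightarrow> 'x) \<Rightarrow> (nat \<Rightarrow> 'w \<Rightarrow> real) \<Rightarrow>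
     nat \<Rightarrow> nat \<Rightarrow> 'x \<Rightarrow> 'w \<Rightarrow> ereal" where
  "dyn_risk M F G \<gamma> \<sigma> X Z T t x \<omega> =
     (if t < T
      then \<sigma> t x (reg_cond_distr M (U_alg M F G t)
             (\<lambda>\<omega>'. Z t \<omega>' + \<gamma> * real_of_ereal
                (dyn_risk M F G \<gamma> \<sigma> X Z T (Suc t) (X (Suc t) \<omega>') \<omega>')) \<omega>)
      else \<sigma> t x (reg_cond_distr M (U_alg M F G t) (Z t) \<omega>))"
  by pat_completeness auto
termination
  by (relation "Wellfounded.measure (\<lambda>(M, F, G, \<gamma>, \<sigma>, X, Z, T, t, x, \<omega>). T - t)") auto

declare dyn_risk.simps [simp del]

definition dyn_risk0 ::
    "'w measure \<Rightarrow> (nat \<Rightarrow> 'w measure) \<Rightarrow> (nat \<Rightarrow> 'w measure) \<Rightarrow> real \<Rightarrow>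
     (real measure \<Rightarrow> ereal) \<Rightarrow> (nat \<Rightarrow> 'x \<Rightarrow> real measure \<Rightarrow> ereal) \<Rightarrow>
     (nat \<Rightarrow> 'w \<Rightarrow> 'x) \<Rightarrow> (nat \<Rightarrow> 'w \<Rightarrow> real) \<Rightarrow> nat \<Rightarrow> ereal" where
  "dyn_risk0 M F G \<gamma> \<sigma>0 \<sigma> X Z T =
     \<sigma>0 (distr M borel
       (\<lambda>\<omega>. Z 0 \<omega> + \<gamma> * real_of_ereal (dyn_risk M F G \<gamma> \<sigma> X Z T 1 (X 1 \<omega>) \<omega>)))"

definition markov_policies ::
    "(nat \<Rightarrow> 'x::topological_space \<Rightarrow> 'a::topological_space set) \<Rightarrow> (nat \<Rightarrow> 'x \<Rightarrow> 'a measure) set" where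
  "markov_policies \<A> = {p. \<forall>t \<ge> 1. p t \<in> borel \<rightarrow>\<^sub>M prob_algebra borel \<and> (\<forall>x. p t x \<in> prob_on (\<A> t x))}"

definition cost_process ::
    "(nat \<Rightarrow> 'x \<Rightarrow> 'a \<Rightarrow> 'x \<Rightarrow> real) \<Rightarrow> (nat \<Rightarrow> 'w \<Rightarrow> 'x) \<Rightarrow> (nat \<Rightarrow> 'w \<Rightarrow> 'a) \<Rightarrow> nat \<Rightarrow> 'w \<Rightarrow> real" where
  "cost_process C X A t \<omega> = (if t = 0 then 0 else C t (X t \<omega>) (A t \<omega>) (X (Suc t) \<omega>))"

text \<open>The operators act on real functions and have values in \<^typ>\<open>ereal\<close>; they are finite on bounded
  measurable functions, so that \<^const>\<open>real_of_ereal\<close> in the recursions only changes the type.\<close>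

definition one_step_law ::
    "real \<Rightarrow> (nat \<Rightarrow> 'x \<Rightarrow> 'a \<Rightarrow> 'x \<Rightarrow> real) \<Rightarrow> (nat \<Rightarrow> 'x \<Rightarrow> 'a \<Rightarrow> 'x measure) \<Rightarrow>
     nat \<Rightarrow> ('x \<Rightarrow> real) \<Rightarrow> 'x \<Rightarrow> 'a measure \<Rightarrow> real measure" where
  "one_step_law \<gamma> C P t v x l = measure_of UNIV (sets borel)
     (\<lambda>B. \<integral>\<^sup>+ a. (\<integral>\<^sup>+ y. indicator B (C t x a y + \<gamma> * v y) \<partial>P t x a) \<partial>l)"

definition G_op ::
    "real \<Rightarrow> (nat \<Rightarrow> 'x \<Rightarrow> 'a \<Rightarrow> 'x \<Rightarrow> real) \<Rightarrow> (nat \<Rightarrow> 'x \<Rightarrow> 'a \<Rightarrow> 'x measure) \<Rightarrow>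
     (nat \<Rightarrow> 'x \<Rightarrow> real measure \<Rightarrow> ereal) \<Rightarrow> nat \<Rightarrow> 'a measure \<Rightarrow> ('x \<Rightarrow> real) \<Rightarrow> 'x \<Rightarrow> ereal" where
  "G_op \<gamma> C P \<sigma> t l v x = \<sigma> t x (one_step_law \<gamma> C P t v x l)"

definition H_op ::
    "real \<Rightarrow> (nat \<Rightarrow> 'x \<Rightarrow> 'a \<Rightarrow> 'x \<Rightarrow> real) \<Rightarrow> (nat \<Rightarrow> 'x \<Rightarrow> 'a \<Rightarrow> 'x measure) \<Rightarrow>
     (nat \<Rightarrow> 'x \<Rightarrow> real measure \<Rightarrow> ereal) \<Rightarrow> (nat \<Rightarrow> 'x \<Rightarrow> 'a measure) \<Rightarrow>
     nat \<Rightarrow> ('x \<Rightarrow> real) \<Rightarrow> 'x \<Rightarrow> ereal" where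
  "H_op \<gamma> C P \<sigma> p t v x = G_op \<gamma> C P \<sigma> t (p t x) v x"

definition S_op ::
    "real \<Rightarrow> (nat \<Rightarrow> 'x \<Rightarrow> 'a \<Rightarrow> 'x \<Rightarrow> real) \<Rightarrow> (nat \<Rightarrow> 'x \<Rightarrow> 'a \<Rightarrow> 'x measure) \<Rightarrow>
     (nat \<Rightarrow> 'x \<Rightarrow> real measure \<Rightarrow> ereal) \<Rightarrow> (nat \<Rightarrow> 'x \<Rightarrow> 'a::topological_space set) \<Rightarrow>
     nat \<Rightarrow> ('x \<Rightarrow> real) \<Rightarrow> 'x \<Rightarrow> ereal" where
  "S_op \<gamma> C P \<sigma> \<A> t v x = (INF l \<in> prob_on (\<A> t x). G_op \<gamma> C P \<sigma> t l v x)"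

definition H0_op ::
    "real \<Rightarrow> 'x measure \<Rightarrow> (real measure \<Rightarrow> ereal) \<Rightarrow> ('x \<Rightarrow> real) \<Rightarrow> ereal" where
  "H0_op \<gamma> \<xi> \<sigma>0 v = \<sigma>0 (distr \<xi> borel (\<lambda>y. \<gamma> * v y))"

function J_pol ::
    "real \<Rightarrow> (nat \<Rightarrow> 'x \<Rightarrow> 'a \<Rightarrow> 'x \<Rightarrow> real) \<Rightarrow> (nat \<Rightarrow> 'x \<Rightarrow> 'a \<Rightarrow> 'x measure) \<Rightarrow>
     (nat \<Rightarrow> 'x \<Rightarrow> real measure \<Rightarrow> ereal) \<Rightarrow> (nat \<Rightarrow> 'x \<Rightarrow> 'a measure) \<Rightarrow>
     nat \<Rightarrow> nat \<Rightarrow> 'x \<Rightarrow> ereal" where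
  "J_pol \<gamma> C P \<sigma> p T t x =
     (if t \<le> T then H_op \<gamma> C P \<sigma> p t (\<lambda>y. real_of_ereal (J_pol \<gamma> C P \<sigma> p T (Suc t) y)) x else 0)"
  by pat_completeness auto
termination
  by (relation "Wellfounded.measure (\<lambda>(\<gamma>, C, P, \<sigma>, p, T, t, x). Suc T - t)") auto

declare J_pol.simps [simp del]

function J_opt ::
    "real \<Rightarrow> (nat \<Rightarrow> 'x \<Rightarrow> 'a \<Rightarrow> 'x \<Rightarrow> real) \<Rightarrow> (nat \<Rightarrow> 'x \<Rightarrow> 'a \<Rightarrow> 'x measure) \<Rightarrow>
     (nat \<Rightarrow> 'x \<Rightarrow> real measure \<Rightarrow> ereal) \<Rightarrow> (nat \<Rightarrow> 'x \<Rightarrow> 'a::topological_space set) \<Rightarrow>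
     nat \<Rightarrow> nat \<Rightarrow> 'x \<Rightarrow> ereal" where
  "J_opt \<gamma> C P \<sigma> \<A> T t x =
     (if t \<le> T then S_op \<gamma> C P \<sigma> \<A> t (\<lambda>y. real_of_ereal (J_opt \<gamma> C P \<sigma> \<A> T (Suc t) y)) x else 0)"
  by pat_completeness auto
termination
  by (relation "Wellfounded.measure (\<lambda>(\<gamma>, C, P, \<sigma>, \<A>, T, t, x). Suc T - t)") auto

declare J_opt.simps [simp del]

definition J_pol0 ::
    "real \<Rightarrow> (nat \<Rightarrow> 'x \<Rightarrow> 'a \<Rightarrow> 'x \<Rightarrow> real) \<Rightarrow> (nat \<Rightarrow> 'x \<Rightarrow> 'a \<Rightarrow> 'x measure) \<Rightarrow>
     'x measure \<Rightarrow> (real measure \<Rightarrow> ereal) \<Rightarrow> (nat \<Rightarrow> 'x \<Rightarrow> real measure \<Rightarrow> ereal) \<Rightarrow>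
     (nat \<Rightarrow> 'x \<Rightarrow> 'a measure) \<Rightarrow> nat \<Rightarrow> ereal" where
  "J_pol0 \<gamma> C P \<xi> \<sigma>0 \<sigma> p T = H0_op \<gamma> \<xi> \<sigma>0 (\<lambda>y. real_of_ereal (J_pol \<gamma> C P \<sigma> p T 1 y))"

definition J_opt0 ::
    "real \<Rightarrow> (nat \<Rightarrow> 'x \<Rightarrow> 'a \<Rightarrow> 'x \<Rightarrow> real) \<Rightarrow> (nat \<Rightarrow> 'x \<Rightarrow> 'a \<Rightarrow> 'x measure) \<Rightarrow>
     'x measure \<Rightarrow> (real measure \<Rightarrow> ereal) \<Rightarrow> (nat \<Rightarrow> 'x \<Rightarrow> real measure \<Rightarrow> ereal) \<Rightarrow>
     (nat \<Rightarrow> 'x \<Rightarrow> 'a::topological_space set) \<Rightarrow> nat \<Rightarrow> ereal" where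
  "J_opt0 \<gamma> C P \<xi> \<sigma>0 \<sigma> \<A> T = H0_op \<gamma> \<xi> \<sigma>0 (\<lambda>y. real_of_ereal (J_opt \<gamma> C P \<sigma> \<A> T 1 y))"

definition argmin_set ::
    "real \<Rightarrow> (nat \<Rightarrow> 'x \<Rightarrow> 'a \<Rightarrow> 'x \<Rightarrow> real) \<Rightarrow> (nat \<Rightarrow> 'x \<Rightarrow> 'a \<Rightarrow> 'x measure) \<Rightarrow>
     (nat \<Rightarrow> 'x \<Rightarrow> real measure \<Rightarrow> ereal) \<Rightarrow> (nat \<Rightarrow> 'x \<Rightarrow> 'a::topological_space set) \<Rightarrow>
     nat \<Rightarrow> nat \<Rightarrow> 'x \<Rightarrow> 'a measure set" where
  "argmin_set \<gamma> C P \<sigma> \<A> T t x =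
     {l. is_arg_min (\<lambda>l. G_op \<gamma> C P \<sigma> t l (\<lambda>y. real_of_ereal (J_opt \<gamma> C P \<sigma> \<A> T (Suc t) y)) x)
           (\<lambda>l. l \<in> prob_on (\<A> t x)) l}"

locale two_filtration_space = prob_space M + complete_measure M +
    F: filtration "space M" F + G: filtration "space M" G
  for M :: "'w measure" and F G :: "nat \<Rightarrow> 'w measure" +
  assumes atomless: "atomless M"
    and F_sub_G: "sets (F t) \<subseteq> sets (G t)"
    and G_sub: "sets (G t) \<subseteq> sets M"
    and F_null: "null_sets M \<subseteq> sets (F 1)"
    and F_0: "sets (F 0) = {{}, space M}"
    and G_0: "sets (G 0) = {{}, space M}"

text \<open>Times are natural numbers, and every time-indexed datum other than the filtrations is
  constrained at times \<open>t \<ge> 1\<close> only. \<open>Xp p\<close> and \<open>Ap p\<close> are the state and action processes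
  associated with the Markovian policy \<open>p\<close>.\<close>

locale risk_averse_control = two_filtration_space M F G +
    sigma0: law_invariant_convex_risk_measure \<sigma>0
  for M :: "'w measure" and F G :: "nat \<Rightarrow> 'w measure"
    and \<sigma>0 :: "real measure \<Rightarrow> ereal"
    and \<sigma> :: "nat \<Rightarrow> 'x::polish_space \<Rightarrow> real measure \<Rightarrow> ereal"
    and \<A> :: "nat \<Rightarrow> 'x \<Rightarrow> 'a::polish_space set"
    and P :: "nat \<Rightarrow> 'x \<Rightarrow> 'a \<Rightarrow> 'x measure"
    and \<xi> :: "'x measure"
    and \<Psi> :: "((nat \<Rightarrow> 'w \<Rightarrow> 'x) \<times> (nat \<Rightarrow> 'w \<Rightarrow> 'a)) set"
    and Xp :: "(nat \<Rightarrow> 'x \<Rightarrow> 'a measure) \<Rightarrow> nat \<Rightarrow> 'w \<Rightarrow> 'x"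
    and Ap :: "(nat \<Rightarrow> 'x \<Rightarrow> 'a measure) \<Rightarrow> nat \<Rightarrow> 'w \<Rightarrow> 'a"
    and C :: "nat \<Rightarrow> 'x \<Rightarrow> 'a \<Rightarrow> 'x \<Rightarrow> real" +
  assumes sigma_risk_measure: "t \<ge> 1 \<Longrightarrow> law_invariant_convex_risk_measure (\<sigma> t x)"
    and sigma_measurable: "\<lbrakk>t \<ge> 1; compact K\<rbrakk> \<Longrightarrow> (\<lambda>(x, \<mu>). \<sigma> t x \<mu>) \<in>
        borel_of (prod_topology euclidean (subtopology weak_topology (prob_on K))) \<rightarrow>\<^sub>M borel"
    and sigma_bounded: "t \<ge> 1 \<Longrightarrow> \<exists>b::real. b \<ge> 0 \<and> (\<forall>x. \<bar>\<sigma> t x (return borel 0)\<bar> \<le> ereal b)"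
    and actions_nonempty: "t \<ge> 1 \<Longrightarrow> \<A> t x \<noteq> {}"
    and actions_closed: "t \<ge> 1 \<Longrightarrow> closed (\<A> t x)"
    and actions_weakly_measurable:
      "\<lbrakk>t \<ge> 1; open V\<rbrakk> \<Longrightarrow> {x. \<A> t x \<inter> V \<noteq> {}} \<in> sets borel"
    and kernel: "t \<ge> 1 \<Longrightarrow> (\<lambda>(x, a). P t x a) \<in> borel \<rightarrow>\<^sub>M prob_algebra borel"
    and initial: "\<xi> \<in> space (prob_algebra borel)"
    and X_adapted: "\<lbrakk>(X, A) \<in> \<Psi>; t \<ge> 1\<rbrakk> \<Longrightarrow> X t \<in> F t \<rightarrow>\<^sub>M borel"
    and A_adapted: "\<lbrakk>(X, A) \<in> \<Psi>; t \<ge> 1\<rbrakk> \<Longrightarrow> A t \<in> G t \<rightarrow>\<^sub>M borel"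
    and X_initial: "(X, A) \<in> \<Psi> \<Longrightarrow> distr M borel (X 1) = \<xi>"
    and X_transition: "\<lbrakk>(X, A) \<in> \<Psi>; t \<ge> 1; B \<in> sets borel\<rbrakk> \<Longrightarrow> AE \<omega> in M.
        real_cond_exp M (G t) (indicator {\<omega>' \<in> space M. X (Suc t) \<omega>' \<in> B}) \<omega>
          = measure (P t (X t \<omega>) (A t \<omega>)) B"
    and A_admissible: "(X, A) \<in> \<Psi> \<Longrightarrow> AE \<omega> in M. \<forall>t \<ge> 1. A t \<omega> \<in> \<A> t (X t \<omega>)"
    and policy_pair: "p \<in> markov_policies \<A> \<Longrightarrow> (Xp p, Ap p) \<in> \<Psi>"
    and policy_cond_U: "\<lbrakk>p \<in> markov_policies \<A>; t \<ge> 1; D \<in> sets borel\<rbrakk> \<Longrightarrow> AE \<omega> in M.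
        real_cond_exp M (U_alg M F G t) (indicator {\<omega>' \<in> space M. Ap p t \<omega>' \<in> D}) \<omega>
          = measure (p t (Xp p t \<omega>)) D"
    and policy_cond_X: "\<lbrakk>p \<in> markov_policies \<A>; t \<ge> 1; D \<in> sets borel\<rbrakk> \<Longrightarrow> AE \<omega> in M.
        real_cond_exp M (vimage_algebra (space M) (Xp p t) borel)
            (indicator {\<omega>' \<in> space M. Ap p t \<omega>' \<in> D}) \<omega>
          = measure (p t (Xp p t \<omega>)) D"
    and cost_measurable: "t \<ge> 1 \<Longrightarrow> (\<lambda>(x, a, y). C t x a y) \<in> borel_measurable borel"

end

theory Submission
  imports Defs
begin

text \<open>The value functions are constructed backwards in time, and the argument rests on one invariant: a value
function is bounded and lower semicontinuous.

Let \<open>v\<close> be bounded and lower semicontinuous, and let \<open>x\<^sub>n \<longlonglongrightarrow> x\<close> and \<open>l\<^sub>n \<longlonglongrightarrow> l\<close> weakly. The one-step laws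
at \<open>(x\<^sub>n, l\<^sub>n)\<close> live on a fixed compact interval, so a subsequence of them has a weak limit \<open>\<mu>\<close>. This limit
need not be the one-step law at \<open>(x, l)\<close>, because the cost is only lower semicontinuous. But the portmanteau
inequality shows that \<open>\<mu>\<close> dominates that law stochastically, so monotonicity of the risk measure,
followed by its lower semicontinuity along the subsequence, makes the one-step risk jointly lower semicontinuous
(\<open>G_op_level_closed\<close>). The admissible measures at \<open>x\<close> live on a compact set of actions and depend on
\<open>x\<close> with closed graph. Hence the minimum over them is attained on a closed set, and the minimal
value is bounded and lower semicontinuous again (\<open>minimisers_G_op\<close>, \<open>S_op_lower_semicontinuous\<close>).

Compactness and selection are both reduced to concrete spaces. A Borel injection of a compact metric space into the
line whose inverse is uniformly continuous turns Helly's selection theorem into sequential compactness of the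
probability measures on the space (\<open>prob_on_compact_convergent_subsequence\<close>). Integration against a countable
family of continuous functions identifies measures with sequences of reals, the map \<open>moments\<close>; weak sequential
compactness becomes compactness there. A measurable minimiser is found by minimising the risk
and then all coordinates of the sequence, one after the other: each minimisation keeps a
compact-valued map measurable, and in the end a single point is left (\<open>minimisers_hit_measurable\<close>,
\<open>measurable_selection\<close>).

Optimality follows from monotonicity: no Markovian policy has a value below \<open>J_opt\<close>, and one that always selects
minimisers attains it. To compare with the dynamic risk measure, condition the cost-to-go under a
policy \<open>p\<close> first on \<open>G t\<close>, where the next state follows the transition kernel, and then on the smaller
sigma-algebra \<open>U_alg M F G t\<close>, where the action follows \<open>p t (X t)\<close>. The result is the one-step law at
\<open>(X t, p t (X t))\<close> (\<open>step_cond_law\<close>). Regular conditional distributions are almost surely unique, so a backward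
induction shows that the dynamic risk measure along the controlled process is almost surely \<open>J_pol\<close> at the current
state (\<open>dyn_risk_AE_eq_J_pol\<close>).\<close>

section \<open>Weak convergence of probability measures\<close>

definition weakly_converges :: "(nat \<Rightarrow> 'a::topological_space measure) \<Rightarrow> 'a measure \<Rightarrow> bool" where
  "weakly_converges \<mu> \<mu>0 \<longleftrightarrow> (\<forall>f :: 'a \<Rightarrow> real. continuous_on UNIV f \<longrightarrow> bounded (range f) \<longrightarrow>
     (\<lambda>n. \<integral>z. f z \<partial>\<mu> n) \<longlonglongrightarrow> (\<integral>z. f z \<partial>\<mu>0))"

lemma weakly_convergesD:
  "weakly_converges \<mu> \<mu>0 \<Longrightarrow> continuous_on UNIV (f :: 'a::topological_space \<Rightarrow> real) \<Longrightarrow>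
    bounded (range f) \<Longrightarrow> (\<lambda>n. \<integral>z. f z \<partial>\<mu> n) \<longlonglongrightarrow> (\<integral>z. f z \<partial>\<mu>0)"
  unfolding weakly_converges_def by blast

lemma prob_onD:
  assumes "\<mu> \<in> prob_on F"
  shows "prob_space \<mu>" "sets \<mu> = sets borel" "space \<mu> = UNIV" "measure \<mu> F = 1"
  using assms sets_eq_imp_space_eq[of \<mu> borel] by (auto simp: prob_on_def space_prob_algebra)

lemma borel_prob_spaceD:
  assumes "\<mu> \<in> space (prob_algebra borel)"
  shows "prob_space \<mu>" "sets \<mu> = sets borel" "space \<mu> = UNIV"
  using assms sets_eq_imp_space_eq[of \<mu> borel] by (auto simp: space_prob_algebra)

lemma prob_on_iff_AE:
  assumes "F \<in> sets borel"
  shows "\<mu> \<in> prob_on F \<longleftrightarrow> \<mu> \<in> space (prob_algebra borel) \<and> (AE z in \<mu>. z \<in> F)"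
  using assms prob_space.prob_eq_1[of \<mu> F] by (auto simp: prob_on_def space_prob_algebra)

lemma prob_on_mono:
  assumes "F \<subseteq> F'" "F \<in> sets borel" "F' \<in> sets borel" "\<mu> \<in> prob_on F"
  shows "\<mu> \<in> prob_on F'"
  using assms by (auto simp: prob_on_iff_AE)

lemma integrable_bounded_borel:
  fixes f :: "'a::topological_space \<Rightarrow> real"
  assumes "\<mu> \<in> space (prob_algebra borel)" "f \<in> borel_measurable borel" "\<And>z. \<bar>f z\<bar> \<le> B"
  shows "integrable \<mu> f"
proof -
  interpret prob_space \<mu> using assms by (auto dest: borel_prob_spaceD)
  have "f \<in> borel_measurable \<mu>" using assms(2) borel_prob_spaceD[OF assms(1)] measurable_cong_sets by blast
  then show ?thesis by (intro integrable_const_bound[where B=B]) (auto simp: assms)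
qed

lemma integral_measurable_prob_algebra:
  fixes f :: "'a \<Rightarrow> real"
  assumes "f \<in> borel_measurable N" "\<And>z. \<bar>f z\<bar> \<le> B"
  shows "(\<lambda>\<mu>. \<integral>z. f z \<partial>\<mu>) \<in> borel_measurable (prob_algebra N)"
proof -
  have [measurable]: "f \<in> borel_measurable N" by fact
  have "(\<lambda>\<mu>. \<integral>z. f z \<partial>\<mu>) \<in> borel_measurable (prob_algebra N) \<longleftrightarrow>
    (\<lambda>\<mu>. enn2real (\<integral>\<^sup>+z. f z + B \<partial>\<mu>) - B) \<in> borel_measurable (prob_algebra N)"
  (* The bound shifts the integrand to a nonnegative one. *)
  proof (rule measurable_cong)
    fix \<mu> assume m: "\<mu> \<in> space (prob_algebra N)"
    then interpret prob_space \<mu> by (auto simp: space_prob_algebra)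
    have fm[measurable]: "f \<in> borel_measurable \<mu>" using m assms(1)
      by (auto simp: space_prob_algebra cong: measurable_cong_sets)
    have i: "integrable \<mu> f" by (intro integrable_const_bound[where B=B]) (auto simp: assms)
    have "0 \<le> f z + B" for z using assms(2)[of z] by linarith
    then have "(\<integral>z. f z + B \<partial>\<mu>) = enn2real (\<integral>\<^sup>+z. f z + B \<partial>\<mu>)" using fm
      by (intro integral_eq_nn_integral) auto
    moreover have "(\<integral>z. f z + B \<partial>\<mu>) = (\<integral>z. f z \<partial>\<mu>) + B" using i by (simp add: prob_space)
    ultimately show "(\<integral>z. f z \<partial>\<mu>) = enn2real (\<integral>\<^sup>+z. f z + B \<partial>\<mu>) - B" by simp
  qed
  also have "\<dots>" unfolding prob_algebra_def by (intro measurable_restrict_space1) measurable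
  finally show ?thesis .
qed

lemma topspace_weak_topology: "topspace weak_topology = space (prob_algebra borel)"
proof -
  have "UNIV \<in> {{\<mu> :: 'a measure. (\<integral>z. f z \<partial>\<mu>) \<in> V} | f V. continuous_on UNIV f \<and> bounded (range f) \<and> open (V :: real set)}"
    by (intro CollectI exI[of _ "\<lambda>_. 0"] exI[of _ UNIV]) auto
  then show ?thesis unfolding weak_topology_def topspace_subtopology topology_generated_by_topspace by blast
qed

text \<open>Every open set is obtained from the generating sets by unions and finite
  intersections, and each generating set only looks at one integral.\<close>

lemma weakly_converges_imp_limitin:
  assumes "weakly_converges \<mu> \<mu>0" "\<And>n. \<mu> n \<in> space (prob_algebra borel)"
    "\<mu>0 \<in> space (prob_algebra borel)"
  shows "limitin weak_topology \<mu> \<mu>0 sequentially"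
proof -
  define S where "S = {{\<mu> :: 'a measure. (\<integral>z. f z \<partial>\<mu>) \<in> V} | f V. continuous_on UNIV f \<and> bounded (range f) \<and> open (V :: real set)}"
  have "generate_topology_on S W \<Longrightarrow> \<mu>0 \<in> W \<Longrightarrow> \<forall>\<^sub>F n in sequentially. \<mu> n \<in> W" for W
  proof (induction rule: generate_topology_on.induct)
    case (UN K)
    then obtain k where "k \<in> K" "\<mu>0 \<in> k" by auto
    with UN have "\<forall>\<^sub>F n in sequentially. \<mu> n \<in> k" by auto
    then show ?case by eventually_elim (use \<open>k \<in> K\<close> in auto)
  next
    case (Basis W)
    then obtain f V where W: "W = {\<mu> :: 'a measure. (\<integral>z. f z \<partial>\<mu>) \<in> V}" "continuous_on UNIV f" "bounded (range f)"
      "open (V :: real set)" unfolding S_def by auto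
    then have "(\<lambda>n. \<integral>z. f z \<partial>\<mu> n) \<longlonglongrightarrow> (\<integral>z. f z \<partial>\<mu>0)" using assms(1) by (auto dest: weakly_convergesD)
    then show ?case using W Basis topological_tendstoD by fastforce
  qed (auto intro: eventually_conj)
  moreover have "\<mu>0 \<in> topspace (topology_generated_by S)"
  proof -
    have "UNIV \<in> S" unfolding S_def
      by (intro CollectI exI[of _ "\<lambda>_. 0"] exI[of _ UNIV]) auto
    then show ?thesis by auto
  qed
  ultimately have "limitin (topology_generated_by S) \<mu> \<mu>0 sequentially"
    by (auto simp: limitin_def openin_topology_generated_by_iff)
  then show ?thesis using assms unfolding weak_topology_def S_def[symmetric]
    by (auto simp: limitin_subtopology)
qed

section \<open>Measures as sequences of integrals\<close>

text \<open>Stability under intersections makes this family determine probability measures; being a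
  basis, it contains arbitrarily small neighbourhoods of every point. The choice is made once and for all, so that
  everything indexed by it does not depend on a proof.\<close>

definition basic_opens :: "'a::second_countable_topology set set" where
  "basic_opens = (SOME \<U>. countable \<U> \<and> Int_stable \<U> \<and> UNIV \<in> \<U> \<and> (\<forall>U\<in>\<U>. open U) \<and>
     topological_basis \<U> \<and> sets borel = sigma_sets UNIV \<U>)"

lemma basic_opens:
  "countable (basic_opens :: 'a::second_countable_topology set set)" "Int_stable (basic_opens :: 'a set set)"
  "UNIV \<in> (basic_opens :: 'a set set)" "U \<in> (basic_opens :: 'a set set) \<Longrightarrow> open U"
  "topological_basis (basic_opens :: 'a set set)"
  "sets borel = sigma_sets UNIV (basic_opens :: 'a set set)"
proof -
  obtain B :: "'a set set" where B: "countable B" "topological_basis B" using ex_countable_basis by auto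
  define \<U> where "\<U> = (\<lambda>F. \<Inter>F) ` {F. finite F \<and> F \<subseteq> B}"
  have c: "countable \<U>" unfolding \<U>_def using countable_Collect_finite_subset[OF B(1)] by auto
  have o: "open U" if "U \<in> \<U>" for U using that B(2) unfolding \<U>_def
    by (auto intro!: open_Inter simp: topological_basis_open)
  have i: "Int_stable \<U>" unfolding Int_stable_def \<U>_def
  proof clarsimp
    fix F F' assume "finite F" "F \<subseteq> B" "finite F'" "F' \<subseteq> B"
    then show "\<Inter>F \<inter> \<Inter>F' \<in> Inter ` {F. finite F \<and> F \<subseteq> B}" by (intro image_eqI[of _ _ "F \<union> F'"]) auto
  qed
  have u: "UNIV \<in> \<U>" unfolding \<U>_def by (intro image_eqI[of _ _ "{}"]) auto
  have "B \<subseteq> \<U>" unfolding \<U>_def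
  proof
    fix b assume "b \<in> B" then show "b \<in> Inter ` {F. finite F \<and> F \<subseteq> B}" by (intro image_eqI[of _ _ "{b}"]) auto
  qed
  then have t: "topological_basis \<U>" using B(2) o unfolding topological_basis_def
    by (meson subset_trans)
  have s: "sets borel = sigma_sets UNIV \<U>" using arg_cong[OF borel_eq_countable_basis[OF c t], of sets] by simp
  have "\<exists>\<U> :: 'a set set. countable \<U> \<and> Int_stable \<U> \<and> UNIV \<in> \<U> \<and> (\<forall>U\<in>\<U>. open U) \<and>
     topological_basis \<U> \<and> sets borel = sigma_sets UNIV \<U>"
    using c i u o t s by blast
  from someI_ex[OF this, folded basic_opens_def] show "countable (basic_opens :: 'a::second_countable_topology set set)" "Int_stable (basic_opens :: 'a set set)"
    "UNIV \<in> (basic_opens :: 'a set set)" "U \<in> (basic_opens :: 'a set set) \<Longrightarrow> open U"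
    "topological_basis (basic_opens :: 'a set set)"
    "sets borel = sigma_sets UNIV (basic_opens :: 'a set set)" by auto
qed

text \<open>Lipschitz functions that increase to the indicator of an open set \<open>U\<close>. The case
  \<open>U = UNIV\<close> is separate because \<^const>\<open>infdist\<close> to the empty set is 0.\<close>

definition bump :: "'a::metric_space set \<Rightarrow> nat \<Rightarrow> 'a \<Rightarrow> real" where
  "bump U n a = (if U = UNIV then 1 else min 1 (real n * infdist a (- U)))"

lemma bump_bounds: "0 \<le> bump U n a" "bump U n a \<le> 1" "\<bar>bump U n a\<bar> \<le> 1"
  by (auto simp: bump_def infdist_nonneg)

lemma continuous_bump: "continuous_on UNIV (bump U n)"
  unfolding bump_def by (cases "U = UNIV") (auto intro!: continuous_intros)

lemma bounded_bump: "bounded (range (bump U n))"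
  using bump_bounds(3) by (auto simp: bounded_iff)

lemma bump_measurable: "bump U n \<in> borel_measurable borel"
  using continuous_bump by (rule borel_measurable_continuous_onI)

lemma bump_tendsto_indicator:
  assumes "open U"
  shows "(\<lambda>n. bump U n a) \<longlonglongrightarrow> indicator U a"
proof (cases "U = UNIV \<or> a \<notin> U")
  case True
  then have "bump U n a = indicator U a" for n by (auto simp: bump_def)
  then show ?thesis by simp
next
  case False
  then have "- U \<noteq> {}" "a \<notin> - U" by auto
  then have "infdist a (- U) > 0" using in_closed_iff_infdist_zero[of "- U" a] assms infdist_nonneg[of a "- U"]
    by (simp add: closed_Compl)
  then have "\<forall>\<^sub>F n in sequentially. bump U n a = 1"
  proof -
    obtain m :: nat where m: "1 / infdist a (- U) < m" using reals_Archimedean2 by blast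
    have "bump U n a = 1" if "n \<ge> m" for n
    proof -
      have "1 < real m * infdist a (- U)" using m \<open>infdist a (- U) > 0\<close> by (simp add: field_simps)
      also have "\<dots> \<le> real n * infdist a (- U)" using that infdist_nonneg by (intro mult_right_mono) auto
      finally show ?thesis by (simp add: bump_def)
    qed
    then show ?thesis using eventually_sequentially by blast
  qed
  then show ?thesis using False by (auto intro: tendsto_eventually)
qed

lemma measure_eq_lim_bump:
  assumes "\<mu> \<in> space (prob_algebra borel)" "open U"
  shows "(\<lambda>n. \<integral>a. bump U n a \<partial>\<mu>) \<longlonglongrightarrow> measure \<mu> U"
proof -
  interpret prob_space \<mu> using assms by (auto dest: borel_prob_spaceD)
  note s = borel_prob_spaceD[OF assms(1)]
  have [measurable]: "bump U n \<in> borel_measurable \<mu>" "U \<in> sets \<mu>" for n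
    using bump_measurable[of U n] assms(2) by (auto simp: s cong: measurable_cong_sets)
  have "(\<lambda>n. \<integral>a. bump U n a \<partial>\<mu>) \<longlonglongrightarrow> (\<integral>a. indicator U a \<partial>\<mu>)"
    by (rule integral_dominated_convergence[where w="\<lambda>_. 1"])
      (auto simp: bump_tendsto_indicator assms bump_bounds)
  then show ?thesis using s by simp
qed

definition test_fun :: "nat \<Rightarrow> 'a::{metric_space,second_countable_topology} \<Rightarrow> real" where
  "test_fun i = (case from_nat_into (basic_opens \<times> UNIV) i of (U, n) \<Rightarrow> bump U n)"

text \<open>This map identifies the Borel probability measures with a set of real sequences. It replaces a metric on
  the space of measures: sequences of reals form a Polish space, and the map is injective, weakly continuous
  and compatible with the evaluation sigma-algebra.\<close>

definition moments :: "'a::{metric_space,second_countable_topology} measure \<Rightarrow> nat \<Rightarrow> real" where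
  "moments \<mu> i = (\<integral>a. test_fun i a \<partial>\<mu>)"

lemma test_fun: "continuous_on UNIV (test_fun i)" "bounded (range (test_fun i))" "\<bar>test_fun i a\<bar> \<le> 1"
  "test_fun i \<in> borel_measurable borel"
  by (auto simp: test_fun_def continuous_bump bounded_bump bump_bounds bump_measurable split: prod.splits)

lemma bump_eq_test_fun:
  assumes "U \<in> basic_opens"
  obtains i where "bump U n = test_fun i"
proof -
  have "countable (basic_opens \<times> (UNIV :: nat set))" using basic_opens(1) by auto
  then obtain i where "from_nat_into (basic_opens \<times> UNIV) i = (U, n)"
    using from_nat_into_surj[of "basic_opens \<times> UNIV" "(U, n)"] assms by auto
  then have "bump U n = test_fun i" unfolding test_fun_def fun_eq_iff by simp
  then show ?thesis by (rule that)
qed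

lemma prob_algebra_eqI:
  fixes \<mu> \<nu> :: "'a::second_countable_topology measure"
  assumes m: "\<mu> \<in> space (prob_algebra borel)" "\<nu> \<in> space (prob_algebra borel)"
    and eqU: "\<And>U. U \<in> basic_opens \<Longrightarrow> measure \<mu> U = measure \<nu> U"
  shows "\<mu> = \<nu>"
proof -
  note s = borel_prob_spaceD[OF m(1)] borel_prob_spaceD[OF m(2)]
  show ?thesis
  proof (rule measure_eqI_generator_eq[OF basic_opens(2), of UNIV _ _ "\<lambda>_. UNIV"])
    show "emeasure \<mu> X = emeasure \<nu> X" if "X \<in> basic_opens" for X
      using eqU[OF that] s by (simp add: prob_space.finite_measure finite_measure.emeasure_eq_measure)
    show "emeasure \<mu> UNIV \<noteq> \<infinity>" using s by (simp add: prob_space.finite_measure finite_measure.emeasure_eq_measure)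
  qed (use basic_opens s in auto)
qed

lemma moments_inj:
  "inj_on moments (space (prob_algebra (borel :: 'a::{metric_space,second_countable_topology} measure)))"
proof (rule inj_onI)
  fix \<mu> \<nu> :: "'a measure"
  assume m: "\<mu> \<in> space (prob_algebra borel)" "\<nu> \<in> space (prob_algebra borel)" and eq: "moments \<mu> = moments \<nu>"
  have eqU: "measure \<mu> U = measure \<nu> U" if "U \<in> basic_opens" for U
  proof -
    have "(\<integral>a. bump U n a \<partial>\<mu>) = (\<integral>a. bump U n a \<partial>\<nu>)" for n
      using eq bump_eq_test_fun[OF that, of n] by (metis moments_def)
    then show ?thesis using measure_eq_lim_bump[OF m(1) basic_opens(4)[OF that]]
      measure_eq_lim_bump[OF m(2) basic_opens(4)[OF that]] LIMSEQ_unique by auto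
  qed
  then show "\<mu> = \<nu>" using m by (intro prob_algebra_eqI)
qed

text \<open>In the direction from moments to measures, the mass of a basic open set is the limit of the
  integrals of its bumps, hence a measurable function of the moments.\<close>

lemma measurable_moments_iff:
  fixes \<kappa> :: "'w \<Rightarrow> 'a::{metric_space,second_countable_topology} measure"
  assumes "\<And>\<omega>. \<omega> \<in> space N \<Longrightarrow> \<kappa> \<omega> \<in> space (prob_algebra borel)"
  shows "\<kappa> \<in> N \<rightarrow>\<^sub>M prob_algebra borel \<longleftrightarrow> (\<lambda>\<omega>. moments (\<kappa> \<omega>)) \<in> borel_measurable N"
proof
  assume k: "\<kappa> \<in> N \<rightarrow>\<^sub>M prob_algebra borel"
  show "(\<lambda>\<omega>. moments (\<kappa> \<omega>)) \<in> borel_measurable N"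
  proof (rule measurable_coordinatewise_then_product)
    fix i
    show "(\<lambda>\<omega>. moments (\<kappa> \<omega>) i) \<in> borel_measurable N" unfolding moments_def
      using measurable_compose[OF k integral_measurable_prob_algebra[OF test_fun(4,3)]] .
  qed
next
  assume "(\<lambda>\<omega>. moments (\<kappa> \<omega>)) \<in> borel_measurable N"
  then have mi: "(\<lambda>\<omega>. moments (\<kappa> \<omega>) i) \<in> borel_measurable N" for i
    by (rule measurable_product_then_coordinatewise)
  have "\<kappa> \<in> N \<rightarrow>\<^sub>M subprob_algebra borel"
  proof (rule measurable_subprob_algebra_generated[OF basic_opens(6) basic_opens(2)])
    fix \<omega> assume "\<omega> \<in> space N"
    note s = borel_prob_spaceD[OF assms[OF this]]
    show "subprob_space (\<kappa> \<omega>)" using s by (simp add: prob_space_imp_subprob_space)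
    show "sets (\<kappa> \<omega>) = sets borel" using s by simp
  next
    fix U :: "'a set" assume U: "U \<in> basic_opens"
    have "(\<lambda>\<omega>. measure (\<kappa> \<omega>) U) \<in> borel_measurable N"
    proof (rule borel_measurable_LIMSEQ_real)
      show "(\<lambda>n. \<integral>a. bump U n a \<partial>\<kappa> \<omega>) \<longlonglongrightarrow> measure (\<kappa> \<omega>) U" if "\<omega> \<in> space N" for \<omega>
        using that assms U basic_opens(4) by (intro measure_eq_lim_bump) auto
      show "(\<lambda>\<omega>. \<integral>a. bump U n a \<partial>\<kappa> \<omega>) \<in> borel_measurable N" for n
        using bump_eq_test_fun[OF U, of n] mi unfolding moments_def by metis
    qed
    moreover have "emeasure (\<kappa> \<omega>) U = ennreal (measure (\<kappa> \<omega>) U)" if "\<omega> \<in> space N" for \<omega>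
      using borel_prob_spaceD(1)[OF assms[OF that]]
      by (simp add: prob_space.finite_measure finite_measure.emeasure_eq_measure)
    ultimately show "(\<lambda>\<omega>. emeasure (\<kappa> \<omega>) U) \<in> borel_measurable N"
      by (simp cong: measurable_cong)
  next
    have "emeasure (\<kappa> \<omega>) UNIV = 1" if "\<omega> \<in> space N" for \<omega>
      using borel_prob_spaceD[OF assms[OF that]] by (metis prob_space.emeasure_space_1)
    then show "(\<lambda>\<omega>. emeasure (\<kappa> \<omega>) UNIV) \<in> borel_measurable N" by (simp cong: measurable_cong)
  qed auto
  then show "\<kappa> \<in> N \<rightarrow>\<^sub>M prob_algebra borel"
    using assms by (intro measurable_prob_algebraI) (auto dest: borel_prob_spaceD)
qed

lemma continuous_map_moments:
  "continuous_map weak_topology euclidean (moments :: 'a::{metric_space,second_countable_topology} measure \<Rightarrow> _)"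
proof -
  have "continuous_map weak_topology euclidean (\<lambda>\<mu>::'a measure. moments \<mu> i)" for i
    unfolding weak_topology_def
  proof (rule continuous_map_from_subtopology)
    let ?S = "{{\<mu> :: 'a measure. (\<integral>z. f z \<partial>\<mu>) \<in> V} | f V. continuous_on UNIV f \<and> bounded (range f) \<and> open (V :: real set)}"
    have "{\<mu> :: 'a measure. moments \<mu> i \<in> V} \<in> ?S" if "open V" for V
      unfolding moments_def using test_fun[of i] that by blast
    from topology_generated_by_Basis[OF this]
    have o: "openin (topology_generated_by ?S) {\<mu> :: 'a measure. moments \<mu> i \<in> V}" if "open V" for V
      using that by blast
    then have "topspace (topology_generated_by ?S) = UNIV" using openin_subset[OF o[of UNIV]] by auto
    then show "continuous_map (topology_generated_by ?S) euclidean (\<lambda>\<mu>::'a measure. moments \<mu> i)"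
      using o by (simp add: continuous_map_def)
  qed
  then have "continuous_map weak_topology (product_topology (\<lambda>i. euclidean) UNIV) (moments :: 'a measure \<Rightarrow> _)"
    by (subst continuous_map_componentwise_UNIV) auto
  then show ?thesis by (simp add: euclidean_product_topology)
qed

lemma weakly_converges_moments:
  assumes "weakly_converges \<mu> \<mu>0"
  shows "(\<lambda>n. moments (\<mu> n)) \<longlonglongrightarrow> moments (\<mu>0 :: 'a::{metric_space,second_countable_topology} measure)"
proof -
  have "limitin (product_topology (\<lambda>i. euclidean) UNIV) (\<lambda>n. moments (\<mu> n)) (moments \<mu>0) sequentially"
    unfolding limitin_componentwise using assms test_fun(1,2)
    by (auto simp: moments_def intro: weakly_convergesD)
  then show ?thesis by (simp add: euclidean_product_topology)
qed

section \<open>Sequential compactness of the probability measures on a compact set\<close>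

text \<open>The digits 0 and 2 in base 3 record to which basic open sets a point belongs. As for the Cantor
  set, the unused digit leaves gaps, so that close codes have equal leading digits.\<close>

definition ternary_code :: "'a::second_countable_topology \<Rightarrow> real" where
  "ternary_code a = (\<Sum>j. 2 * indicator (from_nat_into basic_opens j) a / 3 ^ Suc j)"

lemma ternary_tail_sums: "(\<lambda>j. 2 / 3 ^ Suc (j + m)) sums (1 / 3 ^ m :: real)"
proof -
  have "(\<lambda>j. (2 / 3 ^ Suc m) * (1 / 3 :: real) ^ j) sums ((2 / 3 ^ Suc m) * (1 / (1 - 1 / 3)))"
    by (intro sums_mult geometric_sums) auto
  then show ?thesis by (simp add: power_add power_divide mult_ac)
qed

lemma ternary_code_summable:
  "summable (\<lambda>j. 2 * indicator (from_nat_into basic_opens (j + m)) a / 3 ^ Suc (j + m) :: real)"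
  by (rule summable_comparison_test[OF _ sums_summable[OF ternary_tail_sums[of m]]])
    (auto intro!: exI[of _ 0] simp: indicator_def)

lemma ternary_code_tail:
  "0 \<le> (\<Sum>j. 2 * indicator (from_nat_into basic_opens (j + m)) a / 3 ^ Suc (j + m) :: real)"
  "(\<Sum>j. 2 * indicator (from_nat_into basic_opens (j + m)) a / 3 ^ Suc (j + m) :: real) \<le> 1 / 3 ^ m"
proof -
  show "0 \<le> (\<Sum>j. 2 * indicator (from_nat_into basic_opens (j + m)) a / 3 ^ Suc (j + m) :: real)"
    by (intro suminf_nonneg ternary_code_summable) auto
  have "(\<Sum>j. 2 * indicator (from_nat_into basic_opens (j + m)) a / 3 ^ Suc (j + m) :: real) \<le> (\<Sum>j. 2 / 3 ^ Suc (j + m))"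
    by (intro suminf_le ternary_code_summable sums_summable[OF ternary_tail_sums]) (auto simp: indicator_def)
  then show "(\<Sum>j. 2 * indicator (from_nat_into basic_opens (j + m)) a / 3 ^ Suc (j + m) :: real) \<le> 1 / 3 ^ m"
    using sums_unique[OF ternary_tail_sums[of m]] by simp
qed

lemma ternary_code_split:
  "ternary_code a = (\<Sum>j. 2 * indicator (from_nat_into basic_opens (j + m)) a / 3 ^ Suc (j + m))
     + (\<Sum>j<m. 2 * indicator (from_nat_into basic_opens j) a / 3 ^ Suc j)"
  unfolding ternary_code_def using ternary_code_summable[of 0 a] by (subst suminf_split_initial_segment[of _ m]) auto

lemma ternary_code_bounds: "0 \<le> ternary_code a" "ternary_code a \<le> 1"
  using ternary_code_tail[of 0 a] by (simp_all add: ternary_code_def)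

lemma ternary_code_measurable: "ternary_code \<in> borel_measurable borel"
proof -
  have "(basic_opens :: 'a set set) \<noteq> {}" using basic_opens(3) by blast
  then have [measurable]: "(from_nat_into basic_opens j :: 'a set) \<in> sets borel" for j :: nat
    by (intro borel_open basic_opens(4) from_nat_into)
  show ?thesis unfolding ternary_code_def by measurable
qed

text \<open>At the first digit where the codes differ the difference is \<open>2 / 3 ^ Suc j\<close>, and the
  remaining digits make up for at most half of it.\<close>

lemma ternary_code_close:
  fixes a b :: "'a::second_countable_topology"
  assumes "\<bar>ternary_code a - ternary_code b\<bar> < 1 / 3 ^ N" "j < N"
  shows "a \<in> from_nat_into basic_opens j \<longleftrightarrow> b \<in> from_nat_into basic_opens j"
  using assms(2)
proof (induction j rule: less_induct)
  case (less j)
  let ?t = "\<lambda>c. \<Sum>i. 2 * indicator (from_nat_into basic_opens (i + Suc j)) c / 3 ^ Suc (i + Suc j) :: real"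
  let ?i = "\<lambda>c. 2 * indicator (from_nat_into basic_opens j) c / 3 ^ Suc j :: real"
  have split: "ternary_code c = ?t c + (\<Sum>i<j. 2 * indicator (from_nat_into basic_opens i) c / 3 ^ Suc i) + ?i c" for c :: 'a
    by (subst ternary_code_split[of c "Suc j"]) simp
  moreover have "(\<Sum>i<j. 2 * indicator (from_nat_into basic_opens i) a / 3 ^ Suc i :: real) =
    (\<Sum>i<j. 2 * indicator (from_nat_into basic_opens i) b / 3 ^ Suc i)"
    using less by (intro sum.cong refl) (auto simp: indicator_def)
  ultimately have "ternary_code a - ternary_code b = ?t a - ?t b + (?i a - ?i b)"
    using split[of a] split[of b] by linarith
  moreover have "\<bar>?t a - ?t b\<bar> \<le> 1 / 3 ^ Suc j"
    using ternary_code_tail[of "Suc j" a] ternary_code_tail[of "Suc j" b] by linarith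
  moreover have "(1 / 3 ^ N :: real) \<le> 1 / 3 ^ Suc j"
    using less.prems by (intro divide_left_mono power_increasing) auto
  ultimately have "\<bar>?i a - ?i b\<bar> < 2 * (1 / 3 ^ Suc j)" using assms(1) by linarith
  then show ?case
    by (cases "a \<in> from_nat_into basic_opens j"; cases "b \<in> from_nat_into basic_opens j") auto
qed

text \<open>Finitely many basic open sets of small diameter cover \<open>K\<close>. Points whose codes are close
  lie in the same ones, so they are close to each other: the inverse of the code is uniformly continuous and extends to the
  closure, still with values in \<open>K\<close>.\<close>

lemma ternary_code_inverse:
  fixes K :: "'a::polish_space set"
  assumes "compact K"
  obtains h where "continuous_on (closure (ternary_code ` K)) h" "h ` closure (ternary_code ` K) \<subseteq> K"
    "\<And>a. a \<in> K \<Longrightarrow> h (ternary_code a) = a"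
proof -
  let ?U = "from_nat_into (basic_opens :: 'a set set)"
  have key: "\<exists>N. \<forall>a\<in>K. \<forall>b. \<bar>ternary_code a - ternary_code b\<bar> < 1 / 3 ^ N \<longrightarrow> dist a b < e" if e: "e > 0" for e
  proof -
    have c: "\<exists>j. a \<in> ?U j \<and> ?U j \<subseteq> ball a (e/2)" for a
    proof -
      obtain U where "U \<in> basic_opens" "a \<in> U" "U \<subseteq> ball a (e/2)"
        using topological_basisE[OF basic_opens(5) open_ball, of a a "e/2"] e by auto
      then show ?thesis using from_nat_into_surj[OF basic_opens(1)] by metis
    qed
    then obtain J where J: "\<And>a. a \<in> ?U (J a)" "\<And>a. ?U (J a) \<subseteq> ball a (e/2)" by metis
    have "open (?U j)" for j using basic_opens(4)[OF from_nat_into, of j] basic_opens(3) by auto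
    then obtain F where F: "F \<subseteq> K" "finite F" "K \<subseteq> (\<Union>a\<in>F. ?U (J a))"
    proof (rule compactE_image[OF assms, of K "\<lambda>a. ?U (J a)"])
      show "K \<subseteq> (\<Union>a\<in>K. ?U (J a))" using J(1) by blast
    qed auto
    define N where "N = Suc (Max (J ` F))"
    have "dist a b < e" if ab: "a \<in> K" "\<bar>ternary_code a - ternary_code b\<bar> < 1 / 3 ^ N" for a b
    proof -
      obtain c where c: "c \<in> F" "a \<in> ?U (J c)" using F ab(1) by blast
      have "J c < N" using F(2) c(1) unfolding N_def by (simp add: less_Suc_eq_le)
      then have "b \<in> ?U (J c)" using ternary_code_close[OF ab(2)] c by blast
      then have "dist c a < e/2" "dist c b < e/2" using J(2)[of c] c by auto
      then show ?thesis using dist_triangle_half_r by blast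
    qed
    then show ?thesis by blast
  qed
  have inj: "inj_on ternary_code K"
  proof (rule inj_onI)
    fix a b assume ab: "a \<in> K" "b \<in> K" "ternary_code a = ternary_code b"
    have "dist a b < e" if "e > 0" for e using key[OF that] ab by auto
    then show "a = b" using zero_less_dist_iff by blast
  qed
  define g where "g = inv_into K ternary_code"
  have g: "g (ternary_code a) = a" if "a \<in> K" for a using inj that by (simp add: g_def)
  have "uniformly_continuous_on (ternary_code ` K) g"
    unfolding uniformly_continuous_on_def
  proof (intro allI impI)
    fix e :: real assume "e > 0"
    from key[OF this] obtain N where N: "\<And>a b. a \<in> K \<Longrightarrow> \<bar>ternary_code a - ternary_code b\<bar> < 1 / 3 ^ N \<Longrightarrow> dist a b < e" by blast
    show "\<exists>d>0. \<forall>x\<in>ternary_code ` K. \<forall>x'\<in>ternary_code ` K. dist x' x < d \<longrightarrow> dist (g x') (g x) < e"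
      using N g by (intro exI[of _ "1 / 3 ^ N"]) (auto simp: dist_real_def)
  qed
  then obtain h where h: "uniformly_continuous_on (closure (ternary_code ` K)) h"
    "\<And>x. x \<in> ternary_code ` K \<Longrightarrow> g x = h x"
    using uniformly_continuous_on_extension_on_closure by metis
  have ch: "continuous_on (closure (ternary_code ` K)) h" using h(1) by (rule uniformly_continuous_imp_continuous)
  have "h ` (ternary_code ` K) \<subseteq> K" using h(2) g by force
  then have "h ` closure (ternary_code ` K) \<subseteq> K"
    using image_closure_subset[OF ch compact_imp_closed[OF assms]] by blast
  then show ?thesis using ch h(2) g by (intro that) auto
qed

text \<open>The code carries the measures to the unit interval, where Helly's theorem gives a
  convergent subsequence, and the continuous inverse carries the limit back. The code itself need not be continuous, which is
  harmless: only integrals of functions composed with the inverse have to converge.\<close>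

lemma prob_on_compact_convergent_subsequence:
  fixes K :: "'a::polish_space set"
  assumes K: "compact K" and \<mu>: "\<And>n. \<mu> n \<in> prob_on K"
  obtains r l where "strict_mono (r :: nat \<Rightarrow> nat)" "l \<in> prob_on K" "weakly_converges (\<mu> \<circ> r) l"
proof -
  let ?s = "ternary_code :: 'a \<Rightarrow> real"
  define C where "C = closure (?s ` K)"
  obtain h where h: "continuous_on C h" "h ` C \<subseteq> K" "\<And>a. a \<in> K \<Longrightarrow> h (?s a) = a"
    using ternary_code_inverse[OF K] unfolding C_def by blast
  have C: "closed C" by (simp add: C_def)
  have Kb: "K \<in> sets borel" using compact_imp_closed[OF K] by auto
  note m = prob_onD[OF \<mu>]
  have s[measurable]: "?s \<in> borel_measurable (\<mu> n)" for n
    using ternary_code_measurable m(2)[of n] by (auto cong: measurable_cong_sets)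
  have aeK: "AE a in \<mu> n. a \<in> K" for n using \<mu>[of n] Kb by (auto simp: prob_on_iff_AE)
  then obtain a0 where a0: "a0 \<in> K" using m(4)[of 0] by (cases "K = {}") auto
  then have C0: "C \<noteq> {}" by (auto simp: C_def)
  define \<nu> where "\<nu> n = distr (\<mu> n) borel ?s" for n
  have rd: "real_distribution (\<nu> n)" for n
    unfolding \<nu>_def using prob_space.real_distribution_distr[OF m(1) s] by simp
  have "tight \<nu>" unfolding tight_def
  proof (intro conjI allI impI rd)
    fix e :: real assume e: "e > 0"
    have "measure (\<nu> n) {-1<..1} = 1" for n
    proof -
      have "?s -` {-1<..1} \<inter> space (\<mu> n) = space (\<mu> n)"
        using less_le_trans[OF _ ternary_code_bounds(1), of "-1"] ternary_code_bounds(2) by auto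
      then show ?thesis unfolding \<nu>_def using m(1)[of n] by (simp add: measure_distr prob_space.prob_space)
    qed
    then show "\<exists>a b. a < b \<and> (\<forall>n. 1 - e < measure (\<nu> n) {a<..b})"
      using e by (intro exI[of _ "-1"] exI[of _ 1]) auto
  qed
  from tight_imp_convergent_subsubsequence[OF this strict_mono_id] obtain r \<nu>' where
    r: "strict_mono r" and \<nu>': "real_distribution \<nu>'" and conv: "weak_conv_m (\<nu> \<circ> r) \<nu>'" by auto
  interpret N: real_distribution \<nu>' by fact
  have lim: "(\<lambda>n. \<integral>x. f x \<partial>\<nu> (r n)) \<longlonglongrightarrow> (\<integral>x. f x \<partial>\<nu>')"
    if "continuous_on UNIV f" "\<And>x. \<bar>f x\<bar> \<le> B" for f :: "real \<Rightarrow> real" and B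
    using weak_conv_imp_integral_bdd_continuous_conv[of "\<nu> \<circ> r" \<nu>' f B] rd \<nu>' conv that
    by (auto simp: continuous_on_eq_continuous_at)
  have int: "(\<integral>x. f x \<partial>\<nu> n) = (\<integral>a. f (?s a) \<partial>\<mu> n)" if "continuous_on UNIV f" for f :: "real \<Rightarrow> real" and n
    unfolding \<nu>_def using that by (intro integral_distr) (auto intro: borel_measurable_continuous_onI)
  (* Every measure nu n charges only C, and this survives the limit since C is closed. *)
  have "AE x in \<nu>'. x \<in> C"
  proof -
    let ?f = "\<lambda>x. min 1 (infdist x C)"
    have cf: "continuous_on UNIV ?f" by (intro continuous_intros)
    have "(\<integral>a. ?f (?s a) \<partial>\<mu> n) = 0" for n
    proof -
      have "AE a in \<mu> n. ?f (?s a) = 0" using aeK[of n]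
      proof eventually_elim
        case (elim a)
        then have "?s a \<in> C" by (auto simp: C_def intro!: closure_subset[THEN subsetD])
        then show ?case by simp
      qed
      then show ?thesis by (rule integral_eq_zero_AE)
    qed
    then have "(\<integral>x. ?f x \<partial>\<nu>') = 0"
      using lim[OF cf, of 1] int[OF cf] by (simp add: infdist_nonneg LIMSEQ_const_iff)
    moreover have "integrable \<nu>' ?f"
      using borel_measurable_continuous_onI[OF cf] by (intro N.integrable_const_bound[where B=1])
        (auto simp: infdist_nonneg cong: measurable_cong_sets)
    ultimately have "AE x in \<nu>'. ?f x = 0"
      by (subst (asm) integral_nonneg_eq_0_iff_AE) (auto simp: infdist_nonneg)
    then show ?thesis
    proof eventually_elim
      case (elim x)
      then have "infdist x C = 0" by (simp add: min_def split: if_splits)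
      then show ?case using in_closed_iff_infdist_zero[OF C C0] by simp
    qed
  qed
  (* Outside C, a null set for the limit, the value is an arbitrary point of K. *)
  define h' where "h' x = (if x \<in> C then h x else a0)" for x
  have h'm: "h' \<in> borel_measurable borel"
  proof -
    have "h \<in> borel_measurable (restrict_space borel C)" using h(1) by (rule borel_measurable_continuous_on_restrict)
    then show ?thesis unfolding h'_def using C by (subst measurable_If_restrict_space_iff) (auto simp: Int_def)
  qed
  have h'm': "h' \<in> \<nu>' \<rightarrow>\<^sub>M borel" using h'm by (simp cong: measurable_cong_sets)
  define l where "l = distr \<nu>' borel h'"
  have l: "l \<in> prob_on K"
  proof -
    have "prob_space l" unfolding l_def using h'm' by (rule N.prob_space_distr)
    moreover have "AE z in l. z \<in> K"
      unfolding l_def using h'm' Kb h(2) a0 by (subst AE_distr_iff) (auto simp: h'_def)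
    moreover have "sets l = sets borel" by (simp add: l_def)
    ultimately show ?thesis using Kb by (simp add: prob_on_iff_AE space_prob_algebra)
  qed
  have "weakly_converges (\<mu> \<circ> r) l" unfolding weakly_converges_def
  proof (intro allI impI)
    fix f :: "'a \<Rightarrow> real" assume f: "continuous_on UNIV f" "bounded (range f)"
    then obtain B where B: "\<And>a. \<bar>f a\<bar> \<le> B" by (auto simp: bounded_iff)
    then have B0: "0 \<le> B" using order_trans[OF abs_ge_zero] by blast
    have "continuous_on C (f \<circ> h)" using continuous_on_compose[OF h(1) continuous_on_subset[OF f(1)]] by simp
    (* Weak convergence on the line needs a continuous integrand on all of it: Tietze. *)
    then obtain g where g: "continuous_on UNIV g" "\<And>x. x \<in> C \<Longrightarrow> g x = f (h x)" "\<And>x. \<bar>g x\<bar> \<le> B"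
      using Tietze[of C "f \<circ> h" UNIV B] C B B0 by (auto simp: o_def)
    have gm: "g \<in> borel_measurable borel" "f \<in> borel_measurable borel"
      using g f by (auto intro: borel_measurable_continuous_onI)
    have "(\<integral>a. f a \<partial>\<mu> n) = (\<integral>x. g x \<partial>\<nu> n)" for n
    proof -
      have "(\<integral>x. g x \<partial>\<nu> n) = (\<integral>a. g (?s a) \<partial>\<mu> n)" by (rule int[OF g(1)])
      also have "\<dots> = (\<integral>a. f a \<partial>\<mu> n)"
      proof (rule integral_cong_AE)
        show "AE a in \<mu> n. g (?s a) = f a" using aeK[of n]
        proof eventually_elim
          case (elim a)
          then have "?s a \<in> C" by (auto simp: C_def intro!: closure_subset[THEN subsetD])
          then show ?case using elim g(2) h(3) by simp
        qed
        show "(\<lambda>a. g (?s a)) \<in> borel_measurable (\<mu> n)" by (rule measurable_compose[OF s gm(1)])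
        show "f \<in> borel_measurable (\<mu> n)" using gm(2) by (simp add: m(2) cong: measurable_cong_sets)
      qed
      finally show ?thesis by simp
    qed
    moreover have "(\<integral>x. g x \<partial>\<nu>') = (\<integral>a. f a \<partial>l)"
    proof -
      have "(\<integral>a. f a \<partial>l) = (\<integral>x. f (h' x) \<partial>\<nu>')" unfolding l_def using h'm' gm by (intro integral_distr)
      also have "\<dots> = (\<integral>x. g x \<partial>\<nu>')"
      proof (rule integral_cong_AE)
        show "AE x in \<nu>'. f (h' x) = g x" using \<open>AE x in \<nu>'. x \<in> C\<close>
          by eventually_elim (auto simp: h'_def g)
        show "(\<lambda>x. f (h' x)) \<in> borel_measurable \<nu>'" by (rule measurable_compose[OF h'm' gm(2)])
        show "g \<in> borel_measurable \<nu>'" using gm(1) by (simp cong: measurable_cong_sets)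
      qed
      finally show ?thesis by simp
    qed
    ultimately show "(\<lambda>n. \<integral>z. f z \<partial>(\<mu> \<circ> r) n) \<longlonglongrightarrow> (\<integral>z. f z \<partial>l)"
      using lim[OF g(1) g(3)] by simp
  qed
  then show ?thesis using that r l by blast
qed

lemma compact_moments_image:
  fixes K :: "'a::polish_space set"
  assumes K: "compact K" and S: "S \<subseteq> prob_on K"
    and closed: "\<And>\<mu> l. (\<And>n. \<mu> n \<in> S) \<Longrightarrow> l \<in> prob_on K \<Longrightarrow> weakly_converges \<mu> l \<Longrightarrow> l \<in> S"
  shows "compact (moments ` S)"
  unfolding compact_eq_seq_compact_metric seq_compact_def
proof (intro allI impI)
  fix y :: "nat \<Rightarrow> nat \<Rightarrow> real" assume "\<forall>n. y n \<in> moments ` S"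
  then have "\<forall>n. \<exists>m. m \<in> S \<and> y n = moments m" by blast
  from choice[OF this] obtain \<mu> where \<mu>: "\<And>n. \<mu> n \<in> S" "\<And>n. y n = moments (\<mu> n)" by blast
  obtain r l where r: "strict_mono (r :: nat \<Rightarrow> nat)" "l \<in> prob_on K" "weakly_converges (\<mu> \<circ> r) l"
    using prob_on_compact_convergent_subsequence[OF K, of \<mu>] \<mu> S by blast
  have "l \<in> S" using closed[OF _ r(2,3)] \<mu> by simp
  then show "\<exists>l\<in>moments ` S. \<exists>r. strict_mono r \<and> (y \<circ> r) \<longlonglongrightarrow> l"
  proof (intro bexI[of _ "moments l"] exI[of _ r] conjI)
    have "y \<circ> r = (\<lambda>n. moments ((\<mu> \<circ> r) n))" unfolding fun_eq_iff o_apply \<mu>(2) by blast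
    then show "(y \<circ> r) \<longlonglongrightarrow> moments l" using weakly_converges_moments[OF r(3)] by metis
  qed (use r in auto)
qed

text \<open>The moments are weakly continuous and injective on probability measures, so
  \<open>S\<close> is the preimage of the compact set \<open>moments ` S\<close>. Thus sequences suffice to test closedness
  without any countability property of the weak topology.\<close>

lemma closedin_weak_topology_sequential:
  fixes K :: "'a::polish_space set"
  assumes "compact K" "S \<subseteq> prob_on K"
    and "\<And>\<mu> l. (\<And>n. \<mu> n \<in> S) \<Longrightarrow> l \<in> prob_on K \<Longrightarrow> weakly_converges \<mu> l \<Longrightarrow> l \<in> S"
  shows "closedin weak_topology S"
proof -
  have S: "S \<subseteq> space (prob_algebra borel)" using assms(2) by (auto simp: prob_on_def)
  have "closed (moments ` S)" using compact_moments_image[OF assms] by (rule compact_imp_closed)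
  then have *: "closedin weak_topology {\<mu> \<in> topspace weak_topology. moments \<mu> \<in> moments ` S}"
    using closedin_continuous_map_preimage[OF continuous_map_moments] by simp
  have "{\<mu> \<in> topspace weak_topology. moments \<mu> \<in> moments ` S} = S"
    using S moments_inj unfolding topspace_weak_topology by (auto simp: inj_on_def)
  with * show ?thesis by metis
qed

section \<open>Minimisers of set-valued maps and measurable selection\<close>

text \<open>If no minimum were attained, every \<open>y\<close> would admit a level \<open>q y\<close> below
  \<open>h y\<close> and above some other value. The open sets where \<open>h\<close> exceeds these levels cover
  \<open>S\<close>, and the least level of a finite subcover contradicts its own choice.\<close>

lemma compact_attains_min_level_closed:
  fixes h :: "'e::topological_space \<Rightarrow> ereal"
  assumes S: "compact S" "S \<noteq> {}" and lev: "\<And>r::real. closed {y\<in>S. h y \<le> ereal r}"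
  obtains y where "y \<in> S" "\<And>z. z \<in> S \<Longrightarrow> h y \<le> h z"
proof (rule ccontr)
  assume "\<not> thesis"
  with that have "\<forall>y\<in>S. \<exists>z\<in>S. h z < h y" by (meson not_le)
  then have "\<forall>y\<in>S. \<exists>q::real. (\<exists>z\<in>S. h z < ereal q) \<and> ereal q < h y"
    using ereal_dense2 by blast
  from bchoice[OF this] obtain q :: "'e \<Rightarrow> real" where q: "\<And>y. y \<in> S \<Longrightarrow> \<exists>z\<in>S. h z < ereal (q y)"
    "\<And>y. y \<in> S \<Longrightarrow> ereal (q y) < h y" by blast
  have cov: "S \<subseteq> (\<Union>y\<in>S. - {z\<in>S. h z \<le> ereal (q y)})" using q(2) by (fastforce simp: not_le)
  obtain F where F: "F \<subseteq> S" "finite F" "S \<subseteq> (\<Union>y\<in>F. - {z\<in>S. h z \<le> ereal (q y)})"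
  proof (rule compactE_image[OF S(1), of S "\<lambda>y. - {z\<in>S. h z \<le> ereal (q y)}"])
    show "open (- {z\<in>S. h z \<le> ereal (q y)})" for y by (rule open_Compl[OF lev])
  qed (use cov in blast)+
  then have "F \<noteq> {}" using S(2) by auto
  define m where "m = Min (q ` F)"
  have "m \<in> q ` F" unfolding m_def using F(2) \<open>F \<noteq> {}\<close> by (intro Min_in) auto
  then obtain y where y: "y \<in> F" "m = q y" by blast
  obtain z where z: "z \<in> S" "h z < ereal m" using q(1)[of y] y F(1) by blast
  then obtain y' where "y' \<in> F" "h z > ereal (q y')" using F(3) by (fastforce simp: not_le)
  moreover have "m \<le> q y'" unfolding m_def using F(2) \<open>y' \<in> F\<close> by auto
  ultimately show False using z(2) by (metis ereal_less_eq(3) less_le_not_le order_trans less_imp_le)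
qed

text \<open>Measurability of a set-valued map, tested on closed sets. For compact values this form is
  preserved by minimisation, as \<open>minimisers_hit_measurable\<close> shows.\<close>

definition hit_measurable :: "'x measure \<Rightarrow> ('x \<Rightarrow> 'e::topological_space set) \<Rightarrow> bool" where
  "hit_measurable M N \<longleftrightarrow> (\<forall>D. closed D \<longrightarrow> {x \<in> space M. N x \<inter> D \<noteq> {}} \<in> sets M)"

definition minimisers :: "('e \<Rightarrow> 'b::order) \<Rightarrow> 'e set \<Rightarrow> 'e set" where
  "minimisers h S = {y \<in> S. \<forall>z\<in>S. h y \<le> h z}"

lemma minimisers_compact:
  fixes h :: "'e::t2_space \<Rightarrow> ereal"
  assumes S: "compact S" "S \<noteq> {}" and lev: "\<And>r::real. closed {y\<in>S. h y \<le> ereal r}"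
  shows "compact (minimisers h S)" "minimisers h S \<noteq> {}"
proof -
  obtain y where y: "y \<in> S" "\<And>z. z \<in> S \<Longrightarrow> h y \<le> h z" using compact_attains_min_level_closed[OF S lev] by blast
  then show "minimisers h S \<noteq> {}" by (auto simp: minimisers_def)
  have "minimisers h S = S \<inter> (\<Inter>r\<in>{r::real. h y \<le> ereal r}. {z\<in>S. h z \<le> ereal r})"
  proof safe
    fix z assume z: "z \<in> S" "z \<in> (\<Inter>r\<in>{r::real. h y \<le> ereal r}. {z\<in>S. h z \<le> ereal r})"
    have "h z \<le> h y"
    proof (rule ereal_le_real)
      fix r :: real assume "h y \<le> ereal r" then show "h z \<le> ereal r" using z by auto
    qed
    then show "z \<in> minimisers h S" using y z by (auto simp: minimisers_def intro: order_trans)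
  qed (use y(1) in \<open>auto simp: minimisers_def intro: order_trans\<close>)
  also have "compact \<dots>" using lev by (intro compact_Int_closed S closed_INT) auto
  finally show "compact (minimisers h S)" .
qed

text \<open>The minimisers over \<open>N x\<close> meet \<open>D\<close> iff \<open>N x \<inter> D\<close> is nonempty and the minimum over it
  does not exceed the minimum over \<open>N x\<close>. If it does exceed it, a rational number lies in
  between, so the condition involves only countably many sublevel sets.\<close>

lemma minimisers_hit_measurable:
  fixes h :: "'x \<Rightarrow> 'e::t2_space \<Rightarrow> ereal"
  assumes N: "\<And>x. x \<in> space M \<Longrightarrow> compact (N x)" "\<And>x. x \<in> space M \<Longrightarrow> N x \<noteq> {}"
    and lev: "\<And>x r::real. x \<in> space M \<Longrightarrow> closed {y\<in>N x. h x y \<le> ereal r}"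
    and fin: "\<And>x y. x \<in> space M \<Longrightarrow> y \<in> N x \<Longrightarrow> h x y \<noteq> \<infinity>"
    and meas: "\<And>D r. closed D \<Longrightarrow> {x\<in>space M. \<exists>y\<in>N x \<inter> D. h x y \<le> ereal r} \<in> sets M"
  shows "hit_measurable M (\<lambda>x. minimisers (h x) (N x))"
  unfolding hit_measurable_def
proof (intro allI impI)
  fix D :: "'e set" assume D: "closed D"
  let ?L = "\<lambda>D (r::real). {x\<in>space M. \<exists>y\<in>N x \<inter> D. h x y \<le> ereal r}"
  let ?hit = "\<Union>n::nat. ?L D (real n)"
  have hit: "{x\<in>space M. N x \<inter> D \<noteq> {}} = ?hit"
  proof (intro set_eqI iffI)
    fix x assume "x \<in> {x\<in>space M. N x \<inter> D \<noteq> {}}"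
    then obtain y where y: "x \<in> space M" "y \<in> N x" "y \<in> D" by blast
    then have "h x y < \<infinity>" using fin[of x y] by simp
    then obtain n :: nat where "h x y < ereal (real n)" using less_PInf_Ex_of_nat by auto
    then show "x \<in> ?hit" using y less_imp_le by blast
  qed auto
  have "{x\<in>space M. minimisers (h x) (N x) \<inter> D \<noteq> {}} = ?hit - (\<Union>q\<in>\<rat>. ?L UNIV q - ?L D q)"
  proof (rule set_eqI, rule iffI)
    fix x assume "x \<in> {x\<in>space M. minimisers (h x) (N x) \<inter> D \<noteq> {}}"
    then obtain y where y: "x \<in> space M" "y \<in> N x" "y \<in> D" "\<And>z. z \<in> N x \<Longrightarrow> h x y \<le> h x z"
      by (auto simp: minimisers_def)
    then have "x \<in> ?hit" unfolding hit[symmetric] by auto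
    moreover have "x \<notin> ?L UNIV q - ?L D q" for q using y order_trans by blast
    ultimately show "x \<in> ?hit - (\<Union>q\<in>\<rat>. ?L UNIV q - ?L D q)" by blast
  next
    fix x assume x: "x \<in> ?hit - (\<Union>q\<in>\<rat>. ?L UNIV q - ?L D q)"
    then have xs: "x \<in> space M" by auto
    have "x \<in> {x\<in>space M. N x \<inter> D \<noteq> {}}" unfolding hit using x by blast
    then have ne: "N x \<inter> D \<noteq> {}" by simp
    have "closed {y \<in> N x \<inter> D. h x y \<le> ereal r}" for r
    proof -
      have "{y \<in> N x \<inter> D. h x y \<le> ereal r} = {y \<in> N x. h x y \<le> ereal r} \<inter> D" by auto
      then show ?thesis using lev[OF xs] D by auto
    qed
    then obtain y where y: "y \<in> N x \<inter> D" "\<And>z. z \<in> N x \<inter> D \<Longrightarrow> h x y \<le> h x z"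
      using compact_attains_min_level_closed[OF compact_Int_closed[OF N(1)[OF xs] D] ne] by blast
    have "h x y \<le> h x z" if "z \<in> N x" for z
    proof (rule ccontr)
      assume "\<not> h x y \<le> h x z"
      then obtain q' :: rat where q': "h x z < ereal (real_of_rat q')" "ereal (real_of_rat q') < h x y"
        using ereal_dense3[of "h x z" "h x y"] by (auto simp: not_le)
      define q where "q = real_of_rat q'"
      have q: "q \<in> \<rat>" "h x z < ereal q" "ereal q < h x y" using q' by (auto simp: q_def)
      then have "x \<in> ?L UNIV q" using that xs by (auto intro: less_imp_le)
      moreover have "x \<notin> ?L D q" using y(2) q(3) by (auto simp: not_le intro: less_le_trans)
      ultimately show False using x q(1) by blast
    qed
    then show "x \<in> {x\<in>space M. minimisers (h x) (N x) \<inter> D \<noteq> {}}" using y(1) xs by (auto simp: minimisers_def)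
  qed
  moreover have "countable \<rat>" by (rule countable_rat)
  ultimately show "{x\<in>space M. minimisers (h x) (N x) \<inter> D \<noteq> {}} \<in> sets M"
    using meas[OF D] meas[OF closed_UNIV] by (simp only:) (intro sets.Diff sets.countable_UN' sets.countable_nat_UN; blast)
qed

text \<open>Minimising the coordinates one after the other leaves, by compactness, a point that lies in
  all the sets of minimisers. Its coordinates are the successive minima; since the set-valued maps stay measurable,
  so are these minima.\<close>

lemma measurable_selection:
  fixes N :: "'x \<Rightarrow> (nat \<Rightarrow> real) set"
  assumes N: "\<And>x. x \<in> space M \<Longrightarrow> compact (N x)" "\<And>x. x \<in> space M \<Longrightarrow> N x \<noteq> {}" "hit_measurable M N"
  obtains g where "g \<in> borel_measurable M" "\<And>x. x \<in> space M \<Longrightarrow> g x \<in> N x"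
proof -
  define R where "R = rec_nat N (\<lambda>i Q x. minimisers (\<lambda>y :: nat \<Rightarrow> real. ereal (y i)) (Q x))"
  have R0: "R 0 = N" and RS: "\<And>i. R (Suc i) = (\<lambda>x. minimisers (\<lambda>y. ereal (y i)) (R i x))"
    by (auto simp: R_def)
  have lev: "closed {y :: nat \<Rightarrow> real. ereal (y i) \<le> ereal r}" for i r
    unfolding ereal_less_eq(3) by (intro closed_Collect_le continuous_on_const continuous_on_product_coordinates)
  have R: "(\<forall>x\<in>space M. compact (R i x) \<and> R i x \<noteq> {}) \<and> hit_measurable M (R i)" for i
  proof (induction i)
    case 0
    then show ?case using N by (simp add: R0)
  next
    case (Suc i)
    have c: "compact (R i x)" "R i x \<noteq> {}" if "x \<in> space M" for x using Suc that by auto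
    have l: "closed {y \<in> R i x. ereal (y i) \<le> ereal r}" if "x \<in> space M" for x r
      using closed_Int[OF compact_imp_closed[OF c(1)[OF that]] lev[of i r]] by (simp add: Int_def)
    have "{x\<in>space M. \<exists>y\<in>R i x \<inter> D. ereal (y i) \<le> ereal r} \<in> sets M" if "closed D" for D r
    proof -
      have "{x\<in>space M. R i x \<inter> (D \<inter> {y. ereal (y i) \<le> ereal r}) \<noteq> {}} \<in> sets M"
        using Suc closed_Int[OF that lev[of i r]] unfolding hit_measurable_def by blast
      also have "{x\<in>space M. R i x \<inter> (D \<inter> {y. ereal (y i) \<le> ereal r}) \<noteq> {}} =
        {x\<in>space M. \<exists>y\<in>R i x \<inter> D. ereal (y i) \<le> ereal r}" by blast
      finally show ?thesis .
    qed
    then show ?case using minimisers_compact[OF c l] minimisers_hit_measurable[of M "R i" "\<lambda>x y. ereal (y i)"] c l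
      by (simp add: RS)
  qed
  have dec: "R (Suc i) x \<subseteq> R i x" for i x by (auto simp: RS minimisers_def)
  then have anti: "R j x \<subseteq> R i x" if "i \<le> j" for i j x using that lift_Suc_antimono_le[of "\<lambda>i. R i x"] by blast
  have "\<exists>y. \<forall>i. y \<in> R i x" if "x \<in> space M" for x
  proof -
    have c: "compact (R n x)" "R n x \<noteq> {}" for n using R that by auto
    have "R 0 x \<inter> (\<Inter>i\<in>UNIV. R i x) \<noteq> {}"
    proof (rule compact_imp_fip_image[OF c(1)])
      fix I :: "nat set" assume "finite I"
      then have "R (Max (insert 0 I)) x \<subseteq> R 0 x \<inter> (\<Inter>i\<in>I. R i x)" by (intro Int_greatest INT_greatest anti) auto
      moreover obtain y where "y \<in> R (Max (insert 0 I)) x" using c(2)[of "Max (insert 0 I)"] by (meson ex_in_conv)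
      ultimately have "y \<in> R 0 x \<inter> (\<Inter>i\<in>I. R i x)" by (rule subsetD)
      then show "R 0 x \<inter> (\<Inter>i\<in>I. R i x) \<noteq> {}" by (simp only: ex_in_conv[symmetric]) (rule exI)
    qed (use c compact_imp_closed in auto)
    then show ?thesis by auto
  qed
  then have "\<forall>x. \<exists>y. x \<in> space M \<longrightarrow> (\<forall>i. y \<in> R i x)" by blast
  from choice[OF this] obtain g where g: "\<And>x i. x \<in> space M \<Longrightarrow> g x \<in> R i x" by blast
  have "g \<in> borel_measurable M"
  proof (rule measurable_coordinatewise_then_product, rule borel_measurable_iff_le[THEN iffD2], rule allI)
    fix i and r :: real
    have "{x\<in>space M. R i x \<inter> {y. ereal (y i) \<le> ereal r} \<noteq> {}} \<in> sets M"
      using R lev[of i r] unfolding hit_measurable_def by blast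
    also have "{x\<in>space M. R i x \<inter> {y. ereal (y i) \<le> ereal r} \<noteq> {}} = {x\<in>space M. g x i \<le> r}"
    proof safe
      fix x y assume "x \<in> space M" "y \<in> R i x" "ereal (y i) \<le> ereal r"
      then show "g x i \<le> r" using g[of x "Suc i"] by (fastforce simp: RS minimisers_def)
    next
      fix x assume "x \<in> space M" "g x i \<le> r" "R i x \<inter> {y. ereal (y i) \<le> ereal r} = {}"
      then show False using g[of x i] by auto
    qed
    finally show "{x\<in>space M. g x i \<le> r} \<in> sets M" .
  qed
  then show ?thesis using that g[of _ 0] R0 by auto
qed

section \<open>Lower semicontinuous functions and weak limits\<close>

lemma lower_semicontinuous_iff_closed:
  "lower_semicontinuous f \<longleftrightarrow> (\<forall>r. closed {z. f z \<le> r})"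
proof
  assume f: "lower_semicontinuous f"
  show "\<forall>r. closed {z. f z \<le> r}"
  proof
    fix r
    have "open {z. r < f z}"
    proof (subst open_subopen, rule ballI)
      fix z assume "z \<in> {z. r < f z}"
      then have "\<forall>\<^sub>F z' in nhds z. r < f z'" using f unfolding lower_semicontinuous_def by blast
      then show "\<exists>T. open T \<and> z \<in> T \<and> T \<subseteq> {z. r < f z}" unfolding eventually_nhds by blast
    qed
    then show "closed {z. f z \<le> r}" by (simp add: closed_def Compl_eq not_le)
  qed
next
  assume cl: "\<forall>r. closed {z. f z \<le> r}"
  have "open {z. r < f z}" for r using cl by (simp add: closed_def Compl_eq not_le)
  then show "lower_semicontinuous f" unfolding lower_semicontinuous_def eventually_nhds by blast
qed

lemma lower_semicontinuous_measurable:
  assumes "lower_semicontinuous f" shows "f \<in> borel_measurable borel"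
  using assms unfolding lower_semicontinuous_iff_closed by (intro borel_measurableI_le) auto

lemma lower_semicontinuous_sequentially:
  fixes f :: "'z::metric_space \<Rightarrow> real"
  shows "lower_semicontinuous f \<longleftrightarrow>
    (\<forall>zs z r. zs \<longlonglongrightarrow> z \<longrightarrow> r < f z \<longrightarrow> (\<forall>\<^sub>F n in sequentially. r < f (zs n)))"
proof safe
  fix zs z r assume "lower_semicontinuous f" "zs \<longlonglongrightarrow> z" "r < f z"
  then show "\<forall>\<^sub>F n in sequentially. r < f (zs n)"
    unfolding lower_semicontinuous_def filterlim_def le_filter_def eventually_filtermap by blast
next
  assume s: "\<forall>zs z r. zs \<longlonglongrightarrow> z \<longrightarrow> r < f z \<longrightarrow> (\<forall>\<^sub>F n in sequentially. r < f (zs n))"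
  show "lower_semicontinuous f" unfolding lower_semicontinuous_iff_closed closed_sequential_limits
  proof safe
    fix r zs z assume "\<forall>n. zs n \<in> {z. f z \<le> r}" "zs \<longlonglongrightarrow> z"
    show "f z \<le> r"
    proof (rule ccontr)
      assume "\<not> f z \<le> r"
      then have "\<forall>\<^sub>F n in sequentially. r < f (zs n)" using s \<open>zs \<longlonglongrightarrow> z\<close> by auto
      then obtain n where "r < f (zs n)" unfolding eventually_sequentially by blast
      then show False using \<open>\<forall>n. zs n \<in> {z. f z \<le> r}\<close> by (auto simp: not_less[symmetric])
    qed
  qed
qed

lemma lower_semicontinuous_compose:
  assumes "lower_semicontinuous f" "continuous_on UNIV g"
  shows "lower_semicontinuous (\<lambda>z. f (g z))"
  unfolding lower_semicontinuous_iff_closed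
proof
  fix r
  have "closed (g -` {z. f z \<le> r})" using assms lower_semicontinuous_iff_closed[of f] by (intro closed_vimage) (auto simp: continuous_on_eq_continuous_at)
  then show "closed {z. f (g z) \<le> r}" by (simp add: vimage_def)
qed

lemma lower_semicontinuous_add:
  assumes f: "lower_semicontinuous f" and g: "lower_semicontinuous g"
  shows "lower_semicontinuous (\<lambda>z. f z + g z)"
  unfolding lower_semicontinuous_def
proof (intro allI impI)
  fix z r assume "r < f z + g z"
  define e where "e = (f z + g z - r) / 2"
  have "e > 0" "r = (f z - e) + (g z - e)" using \<open>r < f z + g z\<close> by (auto simp: e_def field_simps)
  then have "\<forall>\<^sub>F z' in nhds z. f z - e < f z'" "\<forall>\<^sub>F z' in nhds z. g z - e < g z'"
    using f g unfolding lower_semicontinuous_def by auto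
  then show "\<forall>\<^sub>F z' in nhds z. r < f z' + g z'"
    by eventually_elim (use \<open>r = (f z - e) + (g z - e)\<close> in linarith)
qed

lemma lower_semicontinuous_cmult:
  assumes f: "lower_semicontinuous f" and c: "0 \<le> c"
  shows "lower_semicontinuous (\<lambda>z. c * f z)"
proof (cases "c = 0")
  case True
  then show ?thesis by (simp add: lower_semicontinuous_iff_closed)
next
  case False
  then have "{z. c * f z \<le> r} = {z. f z \<le> r / c}" for r using c by (auto simp: field_simps)
  then show ?thesis using f by (simp add: lower_semicontinuous_iff_closed)
qed

lemma lower_semicontinuous_mono_compose:
  fixes g :: "real \<Rightarrow> real"
  assumes f: "lower_semicontinuous f" and g: "mono g" "continuous_on UNIV g"
  shows "lower_semicontinuous (\<lambda>z. g (f z))"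
  unfolding lower_semicontinuous_def
proof (intro allI impI)
  fix z r assume "r < g (f z)"
  moreover have "open {u. r < g u}" using g(2) by (intro open_Collect_less continuous_on_const) auto
  ultimately obtain d where d: "d > 0" "ball (f z) d \<subseteq> {u. r < g u}" unfolding open_contains_ball by blast
  have "\<forall>\<^sub>F z' in nhds z. f z - d / 2 < f z'" using f d(1) unfolding lower_semicontinuous_def by auto
  then show "\<forall>\<^sub>F z' in nhds z. r < g (f z')"
  proof eventually_elim
    case (elim z')
    have "f z - d / 2 \<in> ball (f z) d" using d(1) by (simp add: dist_real_def)
    then have "r < g (f z - d / 2)" using d(2) by blast
    also have "\<dots> \<le> g (f z')" by (rule monoD[OF g(1)]) (use elim in simp)
    finally show ?case .
  qed
qed

text \<open>The infimal convolution of \<open>f\<close> with \<open>k\<close> times the metric: the largest \<open>k\<close>-Lipschitz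
  function below \<open>f\<close>, when \<open>f\<close> is bounded.\<close>

definition lipschitz_minorant :: "nat \<Rightarrow> ('z::metric_space \<Rightarrow> real) \<Rightarrow> 'z \<Rightarrow> real" where
  "lipschitz_minorant k f z = (INF z'. f z' + real k * dist z z')"

context
  fixes f :: "'z::metric_space \<Rightarrow> real" and B :: real
  assumes B: "\<And>z. \<bar>f z\<bar> \<le> B"
begin

lemma lipschitz_minorant_bdd: "bdd_below (range (\<lambda>z'. f z' + real k * dist z z'))"
proof (rule bdd_belowI2)
  fix z' show "- B \<le> f z' + real k * dist z z'"
    using B[of z'] mult_nonneg_nonneg[OF of_nat_0_le_iff zero_le_dist, of k z z'] by linarith
qed

lemma lipschitz_minorant_le: "lipschitz_minorant k f z \<le> f z' + real k * dist z z'"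
  unfolding lipschitz_minorant_def by (rule cINF_lower[OF lipschitz_minorant_bdd]) simp

lemma lipschitz_minorant_le_self: "lipschitz_minorant k f z \<le> f z"
  using lipschitz_minorant_le[of k z z] by simp

lemma lipschitz_minorant_ge: "- B \<le> lipschitz_minorant k f z"
  unfolding lipschitz_minorant_def
proof (rule cINF_greatest)
  fix z' show "- B \<le> f z' + real k * dist z z'"
    using B[of z'] mult_nonneg_nonneg[OF of_nat_0_le_iff zero_le_dist, of k z z'] by linarith
qed simp

lemma lipschitz_minorant_abs: "\<bar>lipschitz_minorant k f z\<bar> \<le> B"
  using lipschitz_minorant_ge[of k z] lipschitz_minorant_le_self[of k z] B[of z] by linarith

lemma lipschitz_minorant_lipschitz:
  "\<bar>lipschitz_minorant k f z - lipschitz_minorant k f w\<bar> \<le> real k * dist z w"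
proof -
  have "lipschitz_minorant k f z \<le> lipschitz_minorant k f w + real k * dist z w" for z w :: 'z
  proof -
    have "lipschitz_minorant k f z - real k * dist z w \<le> lipschitz_minorant k f w"
      unfolding lipschitz_minorant_def[of k f w]
    proof (rule cINF_greatest)
      fix z'
      have "lipschitz_minorant k f z \<le> f z' + real k * dist z z'" by (rule lipschitz_minorant_le)
      also have "\<dots> \<le> f z' + real k * (dist z w + dist w z')"
        by (intro add_left_mono mult_left_mono dist_triangle) auto
      finally show "lipschitz_minorant k f z - real k * dist z w \<le> f z' + real k * dist w z'"
        by (simp add: algebra_simps)
    qed simp
    then show ?thesis by linarith
  qed
  from this[of z w] this[of w z] show ?thesis by (simp add: dist_commute abs_le_iff algebra_simps)
qed

lemma lipschitz_minorant_continuous: "continuous_on UNIV (lipschitz_minorant k f)"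
proof (rule continuous_onI)
  fix x and e :: real assume "e > 0"
  show "\<exists>d>0. \<forall>x'\<in>UNIV. dist x' x < d \<longrightarrow> dist (lipschitz_minorant k f x') (lipschitz_minorant k f x) \<le> e"
  proof (intro exI conjI ballI impI)
    show "e / (real k + 1) > 0" using \<open>e > 0\<close> by simp
    fix x' assume "dist x' x < e / (real k + 1)"
    then have "(real k + 1) * dist x' x < e" by (simp add: field_simps)
    moreover have "real k * dist x' x \<le> (real k + 1) * dist x' x" by (intro mult_right_mono) auto
    ultimately show "dist (lipschitz_minorant k f x') (lipschitz_minorant k f x) \<le> e"
      using lipschitz_minorant_lipschitz[of k x' x] by (simp add: dist_real_def)
  qed
qed

text \<open>Near \<open>z\<close> the values of \<open>f\<close> are almost as large as \<open>f z\<close> by lower semicontinuity;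
  away from \<open>z\<close> a large multiple of the distance outweighs the bound of \<open>f\<close>.\<close>

lemma lipschitz_minorant_tendsto:
  assumes f: "lower_semicontinuous f"
  shows "(\<lambda>k. lipschitz_minorant k f z) \<longlonglongrightarrow> f z"
proof (rule order_tendstoI)
  fix r assume "f z < r"
  then show "\<forall>\<^sub>F k in sequentially. lipschitz_minorant k f z < r"
    using lipschitz_minorant_le_self le_less_trans by (intro always_eventually) blast
next
  fix r assume "r < f z"
  define s where "s = (r + f z) / 2"
  have s: "r < s" "s < f z" using \<open>r < f z\<close> by (auto simp: s_def)
  then have "\<forall>\<^sub>F z' in nhds z. s < f z'" using f unfolding lower_semicontinuous_def by blast
  then obtain d where d: "d > 0" "\<And>z'. dist z' z < d \<Longrightarrow> s < f z'" unfolding eventually_nhds_metric by blast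
  obtain m :: nat where m: "(s + B) / d < real m" using reals_Archimedean2 by blast
  show "\<forall>\<^sub>F k in sequentially. r < lipschitz_minorant k f z"
    unfolding eventually_sequentially
  proof (intro exI allI impI)
    fix k assume "m \<le> k"
    have "s \<le> lipschitz_minorant k f z" unfolding lipschitz_minorant_def
    proof (rule cINF_greatest)
      fix z'
      show "s \<le> f z' + real k * dist z z'"
      proof (cases "dist z' z < d")
        case True
        then show ?thesis using d(2)[OF True] mult_nonneg_nonneg[OF of_nat_0_le_iff zero_le_dist, of k z z'] by linarith
      next
        case False
        have "s + B < real m * d" using m d(1) by (simp add: field_simps)
        also have "\<dots> \<le> real k * dist z z'" using False \<open>m \<le> k\<close> d(1) by (intro mult_mono) (auto simp: dist_commute)
        finally show ?thesis using B[of z'] by linarith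
      qed
    qed simp
    with s show "r < lipschitz_minorant k f z" by linarith
  qed
qed

end

text \<open>The portmanteau inequality with a moving parameter. For a Lipschitz minorant the
  parameter can be replaced by its limit at a cost that is uniform in \<open>y\<close>, so that weak convergence against
  a single continuous function is all that remains. This is why the minorants are taken on the product space.\<close>

lemma weakly_converges_lower_semicontinuous:
  fixes f :: "'z::metric_space \<times> 'y::metric_space \<Rightarrow> real"
  assumes \<mu>: "weakly_converges \<mu> \<mu>0" "\<And>n. \<mu> n \<in> space (prob_algebra borel)" "\<mu>0 \<in> space (prob_algebra borel)"
    and z: "zs \<longlonglongrightarrow> z" and f: "lower_semicontinuous f" "\<And>p. \<bar>f p\<bar> \<le> B"
    and r: "r < (\<integral>y. f (z, y) \<partial>\<mu>0)"
  shows "\<forall>\<^sub>F n in sequentially. r < (\<integral>y. f (zs n, y) \<partial>\<mu> n)"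
proof -
  let ?L = "\<lambda>k. lipschitz_minorant k f"
  have cont: "continuous_on UNIV (\<lambda>y. (w, y))" for w :: 'z by (intro continuous_intros)
  have cL: "continuous_on UNIV (\<lambda>y. ?L k (w, y))" for k w
    by (rule continuous_on_compose2[OF lipschitz_minorant_continuous[OF f(2)] cont]) auto
  have mL: "(\<lambda>y. ?L k (w, y)) \<in> borel_measurable borel" for k w using cL by (rule borel_measurable_continuous_onI)
  have mf: "(\<lambda>y. f (w, y)) \<in> borel_measurable borel" for w
    by (intro lower_semicontinuous_measurable lower_semicontinuous_compose[OF f(1) cont])
  have aL: "\<bar>?L k p\<bar> \<le> B" for k p using lipschitz_minorant_abs f(2) .
  have iL: "integrable m (\<lambda>y. ?L k (w, y))" if "m \<in> space (prob_algebra borel)" for m k w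
    using that mL aL by (rule integrable_bounded_borel)
  have int_f: "integrable m (\<lambda>y. f (w, y))" if "m \<in> space (prob_algebra borel)" for m w
    using that mf f(2) by (rule integrable_bounded_borel)
  interpret m0: prob_space \<mu>0 using \<mu>(3) by (rule borel_prob_spaceD)
  have "(\<lambda>k. \<integral>y. ?L k (z, y) \<partial>\<mu>0) \<longlonglongrightarrow> (\<integral>y. f (z, y) \<partial>\<mu>0)"
    by (rule integral_dominated_convergence[where w="\<lambda>_. B"])
      (use mL mf borel_prob_spaceD[OF \<mu>(3)] aL lipschitz_minorant_tendsto[OF f(2) f(1)] in \<open>auto cong: measurable_cong_sets\<close>)
  then obtain k where k: "r < (\<integral>y. ?L k (z, y) \<partial>\<mu>0)"
    using order_tendstoD(1)[OF _ r] by (metis (no_types, lifting) eventually_sequentially order_refl)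
  have "(\<lambda>n. \<integral>y. ?L k (zs n, y) \<partial>\<mu> n) \<longlonglongrightarrow> (\<integral>y. ?L k (z, y) \<partial>\<mu>0)"
  proof -
    have "(\<lambda>n. \<integral>y. ?L k (z, y) \<partial>\<mu> n) \<longlonglongrightarrow> (\<integral>y. ?L k (z, y) \<partial>\<mu>0)"
      using aL by (intro weakly_convergesD[OF \<mu>(1)] cL) (auto simp: bounded_iff)
    moreover have "(\<lambda>n. (\<integral>y. ?L k (zs n, y) \<partial>\<mu> n) - (\<integral>y. ?L k (z, y) \<partial>\<mu> n)) \<longlonglongrightarrow> 0"
    proof (rule Lim_null_comparison[OF always_eventually])
      show "\<forall>n. norm ((\<integral>y. ?L k (zs n, y) \<partial>\<mu> n) - (\<integral>y. ?L k (z, y) \<partial>\<mu> n)) \<le> real k * dist (zs n) z"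
      proof
        fix n
        interpret prob_space "\<mu> n" using \<mu>(2)[of n] by (rule borel_prob_spaceD)
        have "norm (\<integral>y. ?L k (zs n, y) - ?L k (z, y) \<partial>\<mu> n) \<le> (\<integral>y. norm (?L k (zs n, y) - ?L k (z, y)) \<partial>\<mu> n)"
          by (rule integral_norm_bound)
        also have "\<dots> \<le> (\<integral>y. real k * dist (zs n) z \<partial>\<mu> n)"
        proof (rule integral_mono)
          fix y :: 'y
          have "dist (zs n, y) (z, y) = dist (zs n) z" by (simp add: dist_Pair_Pair)
          then show "norm (?L k (zs n, y) - ?L k (z, y)) \<le> real k * dist (zs n) z"
            using lipschitz_minorant_lipschitz[OF f(2), where k=k and z="(zs n, y)" and w="(z, y)"] by simp
        qed (use iL[OF \<mu>(2)] in auto)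
        finally show "norm ((\<integral>y. ?L k (zs n, y) \<partial>\<mu> n) - (\<integral>y. ?L k (z, y) \<partial>\<mu> n)) \<le> real k * dist (zs n) z"
          using iL[OF \<mu>(2)] by (simp add: prob_space)
      qed
      show "(\<lambda>n. real k * dist (zs n) z) \<longlonglongrightarrow> 0" using tendsto_mult_right_zero[of "\<lambda>n. dist (zs n) z"] z tendsto_dist_iff by blast
    qed
    ultimately show ?thesis using tendsto_add by fastforce
  qed
  then have "\<forall>\<^sub>F n in sequentially. r < (\<integral>y. ?L k (zs n, y) \<partial>\<mu> n)" using k by (rule order_tendstoD)
  then show ?thesis
  proof eventually_elim
    case (elim n)
    also have "(\<integral>y. ?L k (zs n, y) \<partial>\<mu> n) \<le> (\<integral>y. f (zs n, y) \<partial>\<mu> n)"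
      using iL[OF \<mu>(2)] int_f[OF \<mu>(2)] lipschitz_minorant_le_self[OF f(2)] by (intro integral_mono)
    finally show ?case .
  qed
qed

section \<open>Risk measures and stochastic dominance\<close>

lemma bounded_supportI: "\<mu> \<in> prob_on (cball 0 r) \<Longrightarrow> \<mu> \<in> bounded_support"
  by (auto simp: bounded_support_def)

lemma return_in_prob_on: "F \<in> sets borel \<Longrightarrow> a \<in> F \<Longrightarrow> return borel a \<in> prob_on F"
  by (auto simp: prob_on_iff_AE space_prob_algebra prob_space_return AE_return)

lemma convolution_return:
  "return borel (c::real) \<star> return borel d = return borel (c + d)"
proof (rule measure_eqI)
  fix A assume "A \<in> sets (return borel c \<star> return borel d)"
  then have A: "A \<in> sets borel" by simp
  then have "{a. a + c \<in> A} \<in> sets borel" by measurable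
  moreover have "(\<lambda>x. emeasure (return borel d) {a. a + x \<in> A}) \<in> borel_measurable borel"
  proof -
    have "(\<lambda>x. emeasure (return borel d) {a. a + x \<in> A}) = (\<lambda>x. indicator A (d + x))"
    proof
      fix x have "{a. a + x \<in> A} \<in> sets borel" using A by measurable
      then show "emeasure (return borel d) {a. a + x \<in> A} = indicator A (d + x)"
        by (auto simp: indicator_def)
    qed
    then show ?thesis using A by simp
  qed
  ultimately show "emeasure (return borel c \<star> return borel d) A = emeasure (return borel (c + d)) A" using A
    by (subst convolution_emeasure)
      (auto simp: prob_space_return prob_space.finite_measure nn_integral_return indicator_def add.commute)
qed simp

context law_invariant_convex_risk_measure
begin

text \<open>Stochastic dominance in the form in which it is inherited by weak limits: the piecewise linear
  increasing functions \<open>g j\<close> increase to the indicator of \<open>{s<..}\<close>.\<close>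

lemma monotone_integral:
  assumes \<mu>: "\<mu> \<in> bounded_support" "\<mu>' \<in> bounded_support"
    and le: "\<And>g :: real \<Rightarrow> real. mono g \<Longrightarrow> continuous_on UNIV g \<Longrightarrow> (\<And>u. 0 \<le> g u) \<Longrightarrow> (\<And>u. g u \<le> 1) \<Longrightarrow>
      (\<integral>u. g u \<partial>\<mu>) \<le> (\<integral>u. g u \<partial>\<mu>')"
  shows "\<sigma> \<mu> \<le> \<sigma> \<mu>'"
proof (rule monotone[OF \<mu>])
  fix s :: real
  have pa: "\<mu> \<in> space (prob_algebra borel)" "\<mu>' \<in> space (prob_algebra borel)"
    using \<mu> by (auto simp: bounded_support_def prob_on_def)
  define g where "g j u = min 1 (max 0 (real j * (u - s)))" for j u
  have g: "mono (g j)" "continuous_on UNIV (g j)" "0 \<le> g j u" "g j u \<le> 1" for j u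
    unfolding g_def by (auto intro!: monoI continuous_intros min.mono max.mono mult_left_mono)
  have gi: "(\<lambda>j. g j u) \<longlonglongrightarrow> indicator {s<..} u" for u
  proof (cases "u \<le> s")
    case True
    then have "g j u = 0" for j by (auto simp: g_def mult_le_0_iff)
    then show ?thesis using True by simp
  next
    case False
    then obtain m :: nat where "1 / (u - s) < real m" using reals_Archimedean2 by blast
    then have m: "1 < real m * (u - s)" using False by (simp add: field_simps)
    have "g j u = 1" if "j \<ge> m" for j
    proof -
      have "real m * (u - s) \<le> real j * (u - s)" using that False by (intro mult_right_mono) auto
      then show ?thesis using m by (simp add: g_def)
    qed
    then show ?thesis using False by (intro tendsto_eventually) (auto simp: eventually_sequentially)
  qed
  have lim: "(\<lambda>j. \<integral>u. g j u \<partial>m) \<longlonglongrightarrow> measure m {s<..}" if m: "m \<in> space (prob_algebra borel)" for m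
  proof -
    interpret prob_space m using m by (rule borel_prob_spaceD)
    note sm = borel_prob_spaceD[OF m]
    have gm: "g j \<in> borel_measurable m" for j
      using borel_measurable_continuous_onI[OF g(2)] by (simp add: sm cong: measurable_cong_sets)
    have [measurable]: "{s<..} \<in> sets m" by (simp add: sm)
    have "(\<lambda>j. \<integral>u. g j u \<partial>m) \<longlonglongrightarrow> (\<integral>u. indicator {s<..} u \<partial>m)"
      by (rule integral_dominated_convergence[where w="\<lambda>_. 1"]) (use gm gi g in auto)
    then show ?thesis by (simp add: sm)
  qed
  have "measure \<mu> {s<..} \<le> measure \<mu>' {s<..}"
    by (rule LIMSEQ_le[OF lim[OF pa(1)] lim[OF pa(2)]]) (auto intro!: le g exI[of _ 0])
  moreover have "measure m {..s} = 1 - measure m {s<..}" if m: "m \<in> space (prob_algebra borel)" for m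
  proof -
    have "{..s} = space m - {s<..}" using borel_prob_spaceD[OF m] by auto
    then show ?thesis using borel_prob_spaceD[OF m] prob_space.prob_compl[of m "{s<..}"] by simp
  qed
  ultimately show "measure \<mu>' {..s} \<le> measure \<mu> {..s}" using pa by simp
qed

lemma monotone_AE:
  assumes \<mu>: "\<mu> \<in> bounded_support" "\<mu>' \<in> bounded_support" and "AE u in \<mu>. u \<le> c" "AE u in \<mu>'. c \<le> u"
  shows "\<sigma> \<mu> \<le> \<sigma> \<mu>'"
proof (rule monotone_integral[OF \<mu>])
  fix g :: "real \<Rightarrow> real" assume g: "mono g" "continuous_on UNIV g" "\<And>u. 0 \<le> g u" "\<And>u. g u \<le> 1"
  have pa: "\<mu> \<in> space (prob_algebra borel)" "\<mu>' \<in> space (prob_algebra borel)"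
    using \<mu> by (auto simp: bounded_support_def prob_on_def)
  have i: "integrable m g" if "m \<in> space (prob_algebra borel)" for m
    using that borel_measurable_continuous_onI[OF g(2)] by (rule integrable_bounded_borel[where B=1]) (use g in auto)
  interpret m: prob_space \<mu> using pa by (auto dest: borel_prob_spaceD)
  interpret m': prob_space \<mu>' using pa by (auto dest: borel_prob_spaceD)
  have "(\<integral>u. g u \<partial>\<mu>) \<le> g c"
  proof (rule m.integral_le_const[OF i[OF pa(1)]])
    show "AE u in \<mu>. g u \<le> g c" using assms(3) by eventually_elim (rule monoD[OF g(1)])
  qed
  also have "g c \<le> (\<integral>u. g u \<partial>\<mu>')"
  proof (rule m'.integral_ge_const[OF i[OF pa(2)]])
    show "AE u in \<mu>'. g c \<le> g u" using assms(4) by eventually_elim (rule monoD[OF g(1)])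
  qed
  finally show "(\<integral>u. g u \<partial>\<mu>) \<le> (\<integral>u. g u \<partial>\<mu>')" .
qed

lemma return_bounded_support: "return borel (c :: real) \<in> bounded_support"
  by (rule bounded_supportI[of _ "\<bar>c\<bar>"], rule return_in_prob_on) auto

lemma sigma_return: "\<sigma> (return borel c) = \<sigma> (return borel 0) + ereal c"
  using translation[OF return_bounded_support[of 0], of c] by (simp add: convolution_return)

text \<open>The law lies stochastically between the point masses at \<open>- r\<close> and \<open>r\<close>.\<close>

lemma sigma_bounds:
  assumes "\<mu> \<in> prob_on (cball 0 r)" "\<bar>\<sigma> (return borel 0)\<bar> \<le> ereal b"
  shows "\<bar>\<sigma> \<mu>\<bar> \<le> ereal (b + r)"
proof -
  have ae: "AE u in \<mu>. u \<in> cball 0 r" using assms by (auto simp: prob_on_iff_AE)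
  have "AE u in \<mu>. - r \<le> u" using ae by eventually_elim auto
  then have 1: "\<sigma> (return borel (- r)) \<le> \<sigma> \<mu>" using assms(1)
    by (intro monotone_AE[where c="- r"] return_bounded_support) (auto simp: AE_return intro: bounded_supportI)
  have "AE u in \<mu>. u \<le> r" using ae by eventually_elim auto
  then have 2: "\<sigma> \<mu> \<le> \<sigma> (return borel r)" using assms(1)
    by (intro monotone_AE[where c=r] return_bounded_support) (auto simp: AE_return intro: bounded_supportI)
  show ?thesis using 1 2 assms(2) sigma_return[of r] sigma_return[of "- r"]
    by (cases "\<sigma> (return borel 0)"; cases "\<sigma> \<mu>") auto
qed

end

section \<open>The law of the one-step cost\<close>

locale one_step =
  fixes \<gamma> :: real and C :: "nat \<Rightarrow> 'x::polish_space \<Rightarrow> 'a::polish_space \<Rightarrow> 'x \<Rightarrow> real"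
    and P :: "nat \<Rightarrow> 'x \<Rightarrow> 'a \<Rightarrow> 'x measure" and t :: nat and v :: "'x \<Rightarrow> real"
  assumes P_kernel: "(\<lambda>(x, a). P t x a) \<in> borel \<rightarrow>\<^sub>M prob_algebra borel"
    and cost_borel: "(\<lambda>(x, a, y). C t x a y) \<in> borel_measurable borel"
    and value_borel: "v \<in> borel_measurable borel"
begin

definition "step_kernel x a = distr (P t x a) borel (\<lambda>y. C t x a y + \<gamma> * v y)"

lemma step_cost_measurable: "(\<lambda>((x, a), y). C t x a y + \<gamma> * v y) \<in> borel_measurable ((borel \<Otimes>\<^sub>M borel) \<Otimes>\<^sub>M borel)"
proof -
  have [measurable]: "v \<in> borel_measurable borel" by (rule value_borel)
  have "(\<lambda>(x, a, y). C t x a y) \<in> borel_measurable (borel \<Otimes>\<^sub>M borel \<Otimes>\<^sub>M borel)"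
    using cost_borel by (simp add: borel_prod)
  moreover have "(\<lambda>p. (fst (fst p), snd (fst p), snd p)) \<in> (borel \<Otimes>\<^sub>M borel) \<Otimes>\<^sub>M borel
    \<rightarrow>\<^sub>M (borel :: 'x measure) \<Otimes>\<^sub>M (borel :: 'a measure) \<Otimes>\<^sub>M (borel :: 'x measure)" by measurable
  ultimately have "(\<lambda>p. case (fst (fst p), snd (fst p), snd p) of (x, a, y) \<Rightarrow> C t x a y)
    \<in> borel_measurable ((borel \<Otimes>\<^sub>M borel) \<Otimes>\<^sub>M borel)" by (rule measurable_compose[rotated])
  then have [measurable]: "(\<lambda>p. C t (fst (fst p)) (snd (fst p)) (snd p)) \<in> borel_measurable ((borel \<Otimes>\<^sub>M borel) \<Otimes>\<^sub>M borel)"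
    by (simp add: case_prod_beta)
  show ?thesis unfolding case_prod_beta by measurable
qed

lemma step_cost_measurable1: "(\<lambda>y. C t x a y + \<gamma> * v y) \<in> borel_measurable borel"
  using measurable_compose[OF _ step_cost_measurable, of "\<lambda>y. ((x, a), y)" borel] by simp

lemma P_prob_algebra: "P t x a \<in> space (prob_algebra borel)"
  using measurable_space[OF P_kernel, of "(x, a)"] by simp

lemma step_kernel_measurable: "(\<lambda>(x, a). step_kernel x a) \<in> borel \<Otimes>\<^sub>M borel \<rightarrow>\<^sub>M prob_algebra borel"
proof -
  have "(\<lambda>p. distr (P t (fst p) (snd p)) borel (\<lambda>y. C t (fst p) (snd p) y + \<gamma> * v y))
    \<in> borel \<Otimes>\<^sub>M borel \<rightarrow>\<^sub>M prob_algebra borel"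
    by (rule measurable_distr_prob_space2[where M=borel])
      (use P_kernel step_cost_measurable in \<open>simp_all add: borel_prod case_prod_unfold\<close>)
  then show ?thesis by (simp add: step_kernel_def case_prod_unfold)
qed

lemma step_kernel_measurable1: "step_kernel x \<in> borel \<rightarrow>\<^sub>M prob_algebra borel"
  using measurable_compose[OF _ step_kernel_measurable, of "\<lambda>a. (x, a)" borel] by simp

text \<open>The set function in \<^const>\<open>one_step_law\<close> is the measure of the monadic bind. In
  particular it is a measure on the Borel sets, so \<^const>\<open>measure_of\<close> returns it rather than its default value,
  the null measure.\<close>

lemma one_step_law_eq_bind:
  assumes l: "l \<in> space (prob_algebra borel)"
  shows "one_step_law \<gamma> C P t v x l = l \<bind> step_kernel x"
proof -
  have "one_step_law \<gamma> C P t v x l = measure_of UNIV (sets borel) (emeasure (l \<bind> step_kernel x))"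
    unfolding one_step_law_def
  proof (rule measure_of_eq)
    fix B assume "B \<in> sigma_sets UNIV (sets (borel :: real measure))"
    then have B: "B \<in> sets borel" using sets.sigma_sets_eq[of "borel :: real measure"] by simp
    have "emeasure (step_kernel x a) B = (\<integral>\<^sup>+ y. indicator B (C t x a y + \<gamma> * v y) \<partial>P t x a)" for a
    proof -
      have m: "(\<lambda>y. C t x a y + \<gamma> * v y) \<in> borel_measurable (P t x a)"
        using step_cost_measurable1 borel_prob_spaceD(2)[OF P_prob_algebra] by (simp cong: measurable_cong_sets)
      then have "emeasure (step_kernel x a) B = emeasure (P t x a) ((\<lambda>y. C t x a y + \<gamma> * v y) -` B \<inter> space (P t x a))"
        unfolding step_kernel_def using B by (rule emeasure_distr)
      also have "\<dots> = (\<integral>\<^sup>+ y. indicator ((\<lambda>y. C t x a y + \<gamma> * v y) -` B \<inter> space (P t x a)) y \<partial>P t x a)"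
        using measurable_sets[OF m B] by simp
      also have "\<dots> = (\<integral>\<^sup>+ y. indicator B (C t x a y + \<gamma> * v y) \<partial>P t x a)"
        by (intro nn_integral_cong) (auto simp: indicator_def)
      finally show ?thesis .
    qed
    then show "(\<integral>\<^sup>+ a. \<integral>\<^sup>+ y. indicator B (C t x a y + \<gamma> * v y) \<partial>P t x a \<partial>l) = emeasure (l \<bind> step_kernel x) B"
      using emeasure_bind_prob_algebra[OF l step_kernel_measurable1 B] by simp
  qed auto
  also have "\<dots> = l \<bind> step_kernel x"
    using measure_of_of_measure[of "l \<bind> step_kernel x"] sets_bind'[OF l step_kernel_measurable1]
      sets_eq_imp_space_eq[OF sets_bind'[OF l step_kernel_measurable1]] by simp
  finally show ?thesis .
qed

lemma one_step_law_measurable: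
  assumes "X \<in> N \<rightarrow>\<^sub>M borel" "\<kappa> \<in> N \<rightarrow>\<^sub>M prob_algebra borel"
  shows "(\<lambda>\<omega>. one_step_law \<gamma> C P t v (X \<omega>) (\<kappa> \<omega>)) \<in> N \<rightarrow>\<^sub>M prob_algebra borel"
proof -
  note assms[measurable]
  have "(\<lambda>(\<omega>, a). step_kernel (X \<omega>) a) \<in> N \<Otimes>\<^sub>M borel \<rightarrow>\<^sub>M prob_algebra borel"
    using measurable_compose[OF _ step_kernel_measurable, of "\<lambda>(\<omega>, a). (X \<omega>, a)" "N \<Otimes>\<^sub>M borel"]
    by (simp add: case_prod_beta)
  then have "(\<lambda>\<omega>. \<kappa> \<omega> \<bind> step_kernel (X \<omega>)) \<in> N \<rightarrow>\<^sub>M prob_algebra borel"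
    using assms(2) by (intro measurable_bind_prob_space2)
  moreover have "one_step_law \<gamma> C P t v (X \<omega>) (\<kappa> \<omega>) = \<kappa> \<omega> \<bind> step_kernel (X \<omega>)" if "\<omega> \<in> space N" for \<omega>
    using measurable_space[OF assms(2) that] by (rule one_step_law_eq_bind)
  ultimately show ?thesis by (simp cong: measurable_cong)
qed

lemma one_step_law_space:
  "l \<in> space (prob_algebra borel) \<Longrightarrow> one_step_law \<gamma> C P t v x l \<in> space (prob_algebra borel)"
  using measurable_space[OF one_step_law_measurable[of "\<lambda>_. x" "count_space UNIV" "\<lambda>_. l"]] by simp

lemma emeasure_one_step_law:
  assumes l: "l \<in> space (prob_algebra borel)" and B: "B \<in> sets borel"
  shows "emeasure (one_step_law \<gamma> C P t v x l) B =
    (\<integral>\<^sup>+ a. emeasure (P t x a) {y. C t x a y + \<gamma> * v y \<in> B} \<partial>l)"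
proof -
  have "emeasure (step_kernel x a) B = emeasure (P t x a) {y. C t x a y + \<gamma> * v y \<in> B}" for a
    unfolding step_kernel_def using step_cost_measurable1 borel_prob_spaceD[OF P_prob_algebra] B
    by (subst emeasure_distr) (auto simp: vimage_def cong: measurable_cong_sets)
  then show ?thesis unfolding one_step_law_eq_bind[OF l]
    using emeasure_bind_prob_algebra[OF l step_kernel_measurable1 B] by simp
qed

lemma integral_one_step_law:
  assumes l: "l \<in> space (prob_algebra borel)"
    and g: "g \<in> borel_measurable borel" "\<And>u. 0 \<le> g u" "\<And>u. g u \<le> (1::real)"
  shows "(\<integral>u. g u \<partial>one_step_law \<gamma> C P t v x l) = (\<integral>a. (\<integral>y. g (C t x a y + \<gamma> * v y) \<partial>P t x a) \<partial>l)"
    "(\<lambda>(x, a). \<integral>y. g (C t x a y + \<gamma> * v y) \<partial>P t x a) \<in> borel_measurable borel"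
proof -
  have sk: "(\<integral>u. g u \<partial>step_kernel x a) = (\<integral>y. g (C t x a y + \<gamma> * v y) \<partial>P t x a)" for x a
    unfolding step_kernel_def using step_cost_measurable1 borel_prob_spaceD[OF P_prob_algebra] g(1)
    by (intro integral_distr) (auto cong: measurable_cong_sets)
  have "(\<lambda>\<mu>. \<integral>u. g u \<partial>\<mu>) \<in> borel_measurable (prob_algebra borel)"
    using g by (intro integral_measurable_prob_algebra[where B=1]) auto
  from measurable_compose[OF step_kernel_measurable this]
  show m: "(\<lambda>(x, a). \<integral>y. g (C t x a y + \<gamma> * v y) \<partial>P t x a) \<in> borel_measurable borel"
    by (simp add: borel_prod case_prod_beta sk)
  have m1: "(\<lambda>a. \<integral>y. g (C t x a y + \<gamma> * v y) \<partial>P t x a) \<in> borel_measurable l"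
    using measurable_compose[OF _ m[folded borel_prod], of "\<lambda>a. (x, a)" borel] borel_prob_spaceD(2)[OF l]
    by (simp cong: measurable_cong_sets)
  have skp: "step_kernel x a \<in> space (prob_algebra borel)" for a
    using measurable_space[OF step_kernel_measurable1] by simp
  have nn: "(\<integral>\<^sup>+u. ennreal (g u) \<partial>m) = ennreal (\<integral>u. g u \<partial>m)" if "m \<in> space (prob_algebra borel)" for m
    using integrable_bounded_borel[OF that g(1), of 1] g by (intro nn_integral_eq_integral) auto
  have "(\<integral>\<^sup>+u. ennreal (g u) \<partial>(l \<bind> step_kernel x)) = (\<integral>\<^sup>+a. \<integral>\<^sup>+u. ennreal (g u) \<partial>step_kernel x a \<partial>l)"
  proof (rule nn_integral_bind)
    show "step_kernel x \<in> l \<rightarrow>\<^sub>M subprob_algebra borel"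
      using measurable_prob_algebraD[OF step_kernel_measurable1] borel_prob_spaceD(2)[OF l] by (simp cong: measurable_cong_sets)
  qed (use g in auto)
  also have "\<dots> = (\<integral>\<^sup>+a. ennreal (\<integral>y. g (C t x a y + \<gamma> * v y) \<partial>P t x a) \<partial>l)"
    using nn[OF skp] by (simp add: sk)
  finally have "(\<integral>u. g u \<partial>(l \<bind> step_kernel x)) = enn2real \<dots>"
    using one_step_law_space[OF l, of x] g
    by (subst integral_eq_nn_integral) (auto simp: one_step_law_eq_bind[OF l] dest: borel_prob_spaceD(2) cong: measurable_cong_sets)
  also have "\<dots> = (\<integral>a. (\<integral>y. g (C t x a y + \<gamma> * v y) \<partial>P t x a) \<partial>l)"
    using m1 g by (intro integral_eq_nn_integral[symmetric]) (auto intro: integral_nonneg)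
  finally show "(\<integral>u. g u \<partial>one_step_law \<gamma> C P t v x l) = (\<integral>a. (\<integral>y. g (C t x a y + \<gamma> * v y) \<partial>P t x a) \<partial>l)"
    by (simp add: one_step_law_eq_bind[OF l])
qed

lemma one_step_law_support:
  assumes l: "l \<in> space (prob_algebra borel)" and B: "\<And>a y. \<bar>C t x a y + \<gamma> * v y\<bar> \<le> B"
  shows "one_step_law \<gamma> C P t v x l \<in> prob_on (cball 0 B)"
proof -
  interpret prob_space l using l by (rule borel_prob_spaceD)
  have "{y. C t x a y + \<gamma> * v y \<in> cball 0 B} = space (P t x a)" for a
    using B borel_prob_spaceD[OF P_prob_algebra] by auto
  then have "emeasure (one_step_law \<gamma> C P t v x l) (cball 0 B) = 1"
    using emeasure_one_step_law[OF l, of "cball 0 B"] borel_prob_spaceD(1)[OF P_prob_algebra]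
    by (simp add: prob_space.emeasure_space_1 emeasure_space_1)
  then show ?thesis using one_step_law_space[OF l] by (simp add: prob_on_def measure_def)
qed

end

lemma one_step_law_mono:
  assumes "law_invariant_convex_risk_measure s"
    and P: "(\<lambda>(x, a). P t x a) \<in> (borel :: ('x::polish_space \<times> 'a::polish_space) measure) \<rightarrow>\<^sub>M prob_algebra borel"
    and C: "(\<lambda>(x, a, y). C t x a y) \<in> borel_measurable borel"
    and v: "v \<in> borel_measurable borel" "w \<in> borel_measurable borel" "\<And>y. v y \<le> w y" "0 \<le> \<gamma>"
    and l: "l \<in> space (prob_algebra borel)"
    and B: "\<And>a y. \<bar>C t x a y + \<gamma> * v y\<bar> \<le> B" "\<And>a y. \<bar>C t x a y + \<gamma> * w y\<bar> \<le> B"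
  shows "s (one_step_law \<gamma> C P t v x l) \<le> s (one_step_law \<gamma> C P t w x l)"
proof -
  interpret law_invariant_convex_risk_measure s by fact
  interpret V: one_step \<gamma> C P t v using P C v by unfold_locales
  interpret W: one_step \<gamma> C P t w using P C v by unfold_locales
  show ?thesis
  proof (rule monotone)
    fix r :: real
    have r: "{..r} \<in> sets borel" by simp
    have "emeasure (one_step_law \<gamma> C P t w x l) {..r} \<le> emeasure (one_step_law \<gamma> C P t v x l) {..r}"
      unfolding V.emeasure_one_step_law[OF l r] W.emeasure_one_step_law[OF l r]
    proof (rule nn_integral_mono, rule emeasure_mono)
      fix a
      have "C t x a y + \<gamma> * v y \<le> C t x a y + \<gamma> * w y" for y using v(3,4) by (simp add: mult_left_mono)
      then show "{y. C t x a y + \<gamma> * w y \<in> {..r}} \<subseteq> {y. C t x a y + \<gamma> * v y \<in> {..r}}"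
        unfolding atMost_iff using order_trans by blast
      have "{y. C t x a y + \<gamma> * v y \<in> {..r}} \<in> sets borel"
        using measurable_sets[OF V.step_cost_measurable1, of "{..r}" x a] by (simp add: vimage_def)
      then show "{y. C t x a y + \<gamma> * v y \<in> {..r}} \<in> sets (P t x a)"
        using borel_prob_spaceD(2)[OF V.P_prob_algebra] by simp
    qed
    then show "measure (one_step_law \<gamma> C P t w x l) {..r} \<le> measure (one_step_law \<gamma> C P t v x l) {..r}"
      using borel_prob_spaceD(1)[OF V.one_step_law_space[OF l]] borel_prob_spaceD(1)[OF W.one_step_law_space[OF l]]
      by (simp add: finite_measure.emeasure_eq_measure prob_space.finite_measure)
  qed (use V.one_step_law_support[OF l B(1)] W.one_step_law_support[OF l B(2)] bounded_supportI in auto)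
qed

section \<open>Lower semicontinuity of the one-step risk\<close>

locale semicontinuous_control = risk_averse_control M F G \<sigma>0 \<sigma> \<A> P \<xi> \<Psi> Xp Ap C
  for M :: "'w measure" and F G :: "nat \<Rightarrow> 'w measure"
    and \<sigma>0 :: "real measure \<Rightarrow> ereal"
    and \<sigma> :: "nat \<Rightarrow> 'x::polish_space \<Rightarrow> real measure \<Rightarrow> ereal"
    and \<A> :: "nat \<Rightarrow> 'x \<Rightarrow> 'a::polish_space set"
    and P :: "nat \<Rightarrow> 'x \<Rightarrow> 'a \<Rightarrow> 'x measure"
    and \<xi> :: "'x measure"
    and \<Psi> :: "((nat \<Rightarrow> 'w \<Rightarrow> 'x) \<times> (nat \<Rightarrow> 'w \<Rightarrow> 'a)) set"
    and Xp :: "(nat \<Rightarrow> 'x \<Rightarrow> 'a measure) \<Rightarrow> nat \<Rightarrow> 'w \<Rightarrow> 'x"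
    and Ap :: "(nat \<Rightarrow> 'x \<Rightarrow> 'a measure) \<Rightarrow> nat \<Rightarrow> 'w \<Rightarrow> 'a"
    and C :: "nat \<Rightarrow> 'x \<Rightarrow> 'a \<Rightarrow> 'x \<Rightarrow> real" +
  fixes \<gamma> b :: real
  assumes gamma: "0 \<le> \<gamma>" "\<gamma> \<le> 1"
    and kernel_weakly_continuous:
      "\<And>t xs x0 as a0 (f :: 'x \<Rightarrow> real).
         \<lbrakk>t \<ge> 1; xs \<longlonglongrightarrow> x0; as \<longlonglongrightarrow> a0; continuous_on UNIV f; bounded (range f)\<rbrakk> \<Longrightarrow>
         (\<lambda>n. \<integral>y. f y \<partial>P t (xs n) (as n)) \<longlonglongrightarrow> (\<integral>y. f y \<partial>P t x0 a0)"
    and actions_compact: "\<And>t. t \<ge> 1 \<Longrightarrow> compact (\<Union>x. \<A> t x)"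
    and actions_upper_hemicontinuous:
      "\<And>t x V. \<lbrakk>t \<ge> 1; open V; \<A> t x \<subseteq> V\<rbrakk> \<Longrightarrow> \<exists>W. open W \<and> x \<in> W \<and> (\<forall>z \<in> W. \<A> t z \<subseteq> V)"
    and sigma_lower_semicontinuous:
      "\<And>t K \<mu> \<mu>0 xs x0.
         \<lbrakk>t \<ge> 1; compact K; \<And>n. \<mu> n \<in> prob_on K; \<mu>0 \<in> prob_on K;
          limitin weak_topology \<mu> \<mu>0 sequentially; xs \<longlonglongrightarrow> x0\<rbrakk> \<Longrightarrow>
         \<sigma> t x0 \<mu>0 \<le> liminf (\<lambda>n. \<sigma> t (xs n) (\<mu> n))"
    and cost_lower_semicontinuous:
      "\<And>t. t \<ge> 1 \<Longrightarrow> lower_semicontinuous (\<lambda>(x, a, y). C t x a y)"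
    and cost_bounded: "b > 0" "\<And>t x a y. t \<ge> 1 \<Longrightarrow> \<bar>C t x a y\<bar> \<le> b"
begin

abbreviation "opt_value \<equiv> J_opt \<gamma> C P \<sigma> \<A>"
abbreviation "pol_value \<equiv> J_pol \<gamma> C P \<sigma>"
abbreviation "min_step_risk \<equiv> S_op \<gamma> C P \<sigma> \<A>"
abbreviation "step_risk \<equiv> G_op \<gamma> C P \<sigma>"
abbreviation "step_law \<equiv> one_step_law \<gamma> C P"
abbreviation "optimal_laws \<equiv> argmin_set \<gamma> C P \<sigma> \<A>"

lemma one_step: "t \<ge> 1 \<Longrightarrow> v \<in> borel_measurable borel \<Longrightarrow> one_step C P t v"
  using kernel cost_measurable by unfold_locales auto

lemma step_cost_bound:
  assumes "t \<ge> 1" "\<And>y. \<bar>v y\<bar> \<le> R"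
  shows "\<bar>C t x a y + \<gamma> * v y\<bar> \<le> b + R"
proof -
  have "\<bar>\<gamma> * v y\<bar> \<le> 1 * R" unfolding abs_mult using gamma assms(2)[of y] by (intro mult_mono) auto
  then show ?thesis using cost_bounded(2)[OF assms(1), of x a y] by linarith
qed

lemma step_law_support:
  assumes "t \<ge> 1" "v \<in> borel_measurable borel" "\<And>y. \<bar>v y\<bar> \<le> R" "l \<in> space (prob_algebra borel)"
  shows "step_law t v x l \<in> prob_on (cball 0 (b + R))"
  using one_step.one_step_law_support[OF one_step[OF assms(1,2)] assms(4)] step_cost_bound[where v=v, OF assms(1,3)] by blast

lemma G_op_bounded:
  assumes "t \<ge> 1"
  shows "\<exists>R'. \<forall>v x l. v \<in> borel_measurable borel \<longrightarrow> (\<forall>y. \<bar>v y\<bar> \<le> R) \<longrightarrow> l \<in> space (prob_algebra borel) \<longrightarrow>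
    \<bar>step_risk t l v x\<bar> \<le> ereal R'"
proof -
  obtain c where c: "\<And>x. \<bar>\<sigma> t x (return borel 0)\<bar> \<le> ereal c" using sigma_bounded[OF assms] by blast
  have "\<bar>step_risk t l v x\<bar> \<le> ereal (c + (b + R))"
    if "v \<in> borel_measurable borel" "\<forall>y. \<bar>v y\<bar> \<le> R" "l \<in> space (prob_algebra borel)" for v x l
    unfolding G_op_def using step_law_support[OF assms that(1) _ that(3)] that(2) c
    by (intro law_invariant_convex_risk_measure.sigma_bounds[OF sigma_risk_measure[OF assms]]) auto
  then show ?thesis by blast
qed

lemma G_op_finite:
  assumes "t \<ge> 1" "v \<in> borel_measurable borel" "\<And>y. \<bar>v y\<bar> \<le> R" "l \<in> space (prob_algebra borel)"
  shows "\<bar>step_risk t l v x\<bar> \<noteq> \<infinity>"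
proof -
  obtain R' where "\<bar>step_risk t l v x\<bar> \<le> ereal R'" using G_op_bounded[OF assms(1), of R] assms(2-4) by blast
  then show ?thesis by auto
qed

lemma G_op_mono:
  assumes "t \<ge> 1" "v \<in> borel_measurable borel" "\<And>y. \<bar>v y\<bar> \<le> R" "w \<in> borel_measurable borel" "\<And>y. \<bar>w y\<bar> \<le> R"
    "\<And>y. v y \<le> w y" "l \<in> space (prob_algebra borel)"
  shows "step_risk t l v x \<le> step_risk t l w x"
  unfolding G_op_def
  by (rule one_step_law_mono[where P=P and C=C and B="b + R"])
    (use assms kernel cost_measurable gamma step_cost_bound sigma_risk_measure in auto)

lemma step_cost_lower_semicontinuous:
  assumes "t \<ge> 1" "lower_semicontinuous v"
  shows "lower_semicontinuous (\<lambda>((x, a), y). C t x a y + \<gamma> * v y)"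
proof -
  have "lower_semicontinuous (\<lambda>p. (\<lambda>(x, a, y). C t x a y) (fst (fst p), snd (fst p), snd p) + \<gamma> * v (snd p))"
    by (intro lower_semicontinuous_add lower_semicontinuous_cmult gamma
        lower_semicontinuous_compose[OF cost_lower_semicontinuous[OF assms(1)]]
        lower_semicontinuous_compose[OF assms(2)] continuous_intros)
  then show ?thesis by (simp add: case_prod_unfold)
qed

text \<open>Two applications of the portmanteau inequality: over the next state, with the
  state and the action as parameter, and over the action, with the state as parameter.\<close>

lemma one_step_integral_lower_semicontinuous:
  fixes g :: "real \<Rightarrow> real"
  assumes t: "t \<ge> 1" and v: "lower_semicontinuous v"
    and g: "mono g" "continuous_on UNIV g" "\<And>u. 0 \<le> g u" "\<And>u. g u \<le> 1"
    and lim: "xs \<longlonglongrightarrow> x" "weakly_converges ls l" and ls: "\<And>n. ls n \<in> space (prob_algebra borel)"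
    and l: "l \<in> space (prob_algebra borel)" and r: "r < (\<integral>u. g u \<partial>step_law t v x l)"
  shows "\<forall>\<^sub>F n in sequentially. r < (\<integral>u. g u \<partial>step_law t v (xs n) (ls n))"
proof -
  interpret one_step \<gamma> C P t v using t v by (intro one_step lower_semicontinuous_measurable)
  note gm = borel_measurable_continuous_onI[OF g(2)]
  define H where "H = (\<lambda>(x, a). \<integral>y. g (C t x a y + \<gamma> * v y) \<partial>P t x a)"
  have gl: "lower_semicontinuous (\<lambda>p. g ((\<lambda>((x, a), y). C t x a y + \<gamma> * v y) p))"
    by (rule lower_semicontinuous_mono_compose[OF step_cost_lower_semicontinuous[OF t v] g(1,2)])
  have "lower_semicontinuous H"
    unfolding lower_semicontinuous_sequentially
  proof (intro allI impI)
    fix zs z r assume z: "zs \<longlonglongrightarrow> z" and r: "r < H z"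
    have "weakly_converges (\<lambda>n. P t (fst (zs n)) (snd (zs n))) (P t (fst z) (snd z))"
      unfolding weakly_converges_def
      by (intro allI impI kernel_weakly_continuous[OF t] tendsto_fst[OF z] tendsto_snd[OF z])
    from weakly_converges_lower_semicontinuous[OF this P_prob_algebra P_prob_algebra z gl, of 1 r]
    show "\<forall>\<^sub>F n in sequentially. r < H (zs n)"
      using r g by (simp add: H_def case_prod_unfold)
  qed
  moreover have "\<bar>H p\<bar> \<le> 1" for p
  proof -
    obtain x a where p: "p = (x, a)" by (cases p)
    interpret Q: prob_space "P t x a" using P_prob_algebra by (rule borel_prob_spaceD)
    have "(\<lambda>y. g (C t x a y + \<gamma> * v y)) \<in> borel_measurable borel"
      using measurable_compose[OF step_cost_measurable1 gm] .
    then have "integrable (P t x a) (\<lambda>y. g (C t x a y + \<gamma> * v y))"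
      using g by (intro integrable_bounded_borel[OF P_prob_algebra, where B=1]) auto
    then have "(\<integral>y. g (C t x a y + \<gamma> * v y) \<partial>P t x a) \<le> 1" using g by (intro Q.integral_le_const) auto
    moreover have "0 \<le> (\<integral>y. g (C t x a y + \<gamma> * v y) \<partial>P t x a)" by (rule Bochner_Integration.integral_nonneg) (rule g(3))
    ultimately show ?thesis by (simp add: H_def p)
  qed
  ultimately have "\<forall>\<^sub>F n in sequentially. r < (\<integral>a. H (xs n, a) \<partial>ls n)"
    using weakly_converges_lower_semicontinuous[OF lim(2) ls l lim(1), of H 1 r] r
    by (simp add: H_def integral_one_step_law(1)[OF l gm g(3,4)])
  then show ?thesis by (simp add: H_def integral_one_step_law(1)[OF ls gm g(3,4)])
qed

text \<open>The one-step laws need not converge to the one-step law at the limit, since the integrand is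
  only lower semicontinuous. A weak limit \<open>\<mu>\<close> of a subsequence nevertheless dominates it
  stochastically, and \<open>\<sigma> t\<close> is lower semicontinuous along that subsequence.\<close>

lemma G_op_level_closed:
  assumes t: "t \<ge> 1" and v: "lower_semicontinuous v" "\<And>y. \<bar>v y\<bar> \<le> R"
    and lim: "xs \<longlonglongrightarrow> x" "weakly_converges ls l" and ls: "\<And>n. ls n \<in> space (prob_algebra borel)"
    and l: "l \<in> space (prob_algebra borel)"
    and r: "\<And>n. step_risk t (ls n) v (xs n) \<le> r"
  shows "step_risk t l v x \<le> r"
proof -
  interpret one_step \<gamma> C P t v using t v by (intro one_step lower_semicontinuous_measurable)
  interpret law_invariant_convex_risk_measure "\<sigma> t x" using sigma_risk_measure[OF t] .
  let ?Q = "\<lambda>x l. step_law t v x l"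
  have supp: "?Q x l \<in> prob_on (cball 0 (b + R))" if "l \<in> space (prob_algebra borel)" for x l
    using t that v by (intro step_law_support lower_semicontinuous_measurable)
  have pa: "?Q x l \<in> space (prob_algebra borel)" if "l \<in> space (prob_algebra borel)" for x l
    using supp[OF that] by (simp add: prob_on_def)
  obtain \<rho> \<mu> where \<rho>: "strict_mono (\<rho> :: nat \<Rightarrow> nat)" and \<mu>: "\<mu> \<in> prob_on (cball 0 (b + R))"
    "weakly_converges ((\<lambda>n. ?Q (xs n) (ls n)) \<circ> \<rho>) \<mu>"
    using prob_on_compact_convergent_subsequence[of "cball 0 (b + R)" "\<lambda>n. ?Q (xs n) (ls n)"] supp[OF ls] by auto
  have \<mu>p: "\<mu> \<in> space (prob_algebra borel)" using \<mu> by (simp add: prob_on_def)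
  have "\<sigma> t x (?Q x l) \<le> \<sigma> t x \<mu>"
  proof (rule monotone_integral)
    fix g :: "real \<Rightarrow> real" assume g: "mono g" "continuous_on UNIV g" "\<And>u. 0 \<le> g u" "\<And>u. g u \<le> 1"
    show "(\<integral>u. g u \<partial>?Q x l) \<le> (\<integral>u. g u \<partial>\<mu>)"
    proof (rule ccontr)
      assume "\<not> (\<integral>u. g u \<partial>?Q x l) \<le> (\<integral>u. g u \<partial>\<mu>)"
      then obtain c where c: "(\<integral>u. g u \<partial>\<mu>) < c" "c < (\<integral>u. g u \<partial>?Q x l)" by (meson dense not_le)
      have "\<forall>\<^sub>F n in sequentially. c < (\<integral>u. g u \<partial>?Q (xs n) (ls n))"
        by (rule one_step_integral_lower_semicontinuous[OF t v(1) g lim ls l c(2)])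
      then have "\<forall>\<^sub>F n in sequentially. c < (\<integral>u. g u \<partial>?Q (xs (\<rho> n)) (ls (\<rho> n)))"
        using eventually_subseq[OF \<rho>] by blast
      moreover have "bounded (range g)" using g by (auto simp: bounded_iff intro!: exI[of _ 1])
      then have "(\<lambda>n. \<integral>u. g u \<partial>?Q (xs (\<rho> n)) (ls (\<rho> n))) \<longlonglongrightarrow> (\<integral>u. g u \<partial>\<mu>)"
        using weakly_convergesD[OF \<mu>(2) g(2)] by (simp add: o_def)
      then have "\<forall>\<^sub>F n in sequentially. (\<integral>u. g u \<partial>?Q (xs (\<rho> n)) (ls (\<rho> n))) < c"
        using c(1) by (rule order_tendstoD)
      ultimately have "\<forall>\<^sub>F n in sequentially. False" by eventually_elim simp
      then show False by simp
    qed
  qed (use supp[OF l] \<mu>(1) bounded_supportI in auto)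
  also have "\<dots> \<le> liminf (\<lambda>n. \<sigma> t ((xs \<circ> \<rho>) n) (((\<lambda>n. ?Q (xs n) (ls n)) \<circ> \<rho>) n))"
  proof (rule sigma_lower_semicontinuous[OF t compact_cball])
    show "limitin weak_topology ((\<lambda>n. ?Q (xs n) (ls n)) \<circ> \<rho>) \<mu> sequentially"
      using pa[OF ls] by (intro weakly_converges_imp_limitin[OF \<mu>(2) _ \<mu>p]) auto
    show "(xs \<circ> \<rho>) \<longlonglongrightarrow> x" using lim(1) \<rho> by (rule LIMSEQ_subseq_LIMSEQ)
  qed (use supp[OF ls] \<mu>(1) in auto)
  also have "\<dots> \<le> r"
    using r unfolding G_op_def by (intro Liminf_le) auto
  finally show ?thesis by (simp add: G_op_def)
qed

section \<open>Minimising the one-step risk over the admissible actions\<close>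

lemma admissible_nonempty: "t \<ge> 1 \<Longrightarrow> prob_on (\<A> t x) \<noteq> {}"
proof -
  assume t: "t \<ge> 1"
  then obtain a where "a \<in> \<A> t x" using actions_nonempty by fastforce
  then have "return borel a \<in> prob_on (\<A> t x)" using actions_closed[OF t] by (intro return_in_prob_on) auto
  then show ?thesis by auto
qed

lemma admissible_subset: "t \<ge> 1 \<Longrightarrow> prob_on (\<A> t x) \<subseteq> prob_on (\<Union>x. \<A> t x)"
  using actions_closed[of t x] compact_imp_closed[OF actions_compact, of t]
  by (auto intro!: prob_on_mono[of "\<A> t x"])

lemma prob_on_prob_algebra: "l \<in> prob_on K \<Longrightarrow> l \<in> space (prob_algebra borel)"
  by (simp add: prob_on_def)

text \<open>The test function is the truncated distance to \<open>\<A> t x\<close>. By upper hemicontinuity it is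
  eventually at most \<open>e\<close> on \<open>\<A> t (xs n)\<close>, so its integral under the limit vanishes.\<close>

lemma admissible_closed_graph:
  assumes t: "t \<ge> 1" and xs: "xs \<longlonglongrightarrow> x" and ls: "\<And>n. ls n \<in> prob_on (\<A> t (xs n))" "weakly_converges ls l"
    and l: "l \<in> space (prob_algebra borel)"
  shows "l \<in> prob_on (\<A> t x)"
proof -
  let ?f = "\<lambda>a. min 1 (infdist a (\<A> t x))"
  have f: "continuous_on UNIV ?f" by (intro continuous_intros)
  have f01: "0 \<le> ?f a" "\<bar>?f a\<bar> \<le> 1" for a using infdist_nonneg[of a "\<A> t x"] by auto
  have fm: "?f \<in> borel_measurable borel" using f by (rule borel_measurable_continuous_onI)
  note cl = actions_closed[OF t] and ne = actions_nonempty[OF t]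
  interpret L: prob_space l using l by (rule borel_prob_spaceD)
  have "(\<lambda>n. \<integral>a. ?f a \<partial>ls n) \<longlonglongrightarrow> (\<integral>a. ?f a \<partial>l)"
    using f f01(2) by (intro weakly_convergesD[OF ls(2)]) (auto simp: bounded_iff intro!: exI[of _ 1])
  moreover have "\<forall>\<^sub>F n in sequentially. (\<integral>a. ?f a \<partial>ls n) \<le> e" if e: "e > 0" for e
  proof -
    let ?V = "{a. infdist a (\<A> t x) < e}"
    have "open ?V" by (intro open_Collect_less continuous_intros)
    moreover have "\<A> t x \<subseteq> ?V" using e by auto
    ultimately obtain W where W: "open W" "x \<in> W" "\<And>z. z \<in> W \<Longrightarrow> \<A> t z \<subseteq> ?V"
      using actions_upper_hemicontinuous[OF t, of ?V x] by auto
    have "\<forall>\<^sub>F n in sequentially. xs n \<in> W" using xs W by (simp add: topological_tendstoD)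
    then show ?thesis
    proof eventually_elim
      case (elim n)
      note p = prob_on_prob_algebra[OF ls(1)]
      interpret Ln: prob_space "ls n" using p by (rule borel_prob_spaceD)
      have "AE a in ls n. a \<in> \<A> t (xs n)" using ls(1)[of n] cl by (auto simp: prob_on_iff_AE)
      then have "AE a in ls n. ?f a \<le> e"
      proof eventually_elim
        case (elim a)
        then show ?case using W(3)[OF \<open>xs n \<in> W\<close>] by (auto simp: min_le_iff_disj)
      qed
      then show ?case using integrable_bounded_borel[OF p fm f01(2)] by (intro Ln.integral_le_const)
    qed
  qed
  ultimately have "(\<integral>a. ?f a \<partial>l) \<le> e" if "e > 0" for e
    using that tendsto_upperbound[of _ _ sequentially e] trivial_limit_sequentially by blast
  then have "(\<integral>a. ?f a \<partial>l) \<le> 0" by (rule field_le_epsilon) simp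
  then have "(\<integral>a. ?f a \<partial>l) = 0" using f01(1) by (intro antisym integral_nonneg) auto
  then have "AE a in l. ?f a = 0"
    using integral_nonneg_eq_0_iff_AE[OF integrable_bounded_borel[OF l fm f01(2)]] f01(1) by auto
  then have "AE a in l. a \<in> \<A> t x"
  proof eventually_elim
    case (elim a)
    then have "infdist a (\<A> t x) = 0" by (simp add: min_def split: if_splits)
    then show ?case using in_closed_iff_infdist_zero[OF cl ne] by simp
  qed
  then show ?thesis using l cl by (auto simp: prob_on_iff_AE)
qed

text \<open>With \<open>D\<close> the whole space this gives lower semicontinuity of the minimal risk; a general
  closed \<open>D\<close> is what the measurable selection of minimisers requires.\<close>

lemma G_op_sublevel_closed:
  assumes t: "t \<ge> 1" and v: "lower_semicontinuous v" "\<And>y. \<bar>v y\<bar> \<le> R" and D: "closed D"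
  shows "closed {x. \<exists>l\<in>prob_on (\<A> t x). moments l \<in> D \<and> step_risk t l v x \<le> r}"
  unfolding closed_sequential_limits
proof safe
  fix xs x assume "\<forall>n. xs n \<in> {x. \<exists>l\<in>prob_on (\<A> t x). moments l \<in> D \<and> step_risk t l v x \<le> r}"
    and x: "xs \<longlonglongrightarrow> x"
  then have "\<forall>n. \<exists>l. l \<in> prob_on (\<A> t (xs n)) \<and> moments l \<in> D \<and> step_risk t l v (xs n) \<le> r" by blast
  from choice[OF this] obtain ls where ls: "\<And>n. ls n \<in> prob_on (\<A> t (xs n))" "\<And>n. moments (ls n) \<in> D"
    "\<And>n. step_risk t (ls n) v (xs n) \<le> r" by blast
  have "ls n \<in> prob_on (\<Union>x. \<A> t x)" for n using ls(1)[of n] admissible_subset[OF t] by blast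
  then obtain \<rho> l where \<rho>: "strict_mono (\<rho> :: nat \<Rightarrow> nat)" and l: "l \<in> prob_on (\<Union>x. \<A> t x)" "weakly_converges (ls \<circ> \<rho>) l"
    using prob_on_compact_convergent_subsequence[OF actions_compact[OF t]] by blast
  note lp = prob_on_prob_algebra[OF l(1)]
  have xr: "(xs \<circ> \<rho>) \<longlonglongrightarrow> x" using x \<rho> by (rule LIMSEQ_subseq_LIMSEQ)
  have lA: "l \<in> prob_on (\<A> t x)"
    by (rule admissible_closed_graph[OF t xr _ l(2) lp]) (simp add: ls)
  moreover have "moments l \<in> D"
    using closed_sequentially[OF D _ weakly_converges_moments[OF l(2)]] ls(2) by simp
  moreover have "step_risk t l v x \<le> r"
    by (rule G_op_level_closed[OF t v xr l(2) _ lp]) (auto simp: ls intro: prob_on_prob_algebra[OF ls(1)])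
  ultimately show "\<exists>l\<in>prob_on (\<A> t x). moments l \<in> D \<and> step_risk t l v x \<le> r" by blast
qed

lemma G_op_sublevel_sequentially_closed:
  assumes t: "t \<ge> 1" and v: "lower_semicontinuous v" "\<And>y. \<bar>v y\<bar> \<le> R"
    and ls: "\<And>n. ls n \<in> {l \<in> prob_on (\<A> t x). step_risk t l v x \<le> r}"
    and l: "l \<in> prob_on (\<Union>x. \<A> t x)" "weakly_converges ls l"
  shows "l \<in> {l \<in> prob_on (\<A> t x). step_risk t l v x \<le> r}"
proof -
  note lp = prob_on_prob_algebra[OF l(1)]
  have "l \<in> prob_on (\<A> t x)" using ls by (intro admissible_closed_graph[OF t _ _ l(2) lp, of "\<lambda>_. x"]) auto
  moreover have "step_risk t l v x \<le> r"
    using ls by (intro G_op_level_closed[OF t v _ l(2) _ lp, of "\<lambda>_. x"]) (auto intro: prob_on_prob_algebra)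
  ultimately show ?thesis by simp
qed

text \<open>The minimisation is carried over to the compact sets \<open>N x\<close> of moment sequences, where
  \<open>\<phi>\<close> recovers a measure from its moments.\<close>

lemma minimisers_G_op:
  assumes t: "t \<ge> 1" and v: "lower_semicontinuous v" "\<And>y. \<bar>v y\<bar> \<le> R"
  defines "m \<equiv> \<lambda>x. minimisers (\<lambda>l. step_risk t l v x) (prob_on (\<A> t x))"
  shows "m x \<noteq> {}" "closedin weak_topology (m x)"
    "\<exists>\<pi>\<in>borel \<rightarrow>\<^sub>M prob_algebra borel. \<forall>x. \<pi> x \<in> m x"
proof -
  let ?K = "\<Union>x. \<A> t x" and ?g = "\<lambda>x l. step_risk t l v x"
  note K = actions_compact[OF t] and sub = admissible_subset[OF t]
  have vm: "v \<in> borel_measurable borel" using v(1) by (rule lower_semicontinuous_measurable)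
  define \<phi> where "\<phi> = inv_into (space (prob_algebra borel)) (moments :: 'a measure \<Rightarrow> nat \<Rightarrow> real)"
  have \<phi>: "\<phi> (moments l) = l" if "l \<in> prob_on S" for l S
    unfolding \<phi>_def using moments_inj prob_on_prob_algebra[OF that] by (rule inv_into_f_f)
  define N where "N x = moments ` prob_on (\<A> t x)" for x
  define h where "h x y = ?g x (\<phi> y)" for x y
  have sl: "compact (moments ` {l \<in> prob_on (\<A> t x). ?g x l \<le> r})" for x r
  proof (rule compact_moments_image[OF K])
    show "{l \<in> prob_on (\<A> t x). ?g x l \<le> r} \<subseteq> prob_on ?K" using sub[of x] by blast
  qed (rule G_op_sublevel_sequentially_closed[OF t v])
  have N: "compact (N x)" "N x \<noteq> {}" for x
    using sl[of x \<infinity>] admissible_nonempty[OF t] by (auto simp: N_def)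
  have lev: "closed {y \<in> N x. h x y \<le> ereal r}" for x r
  proof -
    have "{y \<in> N x. h x y \<le> ereal r} = moments ` {l \<in> prob_on (\<A> t x). ?g x l \<le> ereal r}"
      by (auto simp: N_def h_def \<phi>)
    then show ?thesis using compact_imp_closed[OF sl] by simp
  qed
  have min: "minimisers (h x) (N x) = moments ` m x" for x
    by (auto simp: minimisers_def N_def h_def \<phi> m_def)
  have hm: "hit_measurable borel (\<lambda>x. minimisers (h x) (N x))"
  proof (rule minimisers_hit_measurable[OF N lev])
    fix x y assume "y \<in> N x"
    then obtain l where "l \<in> prob_on (\<A> t x)" "y = moments l" by (auto simp: N_def)
    then show "h x y \<noteq> \<infinity>" using G_op_finite[OF t vm v(2), of l x] prob_on_prob_algebra[of l] by (auto simp: h_def \<phi>)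
  next
    fix D :: "(nat \<Rightarrow> real) set" and r :: real assume "closed D"
    have "{x \<in> space borel. \<exists>y\<in>N x \<inter> D. h x y \<le> ereal r} =
      {x. \<exists>l\<in>prob_on (\<A> t x). moments l \<in> D \<and> ?g x l \<le> ereal r}"
    proof -
      have "h x (moments l) = ?g x l" if "l \<in> prob_on (\<A> t x)" for x l using \<phi>[OF that] by (simp add: h_def)
      then have "(\<exists>y\<in>N x \<inter> D. h x y \<le> ereal r) \<longleftrightarrow> (\<exists>l\<in>prob_on (\<A> t x). moments l \<in> D \<and> ?g x l \<le> ereal r)" for x
        unfolding N_def by force
      then show ?thesis by simp
    qed
    then show "{x \<in> space borel. \<exists>y\<in>N x \<inter> D. h x y \<le> ereal r} \<in> sets borel"
      using G_op_sublevel_closed[OF t v \<open>closed D\<close>] by simp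
  qed
  have ne: "m x \<noteq> {}" for x using minimisers_compact(2)[OF N lev, of x] min[of x] by auto
  then show "m x \<noteq> {}" .
  obtain l0 where l0: "l0 \<in> m x" using ne by blast
  then have "m x = {l \<in> prob_on (\<A> t x). ?g x l \<le> ?g x l0}"
    by (auto simp: m_def minimisers_def intro: order_trans)
  moreover have "closedin weak_topology {l \<in> prob_on (\<A> t x). ?g x l \<le> ?g x l0}"
  proof (rule closedin_weak_topology_sequential[OF K])
    show "{l \<in> prob_on (\<A> t x). ?g x l \<le> ?g x l0} \<subseteq> prob_on ?K" using sub[of x] by blast
  qed (rule G_op_sublevel_sequentially_closed[OF t v])
  ultimately show "closedin weak_topology (m x)" by simp
  obtain s where s: "s \<in> borel_measurable borel" "\<And>x. s x \<in> minimisers (h x) (N x)"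
    using measurable_selection[OF minimisers_compact[OF N lev] hm] by auto
  have "\<phi> (s x) \<in> m x \<and> moments (\<phi> (s x)) = s x" for x
  proof -
    obtain l where l: "l \<in> m x" "s x = moments l" using s(2)[of x] min by blast
    moreover from l have "\<phi> (s x) = l" using \<phi> by (auto simp: m_def minimisers_def)
    ultimately show ?thesis by simp
  qed
  then have p: "\<phi> (s x) \<in> m x" "moments (\<phi> (s x)) = s x" for x by auto
  have "(\<lambda>x. \<phi> (s x)) \<in> borel \<rightarrow>\<^sub>M prob_algebra borel"
    using p s(1) by (subst measurable_moments_iff) (auto simp: m_def minimisers_def intro: prob_on_prob_algebra)
  then show "\<exists>\<pi>\<in>borel \<rightarrow>\<^sub>M prob_algebra borel. \<forall>x. \<pi> x \<in> m x" by (rule rev_bexI) (simp add: p(1))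
qed

lemma S_op_eq_minimum:
  assumes "l \<in> minimisers (\<lambda>l. step_risk t l v x) (prob_on (\<A> t x))"
  shows "min_step_risk t v x = step_risk t l v x"
  unfolding S_op_def using assms by (intro antisym INF_lower INF_greatest) (auto simp: minimisers_def)

lemma S_op_bounded:
  assumes t: "t \<ge> 1" and v: "lower_semicontinuous v" "\<And>y. \<bar>v y\<bar> \<le> R"
  shows "\<exists>R'. \<forall>x. \<bar>min_step_risk t v x\<bar> \<le> ereal R'"
proof -
  obtain R' where R': "\<And>x l. l \<in> space (prob_algebra borel) \<Longrightarrow> \<bar>step_risk t l v x\<bar> \<le> ereal R'"
    using G_op_bounded[OF t, of R] lower_semicontinuous_measurable[OF v(1)] v(2) by blast
  have "\<bar>min_step_risk t v x\<bar> \<le> ereal R'" for x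
  proof -
    obtain l where l: "l \<in> minimisers (\<lambda>l. step_risk t l v x) (prob_on (\<A> t x))"
      using minimisers_G_op(1)[OF t v, of x] by blast
    then show ?thesis using R'[of l x] S_op_eq_minimum[OF l] by (auto simp: minimisers_def intro: prob_on_prob_algebra)
  qed
  then show ?thesis by blast
qed

lemma S_op_lower_semicontinuous:
  assumes t: "t \<ge> 1" and v: "lower_semicontinuous v" "\<And>y. \<bar>v y\<bar> \<le> R"
  shows "lower_semicontinuous (\<lambda>x. real_of_ereal (min_step_risk t v x))"
  unfolding lower_semicontinuous_iff_closed
proof
  fix r
  have "(real_of_ereal (min_step_risk t v x) \<le> r) \<longleftrightarrow>
    (\<exists>l\<in>prob_on (\<A> t x). moments l \<in> UNIV \<and> step_risk t l v x \<le> ereal r)" for x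
  proof -
    obtain l where l: "l \<in> minimisers (\<lambda>l. step_risk t l v x) (prob_on (\<A> t x))"
      using minimisers_G_op(1)[OF t v, of x] by blast
    obtain R' where "\<bar>min_step_risk t v x\<bar> \<le> ereal R'" using S_op_bounded[OF t v] by blast
    then have "(real_of_ereal (min_step_risk t v x) \<le> r) \<longleftrightarrow> min_step_risk t v x \<le> ereal r"
      by (cases "min_step_risk t v x") auto
    then show ?thesis using l unfolding S_op_eq_minimum[OF l] by (auto simp: minimisers_def intro: order_trans)
  qed
  then show "closed {x. real_of_ereal (min_step_risk t v x) \<le> r}"
    using G_op_sublevel_closed[OF t v closed_UNIV, of "ereal r"] by simp
qed

section \<open>Value functions\<close>

lemma J_opt_bounded_lower_semicontinuous:
  assumes "t \<ge> 1"
  shows "lower_semicontinuous (\<lambda>x. real_of_ereal (opt_value T t x)) \<and>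
    (\<exists>R. \<forall>x. \<bar>opt_value T t x\<bar> \<le> ereal R)"
  using assms
proof (induction "Suc T - t" arbitrary: t)
  case 0
  then have "opt_value T t = (\<lambda>_. 0)" by (intro ext) (simp add: J_opt.simps)
  then show ?case by (auto simp: lower_semicontinuous_iff_closed intro!: exI[of _ 0])
next
  case (Suc n)
  then have tT: "t \<le> T" and n: "n = Suc T - Suc t" by auto
  let ?v = "\<lambda>y. real_of_ereal (opt_value T (Suc t) y)"
  from Suc(1)[OF n] obtain R where v: "lower_semicontinuous ?v" and R: "\<And>y. \<bar>opt_value T (Suc t) y\<bar> \<le> ereal R" by auto
  have vR: "\<bar>?v y\<bar> \<le> R" for y using R[of y] by (cases "opt_value T (Suc t) y") auto
  have "opt_value T t = min_step_risk t ?v" using tT by (intro ext) (subst J_opt.simps, simp)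
  then show ?case using S_op_lower_semicontinuous[OF Suc.prems v vR] S_op_bounded[OF Suc.prems v vR] by simp
qed

lemma argmin_set_eq_minimisers:
  "optimal_laws T t x = minimisers
     (\<lambda>l. step_risk t l (\<lambda>y. real_of_ereal (opt_value T (Suc t) y)) x) (prob_on (\<A> t x))"
  by (auto simp: argmin_set_def minimisers_def is_arg_min_def not_less)

lemma argmin_set_properties:
  assumes t: "t \<ge> 1"
  shows "optimal_laws T t x \<noteq> {}" "closedin weak_topology (optimal_laws T t x)"
    "\<exists>\<pi>\<in>borel \<rightarrow>\<^sub>M prob_algebra borel. \<forall>x. \<pi> x \<in> optimal_laws T t x"
proof -
  let ?v = "\<lambda>y. real_of_ereal (opt_value T (Suc t) y)"
  obtain R where v: "lower_semicontinuous ?v" and R: "\<And>y. \<bar>opt_value T (Suc t) y\<bar> \<le> ereal R"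
    using J_opt_bounded_lower_semicontinuous[of "Suc t" T] by auto
  have "\<bar>?v y\<bar> \<le> R" for y using R[of y] by (cases "opt_value T (Suc t) y") auto
  from minimisers_G_op[OF t v this]
  show "optimal_laws T t x \<noteq> {}" "closedin weak_topology (optimal_laws T t x)"
    "\<exists>\<pi>\<in>borel \<rightarrow>\<^sub>M prob_algebra borel. \<forall>x. \<pi> x \<in> optimal_laws T t x"
    unfolding argmin_set_eq_minimisers by blast+
qed

text \<open>Measurability of \<open>\<sigma> t\<close> refers to the Borel sets of a product topology, which
  are not generated by rectangles in any evident way. The moments solve this: the
  complement of an open set is carried to a closed set \<open>?D\<close> of a product of Polish spaces, by sequential compactness
  of the measures on an interval, and there measurability can be tested in each component.\<close>

lemma sigma_compose_measurable:
  assumes t: "t \<ge> 1" and X: "X \<in> N \<rightarrow>\<^sub>M borel" and \<kappa>: "\<kappa> \<in> N \<rightarrow>\<^sub>M prob_algebra borel"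
    and supp: "\<And>\<omega>. \<omega> \<in> space N \<Longrightarrow> \<kappa> \<omega> \<in> prob_on (cball 0 r)"
  shows "(\<lambda>\<omega>. \<sigma> t (X \<omega>) (\<kappa> \<omega>)) \<in> borel_measurable N"
proof -
  let ?K = "cball 0 r :: real set"
  let ?T = "prod_topology (euclidean :: 'x topology) (subtopology weak_topology (prob_on ?K))"
  let ?e = "\<lambda>(x :: 'x, \<mu> :: real measure). (x, moments \<mu>)"
  have top: "topspace ?T = UNIV \<times> prob_on ?K"
    by (auto simp: topspace_weak_topology prob_on_def)
  have "(\<lambda>\<omega>. (X \<omega>, \<kappa> \<omega>)) \<in> N \<rightarrow>\<^sub>M borel_of ?T"
    unfolding borel_of_def
  proof (rule measurable_measure_of)
    show "{V. openin ?T V} \<subseteq> Pow (topspace ?T)" using openin_subset by blast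
    show "(\<lambda>\<omega>. (X \<omega>, \<kappa> \<omega>)) \<in> space N \<rightarrow> topspace ?T" using supp top by auto
    fix V assume "V \<in> {V. openin ?T V}"
    then have V: "openin ?T V" by simp
    let ?D = "?e ` (UNIV \<times> prob_on ?K - V)"
    have "closed ?D" unfolding closed_sequential_limits
    proof (intro allI impI)
      fix zs z assume "(\<forall>n. zs n \<in> ?D) \<and> zs \<longlonglongrightarrow> z"
      then have z: "zs \<longlonglongrightarrow> z" and "\<forall>n. \<exists>p. p \<in> UNIV \<times> prob_on ?K - V \<and> zs n = ?e p" by blast+
      from choice[OF this(2)] obtain ps where ps: "\<And>n. ps n \<in> UNIV \<times> prob_on ?K - V" "\<And>n. zs n = ?e (ps n)" by blast
      define xs \<mu> where "xs n = fst (ps n)" and "\<mu> n = snd (ps n)" for n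
      have \<mu>: "\<mu> n \<in> prob_on ?K" "(xs n, \<mu> n) \<notin> V" "zs n = (xs n, moments (\<mu> n))" for n
        using ps(1)[of n] ps(2)[of n] by (auto simp: xs_def \<mu>_def case_prod_unfold)
      obtain \<rho> l where \<rho>: "strict_mono (\<rho> :: nat \<Rightarrow> nat)" and l: "l \<in> prob_on ?K" "weakly_converges (\<mu> \<circ> \<rho>) l"
        using prob_on_compact_convergent_subsequence[of ?K \<mu>] \<mu>(1) by auto
      have zr: "(zs \<circ> \<rho>) \<longlonglongrightarrow> z" using z \<rho> by (rule LIMSEQ_subseq_LIMSEQ)
      have xr: "(\<lambda>n. xs (\<rho> n)) \<longlonglongrightarrow> fst z" using tendsto_fst[OF zr] \<mu>(3) by (simp add: o_def)
      have mr: "(\<lambda>n. moments (\<mu> (\<rho> n))) \<longlonglongrightarrow> snd z" using tendsto_snd[OF zr] \<mu>(3) by (simp add: o_def)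
      moreover have "(\<lambda>n. moments (\<mu> (\<rho> n))) \<longlonglongrightarrow> moments l" using weakly_converges_moments[OF l(2)] by (simp add: o_def)
      ultimately have ml: "snd z = moments l" by (rule LIMSEQ_unique)
      have "limitin weak_topology (\<mu> \<circ> \<rho>) l sequentially"
        using \<mu>(1) l by (intro weakly_converges_imp_limitin) (auto intro: prob_on_prob_algebra)
      then have "limitin (subtopology weak_topology (prob_on ?K)) (\<lambda>n. \<mu> (\<rho> n)) l sequentially"
        using \<mu>(1) l(1) by (simp add: limitin_subtopology o_def)
      then have lim: "limitin ?T (\<lambda>n. (xs (\<rho> n), \<mu> (\<rho> n))) (fst z, l) sequentially"
        using xr by (simp add: limitin_pairwise o_def)
      have "(fst z, l) \<notin> V"
      proof
        assume "(fst z, l) \<in> V"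
        then have "\<forall>\<^sub>F n in sequentially. (xs (\<rho> n), \<mu> (\<rho> n)) \<in> V" using lim V unfolding limitin_def by blast
        then show False using \<mu>(2) by (simp add: eventually_False)
      qed
      then show "z \<in> ?D" using l(1) ml by (intro image_eqI[of _ _ "(fst z, l)"]) (auto simp: prod_eq_iff)
    qed
    then have Dm: "?D \<in> sets (borel \<Otimes>\<^sub>M borel)" unfolding borel_prod by (rule borel_closed)
    have "(\<lambda>\<omega>. moments (\<kappa> \<omega>)) \<in> borel_measurable N"
      using \<kappa> measurable_space[OF \<kappa>] by (subst measurable_moments_iff[symmetric]) auto
    then have "(\<lambda>\<omega>. (X \<omega>, moments (\<kappa> \<omega>))) \<in> N \<rightarrow>\<^sub>M borel \<Otimes>\<^sub>M borel" using X by simp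
    from measurable_sets[OF this Dm] have "space N - (\<lambda>\<omega>. (X \<omega>, moments (\<kappa> \<omega>))) -` ?D \<inter> space N \<in> sets N" by auto
    moreover have "space N - (\<lambda>\<omega>. (X \<omega>, moments (\<kappa> \<omega>))) -` ?D \<inter> space N = (\<lambda>\<omega>. (X \<omega>, \<kappa> \<omega>)) -` V \<inter> space N"
    proof -
      have "(X \<omega>, moments (\<kappa> \<omega>)) \<in> ?D \<longleftrightarrow> (X \<omega>, \<kappa> \<omega>) \<notin> V" if "\<omega> \<in> space N" for \<omega>
      proof
        assume "(X \<omega>, moments (\<kappa> \<omega>)) \<in> ?D"
        then obtain \<mu> where "\<mu> \<in> prob_on ?K" "moments (\<kappa> \<omega>) = moments \<mu>" "(X \<omega>, \<mu>) \<notin> V" by auto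
        moreover from this have "\<kappa> \<omega> = \<mu>"
          using supp[OF that] by (intro inj_onD[OF moments_inj]) (auto intro: prob_on_prob_algebra)
        ultimately show "(X \<omega>, \<kappa> \<omega>) \<notin> V" by simp
      next
        assume "(X \<omega>, \<kappa> \<omega>) \<notin> V"
        then show "(X \<omega>, moments (\<kappa> \<omega>)) \<in> ?D" using supp[OF that] by (intro image_eqI[of _ _ "(X \<omega>, \<kappa> \<omega>)"]) auto
      qed
      then show ?thesis by blast
    qed
    ultimately show "(\<lambda>\<omega>. (X \<omega>, \<kappa> \<omega>)) -` V \<inter> space N \<in> sets N" by simp
  qed
  from measurable_compose[OF this sigma_measurable[OF t compact_cball]] show ?thesis by simp
qed

lemma J_pol_bounded_measurable:
  assumes "t \<ge> 1" and p: "p \<in> markov_policies \<A>"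
  shows "(\<lambda>x. real_of_ereal (pol_value p T t x)) \<in> borel_measurable borel \<and>
    (\<exists>R. \<forall>x. \<bar>pol_value p T t x\<bar> \<le> ereal R)"
  using assms(1)
proof (induction "Suc T - t" arbitrary: t)
  case 0
  then have "pol_value p T t = (\<lambda>_. 0)" by (intro ext) (simp add: J_pol.simps)
  then show ?case by (auto intro!: exI[of _ 0])
next
  case (Suc n)
  then have tT: "t \<le> T" and n: "n = Suc T - Suc t" by auto
  let ?v = "\<lambda>y. real_of_ereal (pol_value p T (Suc t) y)"
  from Suc(1)[OF n] obtain R where v: "?v \<in> borel_measurable borel" and R: "\<And>y. \<bar>pol_value p T (Suc t) y\<bar> \<le> ereal R" by auto
  have vR: "\<bar>?v y\<bar> \<le> R" for y using R[of y] by (cases "pol_value p T (Suc t) y") auto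
  have J: "pol_value p T t x = step_risk t (p t x) ?v x" for x using tT by (subst J_pol.simps) (simp add: H_op_def)
  have pm: "p t \<in> borel \<rightarrow>\<^sub>M prob_algebra borel" using p Suc.prems by (auto simp: markov_policies_def)
  have ps: "p t x \<in> space (prob_algebra borel)" for x using measurable_space[OF pm, of x] by simp
  interpret one_step \<gamma> C P t ?v using Suc.prems v by (rule one_step)
  obtain R' where "\<And>x. \<bar>step_risk t (p t x) ?v x\<bar> \<le> ereal R'"
    using G_op_bounded[OF Suc.prems, of R] v vR ps by blast
  moreover have "(\<lambda>x. step_risk t (p t x) ?v x) \<in> borel_measurable borel"
    unfolding G_op_def using step_law_support[OF Suc.prems v vR ps] one_step_law_measurable[OF _ pm, of "\<lambda>x. x"]
    by (intro sigma_compose_measurable[OF Suc.prems, where r="b + R"]) auto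
  ultimately show ?case unfolding J by auto
qed

lemma J_opt_le_J_pol:
  assumes "t \<ge> 1" and p: "p \<in> markov_policies \<A>"
  shows "opt_value T t x \<le> pol_value p T t x"
  using assms(1)
proof (induction "Suc T - t" arbitrary: t x)
  case 0
  then show ?case by (simp add: J_pol.simps J_opt.simps)
next
  case (Suc n)
  then have tT: "t \<le> T" and n: "n = Suc T - Suc t" by auto
  let ?v = "\<lambda>y. real_of_ereal (opt_value T (Suc t) y)"
  let ?w = "\<lambda>y. real_of_ereal (pol_value p T (Suc t) y)"
  obtain R1 where v: "lower_semicontinuous ?v" and R1: "\<And>y. \<bar>opt_value T (Suc t) y\<bar> \<le> ereal R1"
    using J_opt_bounded_lower_semicontinuous[of "Suc t" T] by auto
  obtain R2 where w: "?w \<in> borel_measurable borel" and R2: "\<And>y. \<bar>pol_value p T (Suc t) y\<bar> \<le> ereal R2"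
    using J_pol_bounded_measurable[OF _ p, of "Suc t" T] by auto
  have pt: "p t x \<in> prob_on (\<A> t x)" using p Suc.prems by (auto simp: markov_policies_def)
  have le: "?v y \<le> ?w y" for y
    using Suc(1)[OF n, of y] R1[of y] R2[of y]
    by (cases "opt_value T (Suc t) y"; cases "pol_value p T (Suc t) y") auto
  have bd: "\<bar>?v y\<bar> \<le> max R1 R2" "\<bar>?w y\<bar> \<le> max R1 R2" for y using R1[of y] R2[of y]
    by (cases "opt_value T (Suc t) y"; cases "pol_value p T (Suc t) y"; auto)+
  have "opt_value T t x \<le> step_risk t (p t x) ?v x"
    using tT pt by (subst J_opt.simps) (auto simp: S_op_def intro: INF_lower)
  also have "\<dots> \<le> step_risk t (p t x) ?w x"
    by (rule G_op_mono[OF Suc.prems lower_semicontinuous_measurable[OF v] bd(1) w bd(2) le prob_on_prob_algebra[OF pt]])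
  also have "\<dots> = pol_value p T t x" using tT by (subst J_pol.simps) (simp add: H_op_def)
  finally show ?case .
qed

lemma J_pol_eq_J_opt:
  assumes "t \<ge> 1" and p: "\<And>t x. t \<in> {1..T} \<Longrightarrow> p t x \<in> optimal_laws T t x"
  shows "pol_value p T t x = opt_value T t x"
  using assms(1)
proof (induction "Suc T - t" arbitrary: t x)
  case 0
  then show ?case by (simp add: J_pol.simps J_opt.simps)
next
  case (Suc n)
  then have tT: "t \<le> T" and n: "n = Suc T - Suc t" by auto
  let ?v = "\<lambda>y. real_of_ereal (opt_value T (Suc t) y)"
  have IH: "pol_value p T (Suc t) = opt_value T (Suc t)" using Suc(1)[OF n] by auto
  have "pol_value p T t x = step_risk t (p t x) ?v x"
    using tT by (subst J_pol.simps) (simp add: H_op_def IH)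
  also have "\<dots> = min_step_risk t ?v x"
    using p[of t x] tT Suc.prems unfolding argmin_set_eq_minimisers by (intro S_op_eq_minimum[symmetric]) auto
  also have "\<dots> = opt_value T t x" using tT by (subst (2) J_opt.simps) simp
  finally show ?case .
qed

end

section \<open>Conditional laws\<close>

text \<open>The integrated form of a regular conditional law. Compared with conditional expectations it involves no
  almost sure statements, which makes it stable under composition of kernels.\<close>

definition is_cond_law :: "'w measure \<Rightarrow> 'w measure \<Rightarrow> 'y measure \<Rightarrow> ('w \<Rightarrow> 'y) \<Rightarrow> ('w \<Rightarrow> 'y measure) \<Rightarrow> bool" where
  "is_cond_law M N S Y \<kappa> \<longleftrightarrow> Y \<in> M \<rightarrow>\<^sub>M S \<and> \<kappa> \<in> N \<rightarrow>\<^sub>M prob_algebra S \<and>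
     (\<forall>D\<in>sets N. \<forall>B\<in>sets S. emeasure M {\<omega> \<in> space M. \<omega> \<in> D \<and> Y \<omega> \<in> B} =
        (\<integral>\<^sup>+\<omega>. indicator D \<omega> * emeasure (\<kappa> \<omega>) B \<partial>M))"

context prob_space
begin

context
  fixes N assumes N: "subalgebra M N"
begin

lemma subN: "space N = space M" "sets N \<subseteq> sets M" "D \<in> sets N \<Longrightarrow> D \<in> sets M"
  using N by (auto simp: subalgebra_def)

lemma sigma_finite_subalgebra_N: "sigma_finite_subalgebra M N"
  using N by (intro finite_measure_subalgebra_is_sigma_finite finite_measure_subalgebra.intro
      finite_measure_axioms finite_measure_subalgebra_axioms.intro)

lemma is_cond_law_iff_cond_exp:
  assumes Y: "Y \<in> M \<rightarrow>\<^sub>M S" and \<kappa>: "\<kappa> \<in> N \<rightarrow>\<^sub>M prob_algebra S"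
  shows "is_cond_law M N S Y \<kappa> \<longleftrightarrow>
    (\<forall>B\<in>sets S. AE \<omega> in M. real_cond_exp M N (indicator {\<omega> \<in> space M. Y \<omega> \<in> B}) \<omega> = measure (\<kappa> \<omega>) B)"
proof -
  interpret N: sigma_finite_subalgebra M N by (rule sigma_finite_subalgebra_N)
  have kp: "\<kappa> \<omega> \<in> space (prob_algebra S)" if "\<omega> \<in> space M" for \<omega>
    using measurable_space[OF \<kappa>] that subN(1) by simp
  have mk: "(\<lambda>\<omega>. measure (\<kappa> \<omega>) B) \<in> borel_measurable N" if "B \<in> sets S" for B
    using measurable_compose[OF measurable_prob_algebraD[OF \<kappa>] measurable_measure_subprob_algebra[OF that]] .
  have ik: "integrable M (\<lambda>\<omega>. measure (\<kappa> \<omega>) B)" if "B \<in> sets S" for B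
  proof (rule integrable_const_bound[where B=1])
    show "AE \<omega> in M. norm (measure (\<kappa> \<omega>) B) \<le> 1"
      using kp by (intro AE_I2) (auto simp: space_prob_algebra prob_space.prob_le_1)
  qed (rule measurable_from_subalg[OF N mk[OF that]])
  have mB: "{\<omega> \<in> space M. Y \<omega> \<in> B} \<in> sets M" if "B \<in> sets S" for B
    using measurable_sets[OF Y that] by (simp add: vimage_def Int_def conj_commute)
  have lhs: "emeasure M {\<omega> \<in> space M. \<omega> \<in> D \<and> Y \<omega> \<in> B} =
      ennreal (\<integral>\<omega>\<in>D. indicator {\<omega> \<in> space M. Y \<omega> \<in> B} \<omega> \<partial>M)" if "D \<in> sets N" "B \<in> sets S" for D B
  proof -
    have "{\<omega> \<in> space M. \<omega> \<in> D \<and> Y \<omega> \<in> B} = D \<inter> {\<omega> \<in> space M. Y \<omega> \<in> B}" by auto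
    then show ?thesis using mB[OF that(2)] subN(3)[OF that(1)]
      by (simp add: set_lebesgue_integral_def indicator_inter_arith[symmetric] emeasure_eq_measure)
  qed
  have rhs: "(\<integral>\<^sup>+\<omega>. indicator D \<omega> * emeasure (\<kappa> \<omega>) B \<partial>M) = ennreal (\<integral>\<omega>\<in>D. measure (\<kappa> \<omega>) B \<partial>M)"
    if "D \<in> sets N" "B \<in> sets S" for D B
  proof -
    have "(\<integral>\<^sup>+\<omega>. indicator D \<omega> * emeasure (\<kappa> \<omega>) B \<partial>M) = (\<integral>\<^sup>+\<omega>. ennreal (indicator D \<omega> * measure (\<kappa> \<omega>) B) \<partial>M)"
      using kp by (intro nn_integral_cong)
        (auto simp: space_prob_algebra prob_space.finite_measure finite_measure.emeasure_eq_measure indicator_def)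
    also have "\<dots> = ennreal (\<integral>\<omega>. indicator D \<omega> * measure (\<kappa> \<omega>) B \<partial>M)"
      using integrable_mult_indicator[OF subN(3)[OF that(1)] ik[OF that(2)]]
      by (intro nn_integral_eq_integral) auto
    finally show ?thesis by (simp add: set_lebesgue_integral_def)
  qed
  have nn: "0 \<le> (\<integral>\<omega>\<in>D. indicator {\<omega> \<in> space M. Y \<omega> \<in> B} \<omega> \<partial>M :: real)" "0 \<le> (\<integral>\<omega>\<in>D. measure (\<kappa> \<omega>) B \<partial>M)" for D B
    unfolding set_lebesgue_integral_def by (auto intro!: Bochner_Integration.integral_nonneg simp: indicator_def)
  have ii: "integrable M (indicator {\<omega> \<in> space M. Y \<omega> \<in> B} :: _ \<Rightarrow> real)" if "B \<in> sets S" for B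
    using mB[OF that] by (simp add: integrable_indicator_iff emeasure_eq_measure)
  show ?thesis
  proof
    assume L: "is_cond_law M N S Y \<kappa>"
    show "\<forall>B\<in>sets S. AE \<omega> in M. real_cond_exp M N (indicator {\<omega> \<in> space M. Y \<omega> \<in> B}) \<omega> = measure (\<kappa> \<omega>) B"
    proof (intro ballI N.real_cond_exp_charact)
      fix B D assume B: "B \<in> sets S" and D: "D \<in> sets N"
      show "(\<integral>\<omega>\<in>D. indicator {\<omega> \<in> space M. Y \<omega> \<in> B} \<omega> \<partial>M) = (\<integral>\<omega>\<in>D. measure (\<kappa> \<omega>) B \<partial>M)"
        using L B D lhs[OF D B] rhs[OF D B] nn unfolding is_cond_law_def by simp
    qed (use ii ik mk in auto)
  next
    assume R: "\<forall>B\<in>sets S. AE \<omega> in M. real_cond_exp M N (indicator {\<omega> \<in> space M. Y \<omega> \<in> B}) \<omega> = measure (\<kappa> \<omega>) B"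
    show "is_cond_law M N S Y \<kappa>" unfolding is_cond_law_def
    proof (intro conjI Y \<kappa> ballI)
      fix D B assume D: "D \<in> sets N" and B: "B \<in> sets S"
      have "(\<integral>\<omega>\<in>D. indicator {\<omega> \<in> space M. Y \<omega> \<in> B} \<omega> \<partial>M) =
        (\<integral>\<omega>\<in>D. real_cond_exp M N (indicator {\<omega> \<in> space M. Y \<omega> \<in> B}) \<omega> \<partial>M)"
        by (rule N.real_cond_exp_intA[OF ii[OF B] D])
      also have "\<dots> = (\<integral>\<omega>\<in>D. measure (\<kappa> \<omega>) B \<partial>M)"
        using R B subN(3)[OF D] measurable_from_subalg[OF N mk[OF B]]
        by (intro set_lebesgue_integral_cong_AE) auto
      finally show "emeasure M {\<omega> \<in> space M. \<omega> \<in> D \<and> Y \<omega> \<in> B} = (\<integral>\<^sup>+\<omega>. indicator D \<omega> * emeasure (\<kappa> \<omega>) B \<partial>M)"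
        using lhs[OF D B] rhs[OF D B] by simp
    qed
  qed
qed

text \<open>Both sides integrate \<open>h\<close> against a measure on \<open>N \<Otimes>\<^sub>M S\<close>: the joint law of the outcome and
  \<open>Y\<close>, and the measure built from the kernel. They agree on rectangles by definition.\<close>

lemma is_cond_law_nn_integral:
  assumes L: "is_cond_law M N S Y \<kappa>" and h: "h \<in> borel_measurable (N \<Otimes>\<^sub>M S)"
  shows "(\<integral>\<^sup>+\<omega>. h (\<omega>, Y \<omega>) \<partial>M) = (\<integral>\<^sup>+\<omega>. (\<integral>\<^sup>+y. h (\<omega>, y) \<partial>\<kappa> \<omega>) \<partial>M)"
proof -
  have Y: "Y \<in> M \<rightarrow>\<^sub>M S" and \<kappa>[measurable]: "\<kappa> \<in> N \<rightarrow>\<^sub>M prob_algebra S" using L by (auto simp: is_cond_law_def)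
  define R where "R = restr_to_subalg M N"
  have sR: "sets R = sets N" "space R = space M" unfolding R_def by (auto simp: sets_restr_to_subalg[OF N] space_restr_to_subalg)
  have Rp: "R \<in> space (prob_algebra N)"
    using prob_space_restr_to_subalg[OF N prob_space_axioms] sR by (simp add: space_prob_algebra R_def)
  define K where "K \<omega> = distr (\<kappa> \<omega>) (N \<Otimes>\<^sub>M S) (\<lambda>y. (\<omega>, y))" for \<omega>
  have K: "K \<in> N \<rightarrow>\<^sub>M prob_algebra (N \<Otimes>\<^sub>M S)"
    unfolding K_def by (rule measurable_distr_prob_space2[OF \<kappa>]) simp
  have id: "(\<lambda>\<omega>. (\<omega>, Y \<omega>)) \<in> M \<rightarrow>\<^sub>M N \<Otimes>\<^sub>M S"
    using Y measurable_from_subalg[OF N measurable_ident] by (intro measurable_Pair) (auto simp: id_def)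
  have sk: "sets (\<kappa> \<omega>) = sets S" if "\<omega> \<in> space M" for \<omega>
    using measurable_space[OF \<kappa>] that subN(1) by (auto simp: space_prob_algebra)
  have pk: "(\<lambda>y. (\<omega>, y)) \<in> \<kappa> \<omega> \<rightarrow>\<^sub>M N \<Otimes>\<^sub>M S" if "\<omega> \<in> space M" for \<omega>
    using that subN(1) by (simp add: sk[OF that] cong: measurable_cong_sets)
  have "distr M (N \<Otimes>\<^sub>M S) (\<lambda>\<omega>. (\<omega>, Y \<omega>)) = R \<bind> K"
  proof (rule measure_eqI_generator_eq[OF Int_stable_pair_measure_generator[of N S], of "space N \<times> space S" _ _ "\<lambda>_. space N \<times> space S"])
    show "sets (distr M (N \<Otimes>\<^sub>M S) (\<lambda>\<omega>. (\<omega>, Y \<omega>))) = sigma_sets (space N \<times> space S) {a \<times> b |a b. a \<in> sets N \<and> b \<in> sets S}"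
      by (simp add: sets_pair_measure)
    show "sets (R \<bind> K) = sigma_sets (space N \<times> space S) {a \<times> b |a b. a \<in> sets N \<and> b \<in> sets S}"
      by (simp add: sets_bind'[OF Rp K] sets_pair_measure)
    show "emeasure (distr M (N \<Otimes>\<^sub>M S) (\<lambda>\<omega>. (\<omega>, Y \<omega>))) (space N \<times> space S) \<noteq> \<infinity>"
      using prob_space.finite_measure[OF prob_space_distr[OF id]] finite_measure.emeasure_finite by auto
  next
    fix Z assume "Z \<in> {a \<times> b |a b. a \<in> sets N \<and> b \<in> sets S}"
    then obtain D B where Z: "Z = D \<times> B" "D \<in> sets N" "B \<in> sets S" by auto
    then have Zs: "Z \<in> sets (N \<Otimes>\<^sub>M S)" by simp
    have "emeasure (distr M (N \<Otimes>\<^sub>M S) (\<lambda>\<omega>. (\<omega>, Y \<omega>))) Z = emeasure M {\<omega> \<in> space M. \<omega> \<in> D \<and> Y \<omega> \<in> B}"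
      using id Zs by (subst emeasure_distr) (auto simp: Z(1) intro!: arg_cong[where f="emeasure M"])
    also have "\<dots> = (\<integral>\<^sup>+\<omega>. indicator D \<omega> * emeasure (\<kappa> \<omega>) B \<partial>M)"
      using L Z unfolding is_cond_law_def by blast
    also have "\<dots> = (\<integral>\<^sup>+\<omega>. emeasure (K \<omega>) Z \<partial>M)"
    proof (rule nn_integral_cong)
      fix \<omega> assume w: "\<omega> \<in> space M"
      have "emeasure (K \<omega>) Z = emeasure (\<kappa> \<omega>) ((\<lambda>y. (\<omega>, y)) -` Z \<inter> space (\<kappa> \<omega>))"
        unfolding K_def using pk[OF w] Zs by (rule emeasure_distr)
      also have "(\<lambda>y. (\<omega>, y)) -` Z \<inter> space (\<kappa> \<omega>) = (if \<omega> \<in> D then B else {})"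
        using sets.sets_into_space[OF Z(3)] sets_eq_imp_space_eq[OF sk[OF w]] by (auto simp: Z(1))
      finally show "indicator D \<omega> * emeasure (\<kappa> \<omega>) B = emeasure (K \<omega>) Z" by auto
    qed
    also have "\<dots> = (\<integral>\<^sup>+\<omega>. emeasure (K \<omega>) Z \<partial>R)" unfolding R_def
      using measurable_compose[OF measurable_prob_algebraD[OF K] measurable_emeasure_subprob_algebra[OF Zs]]
      by (rule nn_integral_subalgebra2[OF N, symmetric])
    also have "\<dots> = emeasure (R \<bind> K) Z" using emeasure_bind_prob_algebra[OF Rp K Zs] by simp
    finally show "emeasure (distr M (N \<Otimes>\<^sub>M S) (\<lambda>\<omega>. (\<omega>, Y \<omega>))) Z = emeasure (R \<bind> K) Z" .
  qed (auto dest: sets.sets_into_space)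
  then have "(\<integral>\<^sup>+p. h p \<partial>distr M (N \<Otimes>\<^sub>M S) (\<lambda>\<omega>. (\<omega>, Y \<omega>))) = (\<integral>\<^sup>+p. h p \<partial>(R \<bind> K))" by simp
  also have "\<dots> = (\<integral>\<^sup>+\<omega>. \<integral>\<^sup>+p. h p \<partial>K \<omega> \<partial>R)"
    using h measurable_prob_algebraD[OF K] sR(1) by (intro nn_integral_bind) (auto cong: measurable_cong_sets)
  also have "\<dots> = (\<integral>\<^sup>+\<omega>. \<integral>\<^sup>+p. h p \<partial>K \<omega> \<partial>M)" unfolding R_def
    using measurable_compose[OF measurable_prob_algebraD[OF K] nn_integral_measurable_subprob_algebra[OF h]]
    by (rule nn_integral_subalgebra2[OF N])
  also have "\<dots> = (\<integral>\<^sup>+\<omega>. (\<integral>\<^sup>+y. h (\<omega>, y) \<partial>\<kappa> \<omega>) \<partial>M)"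
    unfolding K_def using pk h by (intro nn_integral_cong nn_integral_distr) auto
  finally show ?thesis using h by (simp add: nn_integral_distr[OF id])
qed

text \<open>Whatever is measurable with respect to \<open>N\<close> may be held fixed under the conditional law.\<close>

lemma is_cond_law_freeze:
  assumes L: "is_cond_law M N S Y \<kappa>" and X: "X \<in> N \<rightarrow>\<^sub>M S1" and f: "f \<in> S1 \<Otimes>\<^sub>M S \<rightarrow>\<^sub>M R"
  shows "is_cond_law M N R (\<lambda>\<omega>. f (X \<omega>, Y \<omega>)) (\<lambda>\<omega>. distr (\<kappa> \<omega>) R (\<lambda>y. f (X \<omega>, y)))"
  unfolding is_cond_law_def
proof (intro conjI ballI)
  note [measurable] = X f
  have [measurable]: "Y \<in> M \<rightarrow>\<^sub>M S" and \<kappa>[measurable]: "\<kappa> \<in> N \<rightarrow>\<^sub>M prob_algebra S" using L by (auto simp: is_cond_law_def)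
  have [measurable]: "X \<in> M \<rightarrow>\<^sub>M S1" using measurable_from_subalg[OF N X] .
  show "(\<lambda>\<omega>. f (X \<omega>, Y \<omega>)) \<in> M \<rightarrow>\<^sub>M R" by measurable
  show "(\<lambda>\<omega>. distr (\<kappa> \<omega>) R (\<lambda>y. f (X \<omega>, y))) \<in> N \<rightarrow>\<^sub>M prob_algebra R"
    by (rule measurable_distr_prob_space2[OF \<kappa>]) simp
  fix D B assume D[measurable]: "D \<in> sets N" and B[measurable]: "B \<in> sets R"
  define h where "h = (\<lambda>p. indicator D (fst p) * indicator B (f (X (fst p), snd p)) :: ennreal)"
  have h: "h \<in> borel_measurable (N \<Otimes>\<^sub>M S)" unfolding h_def by measurable
  have Dm[measurable]: "D \<in> sets M" using D by (rule subN(3))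
  have "emeasure M {\<omega> \<in> space M. \<omega> \<in> D \<and> f (X \<omega>, Y \<omega>) \<in> B} = (\<integral>\<^sup>+\<omega>. indicator {\<omega> \<in> space M. \<omega> \<in> D \<and> f (X \<omega>, Y \<omega>) \<in> B} \<omega> \<partial>M)"
    by (rule nn_integral_indicator[symmetric]) measurable
  also have "\<dots> = (\<integral>\<^sup>+\<omega>. h (\<omega>, Y \<omega>) \<partial>M)"
    by (intro nn_integral_cong) (auto simp: h_def indicator_def)
  also have "\<dots> = (\<integral>\<^sup>+\<omega>. (\<integral>\<^sup>+y. h (\<omega>, y) \<partial>\<kappa> \<omega>) \<partial>M)" by (rule is_cond_law_nn_integral[OF L h])
  also have "\<dots> = (\<integral>\<^sup>+\<omega>. indicator D \<omega> * emeasure (distr (\<kappa> \<omega>) R (\<lambda>y. f (X \<omega>, y))) B \<partial>M)"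
  proof (rule nn_integral_cong)
    fix \<omega> assume w: "\<omega> \<in> space M"
    then have sk: "sets (\<kappa> \<omega>) = sets S" and Xw: "X \<omega> \<in> space S1"
      using measurable_space[OF \<kappa>] measurable_space[OF X] subN(1) by (auto simp: space_prob_algebra)
    have m: "(\<lambda>y. f (X \<omega>, y)) \<in> \<kappa> \<omega> \<rightarrow>\<^sub>M R" using Xw by (simp add: sk cong: measurable_cong_sets)
    have "(\<integral>\<^sup>+y. h (\<omega>, y) \<partial>\<kappa> \<omega>) = (\<integral>\<^sup>+y. indicator D \<omega> * indicator ((\<lambda>y. f (X \<omega>, y)) -` B \<inter> space (\<kappa> \<omega>)) y \<partial>\<kappa> \<omega>)"
      by (intro nn_integral_cong) (auto simp: h_def indicator_def)
    also have "\<dots> = indicator D \<omega> * emeasure (\<kappa> \<omega>) ((\<lambda>y. f (X \<omega>, y)) -` B \<inter> space (\<kappa> \<omega>))"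
      using measurable_sets[OF m B] by (simp add: nn_integral_cmult)
    finally show "(\<integral>\<^sup>+y. h (\<omega>, y) \<partial>\<kappa> \<omega>) = indicator D \<omega> * emeasure (distr (\<kappa> \<omega>) R (\<lambda>y. f (X \<omega>, y))) B"
      using emeasure_distr[OF m B] by simp
  qed
  finally show "emeasure M {\<omega> \<in> space M. \<omega> \<in> D \<and> f (X \<omega>, Y \<omega>) \<in> B} =
    (\<integral>\<^sup>+\<omega>. indicator D \<omega> * emeasure (distr (\<kappa> \<omega>) R (\<lambda>y. f (X \<omega>, y))) B \<partial>M)" .
qed

text \<open>Conditioning on the larger \<open>N'\<close> first: there the kernel depends on the outcome only through \<open>X\<close>
  and \<open>A\<close>, so averaging over the conditional law of \<open>A\<close> given \<open>N\<close> yields the conditional law given \<open>N\<close>.\<close>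

lemma is_cond_law_tower:
  assumes N': "subalgebra N' N" and L': "is_cond_law M N' S Y (\<lambda>\<omega>. k (X \<omega>, A \<omega>))"
    and X: "X \<in> N \<rightarrow>\<^sub>M S1" and L: "is_cond_law M N S2 A \<kappa>" and k: "k \<in> S1 \<Otimes>\<^sub>M S2 \<rightarrow>\<^sub>M prob_algebra S"
  shows "is_cond_law M N S Y (\<lambda>\<omega>. \<kappa> \<omega> \<bind> (\<lambda>a. k (X \<omega>, a)))"
  unfolding is_cond_law_def
proof (intro conjI ballI)
  note [measurable] = X k
  have \<kappa>[measurable]: "\<kappa> \<in> N \<rightarrow>\<^sub>M prob_algebra S2" using L by (auto simp: is_cond_law_def)
  show "Y \<in> M \<rightarrow>\<^sub>M S" using L' by (auto simp: is_cond_law_def)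
  show "(\<lambda>\<omega>. \<kappa> \<omega> \<bind> (\<lambda>a. k (X \<omega>, a))) \<in> N \<rightarrow>\<^sub>M prob_algebra S"
    by (rule measurable_bind_prob_space2[OF \<kappa>]) simp
  fix D B assume D[measurable]: "D \<in> sets N" and B[measurable]: "B \<in> sets S"
  define h where "h = (\<lambda>p. indicator D (fst p) * emeasure (k (X (fst p), snd p)) B)"
  have ke[measurable]: "(\<lambda>q. emeasure (k q) B) \<in> borel_measurable (S1 \<Otimes>\<^sub>M S2)"
    using measurable_compose[OF measurable_prob_algebraD[OF k] measurable_emeasure_subprob_algebra[OF B]] .
  have h: "h \<in> borel_measurable (N \<Otimes>\<^sub>M S2)" unfolding h_def by measurable
  have "D \<in> sets N'" using N' D by (auto simp: subalgebra_def)
  then have "emeasure M {\<omega> \<in> space M. \<omega> \<in> D \<and> Y \<omega> \<in> B} = (\<integral>\<^sup>+\<omega>. h (\<omega>, A \<omega>) \<partial>M)"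
    using L' B by (simp add: is_cond_law_def h_def)
  also have "\<dots> = (\<integral>\<^sup>+\<omega>. (\<integral>\<^sup>+a. h (\<omega>, a) \<partial>\<kappa> \<omega>) \<partial>M)" by (rule is_cond_law_nn_integral[OF L h])
  also have "\<dots> = (\<integral>\<^sup>+\<omega>. indicator D \<omega> * emeasure (\<kappa> \<omega> \<bind> (\<lambda>a. k (X \<omega>, a))) B \<partial>M)"
  proof (rule nn_integral_cong)
    fix \<omega> assume w: "\<omega> \<in> space M"
    then have kw: "\<kappa> \<omega> \<in> space (prob_algebra S2)" and Xw: "X \<omega> \<in> space S1"
      using measurable_space[OF \<kappa>] measurable_space[OF X] subN(1) by auto
    have kk: "(\<lambda>a. k (X \<omega>, a)) \<in> S2 \<rightarrow>\<^sub>M prob_algebra S" using Xw by simp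
    have "(\<lambda>a. emeasure (k (X \<omega>, a)) B) \<in> borel_measurable (\<kappa> \<omega>)"
      using measurable_compose[OF measurable_prob_algebraD[OF kk] measurable_emeasure_subprob_algebra[OF B]] kw
      by (simp add: space_prob_algebra cong: measurable_cong_sets)
    then show "(\<integral>\<^sup>+a. h (\<omega>, a) \<partial>\<kappa> \<omega>) = indicator D \<omega> * emeasure (\<kappa> \<omega> \<bind> (\<lambda>a. k (X \<omega>, a))) B"
      using emeasure_bind_prob_algebra[OF kw kk B] by (simp add: h_def nn_integral_cmult)
  qed
  finally show "emeasure M {\<omega> \<in> space M. \<omega> \<in> D \<and> Y \<omega> \<in> B} =
    (\<integral>\<^sup>+\<omega>. indicator D \<omega> * emeasure (\<kappa> \<omega> \<bind> (\<lambda>a. k (X \<omega>, a))) B \<partial>M)" .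
qed

lemma is_cond_law_cong_AE:
  assumes L: "is_cond_law M N S Y \<kappa>" and Y': "Y' \<in> M \<rightarrow>\<^sub>M S" "AE \<omega> in M. Y' \<omega> = Y \<omega>"
  shows "is_cond_law M N S Y' \<kappa>"
  unfolding is_cond_law_def
proof (intro conjI ballI)
  note [measurable] = Y'(1)
  have [measurable]: "Y \<in> M \<rightarrow>\<^sub>M S" using L by (auto simp: is_cond_law_def)
  fix D B assume D: "D \<in> sets N" and B[measurable]: "B \<in> sets S"
  have [measurable]: "D \<in> sets M" using D by (rule subN(3))
  have "emeasure M {\<omega> \<in> space M. \<omega> \<in> D \<and> Y' \<omega> \<in> B} = emeasure M {\<omega> \<in> space M. \<omega> \<in> D \<and> Y \<omega> \<in> B}"
    using Y'(2) by (intro emeasure_eq_AE) auto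
  then show "emeasure M {\<omega> \<in> space M. \<omega> \<in> D \<and> Y' \<omega> \<in> B} = (\<integral>\<^sup>+\<omega>. indicator D \<omega> * emeasure (\<kappa> \<omega>) B \<partial>M)"
    using L D B by (simp add: is_cond_law_def)
qed (use L Y' in \<open>auto simp: is_cond_law_def\<close>)

text \<open>The kernel \<open>\<kappa>\<close>, corrected on a null set, shows that a version with the required support exists, so
  that \<^const>\<open>reg_cond_distr\<close> is one. Two versions agree almost surely on each of countably many
  sets that determine a measure.\<close>

lemma reg_cond_distr_AE_eq:
  assumes L: "is_cond_law M N borel Y \<kappa>"
  shows "AE \<omega> in M. reg_cond_distr M N Y \<omega> = \<kappa> \<omega>"
proof -
  have Y[measurable]: "Y \<in> borel_measurable M" and \<kappa>[measurable]: "\<kappa> \<in> N \<rightarrow>\<^sub>M prob_algebra borel"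
    using L by (auto simp: is_cond_law_def)
  define e where "e = esssup M (\<lambda>\<omega>. ereal \<bar>Y \<omega>\<bar>)"
  define I where "I = {r::real. ereal \<bar>r\<bar> \<le> e}"
  have I[measurable]: "I \<in> sets borel" unfolding I_def by measurable
  have YI: "AE \<omega> in M. Y \<omega> \<in> I" unfolding I_def e_def mem_Collect_eq by (rule esssup_AE)
  have "0 \<in> I"
  proof -
    have "AE \<omega> in M. 0 \<le> e" using YI
    proof eventually_elim
      case (elim \<omega>)
      then have "ereal \<bar>Y \<omega>\<bar> \<le> e" by (simp add: I_def)
      moreover have "0 \<le> ereal \<bar>Y \<omega>\<bar>" by simp
      ultimately show ?case by (rule order_trans[rotated])
    qed
    then have "0 \<le> e" by simp
    then show ?thesis by (simp add: I_def zero_ereal_def)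
  qed
  have kp: "\<kappa> \<omega> \<in> space (prob_algebra borel)" if "\<omega> \<in> space M" for \<omega>
    using measurable_space[OF \<kappa>] that subN(1) by simp
  have km: "(\<lambda>\<omega>. measure (\<kappa> \<omega>) B) \<in> borel_measurable N" if "B \<in> sets borel" for B
    using measurable_compose[OF measurable_prob_algebraD[OF \<kappa>] measurable_measure_subprob_algebra[OF that]] .
  (* The support condition holds almost surely, and the version is corrected on the exceptional null set. *)
  have k1: "measure (\<kappa> \<omega>) I \<le> 1" if "\<omega> \<in> space M" for \<omega>
    using borel_prob_spaceD(1)[OF kp[OF that]] by (rule prob_space.prob_le_1)
  have kI: "AE \<omega> in M. measure (\<kappa> \<omega>) I = 1"
  proof -
    have "(\<integral>\<^sup>+\<omega>. indicator (space N) \<omega> * emeasure (\<kappa> \<omega>) I \<partial>M) = emeasure M {\<omega> \<in> space M. \<omega> \<in> space N \<and> Y \<omega> \<in> I}"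
    proof -
      have "\<forall>D\<in>sets N. \<forall>B\<in>sets borel. emeasure M {\<omega> \<in> space M. \<omega> \<in> D \<and> Y \<omega> \<in> B} =
        (\<integral>\<^sup>+\<omega>. indicator D \<omega> * emeasure (\<kappa> \<omega>) B \<partial>M)" using L unfolding is_cond_law_def by blast
      from this[rule_format, OF sets.top I] show ?thesis by simp
    qed
    also have "\<dots> = 1" using YI subN(1) by (subst emeasure_eq_1_AE) auto
    finally have "(\<integral>\<^sup>+\<omega>. emeasure (\<kappa> \<omega>) I \<partial>M) = 1"
      using subN(1) by (simp cong: nn_integral_cong)
    moreover have "(\<integral>\<^sup>+\<omega>. emeasure (\<kappa> \<omega>) I \<partial>M) = ennreal (\<integral>\<omega>. measure (\<kappa> \<omega>) I \<partial>M)"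
    proof -
      have "(\<integral>\<^sup>+\<omega>. emeasure (\<kappa> \<omega>) I \<partial>M) = (\<integral>\<^sup>+\<omega>. ennreal (measure (\<kappa> \<omega>) I) \<partial>M)"
      proof (rule nn_integral_cong)
        fix \<omega> assume "\<omega> \<in> space M"
        then show "emeasure (\<kappa> \<omega>) I = ennreal (measure (\<kappa> \<omega>) I)"
          using borel_prob_spaceD(1)[OF kp] by (simp add: prob_space.finite_measure finite_measure.emeasure_eq_measure)
      qed
      also have "\<dots> = ennreal (\<integral>\<omega>. measure (\<kappa> \<omega>) I \<partial>M)"
        using k1 measurable_from_subalg[OF N km[OF I]]
        by (intro nn_integral_eq_integral integrable_const_bound[where B=1] AE_I2) auto
      finally show ?thesis .
    qed
    ultimately have i1: "(\<integral>\<omega>. measure (\<kappa> \<omega>) I \<partial>M) = 1" by simp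
    have int: "integrable M (\<lambda>\<omega>. measure (\<kappa> \<omega>) I)"
      using k1 measurable_from_subalg[OF N km[OF I]]
      by (intro integrable_const_bound[where B=1] AE_I2) auto
    have "(\<integral>\<omega>. 1 - measure (\<kappa> \<omega>) I \<partial>M) = 0" using int i1 by (simp add: prob_space)
    then have "AE \<omega> in M. 1 - measure (\<kappa> \<omega>) I = 0" using int k1
      by (subst (asm) integral_nonneg_eq_0_iff_AE) (auto intro!: AE_I2)
    then show ?thesis by eventually_elim simp
  qed
  define \<kappa>' where "\<kappa>' \<omega> = (if measure (\<kappa> \<omega>) I = 1 then \<kappa> \<omega> else return borel 0)" for \<omega>
  have "\<kappa>' \<in> N \<rightarrow>\<^sub>M prob_algebra borel"
    unfolding \<kappa>'_def using km[OF I] by (intro measurable_If \<kappa> measurable_const) (auto simp: space_prob_algebra prob_space_return)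
  moreover have "AE \<omega> in M. measure (\<kappa>' \<omega>) B = real_cond_exp M N (indicator {\<omega>' \<in> space M. Y \<omega>' \<in> B}) \<omega>" if "B \<in> sets borel" for B
  proof -
    have "AE \<omega> in M. real_cond_exp M N (indicator {\<omega> \<in> space M. Y \<omega> \<in> B}) \<omega> = measure (\<kappa> \<omega>) B"
      using L is_cond_law_iff_cond_exp[OF Y \<kappa>] that by blast
    with kI show ?thesis by eventually_elim (simp add: \<kappa>'_def)
  qed
  moreover have "measure (\<kappa>' \<omega>) I = 1" for \<omega>
    using \<open>0 \<in> I\<close> I by (simp add: \<kappa>'_def measure_return)
  ultimately have ex: "is_reg_cond_distr M N Y \<kappa>'" by (simp add: is_reg_cond_distr_def I_def e_def)
  define \<rho> where "\<rho> = reg_cond_distr M N Y"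
  have \<rho>: "is_reg_cond_distr M N Y \<rho>" unfolding \<rho>_def reg_cond_distr_def using ex by (rule someI[of "is_reg_cond_distr M N Y"])
  have measures_eq: "AE \<omega> in M. \<forall>U\<in>basic_opens. measure (\<rho> \<omega>) U = measure (\<kappa> \<omega>) U"
  proof (subst AE_ball_countable[OF basic_opens(1)], rule ballI)
    fix U :: "real set" assume "U \<in> basic_opens"
    then have U: "U \<in> sets borel" by (intro borel_open basic_opens(4))
    have "AE \<omega> in M. real_cond_exp M N (indicator {\<omega> \<in> space M. Y \<omega> \<in> U}) \<omega> = measure (\<kappa> \<omega>) U"
      using L is_cond_law_iff_cond_exp[OF Y \<kappa>] U by blast
    moreover have "AE \<omega> in M. measure (\<rho> \<omega>) U = real_cond_exp M N (indicator {\<omega>' \<in> space M. Y \<omega>' \<in> U}) \<omega>"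
      using \<rho> U unfolding is_reg_cond_distr_def by blast
    ultimately show "AE \<omega> in M. measure (\<rho> \<omega>) U = measure (\<kappa> \<omega>) U" by eventually_elim simp
  qed
  have \<rho>_space: "\<rho> \<omega> \<in> space (prob_algebra borel)" if "\<omega> \<in> space M" for \<omega>
  proof (rule measurable_space[of \<rho> N])
    show "\<rho> \<in> N \<rightarrow>\<^sub>M prob_algebra borel" using \<rho> unfolding is_reg_cond_distr_def by (rule conjunct1)
  qed (simp add: subN(1) that)
  from measures_eq have "AE \<omega> in M. \<rho> \<omega> = \<kappa> \<omega>" using AE_space
  proof eventually_elim
    case (elim \<omega>)
    show ?case using elim(1) by (intro prob_algebra_eqI \<rho>_space[OF elim(2)] kp[OF elim(2)]) auto
  qed
  then show ?thesis by (simp add: \<rho>_def)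
qed

end

end

lemma (in complete_measure) measurable_cong_AE_complete:
  assumes g: "g \<in> M \<rightarrow>\<^sub>M S" and ae: "AE \<omega> in M. f \<omega> = g \<omega>" and f: "f \<in> space M \<rightarrow> space S"
  shows "f \<in> M \<rightarrow>\<^sub>M S"
proof (rule measurableI)
  show "f \<omega> \<in> space S" if "\<omega> \<in> space M" for \<omega> using f that by auto
  fix B assume B: "B \<in> sets S"
  obtain Z where Z: "Z \<in> null_sets M" "{\<omega> \<in> space M. f \<omega> \<noteq> g \<omega>} \<subseteq> Z" using ae by (auto simp: eventually_ae_filter)
  have "f -` B \<inter> space M = (g -` B \<inter> space M - Z) \<union> (f -` B \<inter> space M \<inter> Z)" using Z(2) by auto
  moreover have "f -` B \<inter> space M \<inter> Z \<in> sets M" by (rule complete[OF _ Z(1)]) auto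
  moreover have "g -` B \<inter> space M - Z \<in> sets M" using measurable_sets[OF g B] Z(1) by auto
  ultimately show "f -` B \<inter> space M \<in> sets M" by (metis sets.Un)
qed

section \<open>The dynamic risk measure of a Markovian policy\<close>

context semicontinuous_control
begin

lemma subalgebra_F: "subalgebra M (F t)"
  using F.space_F F_sub_G[of t] G_sub[of t] by (auto simp: subalgebra_def)

lemma subalgebra_G: "subalgebra M (G t)"
  using G.space_F G_sub[of t] by (auto simp: subalgebra_def)

lemma U_alg_generators: "sets (G (t - 1)) \<union> sets (F t) \<subseteq> Pow (space M)"
  using sets.sets_into_space[of _ "G (t - 1)"] sets.sets_into_space[of _ "F t"] G.space_F F.space_F by auto

lemma U_alg_space: "space (U_alg M F G t) = space M" "sets (U_alg M F G t) = sigma_sets (space M) (sets (G (t - 1)) \<union> sets (F t))"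
  using U_alg_generators[of t] by (simp_all add: U_alg_def)

lemma subalgebra_G_U: "subalgebra (G t) (U_alg M F G t)"
proof -
  have "sets (G (t - 1)) \<union> sets (F t) \<subseteq> sets (G t)" using G.sets_F_mono[of "t - 1" t] F_sub_G[of t] by auto
  then have "sigma_sets (space (G t)) (sets (G (t - 1)) \<union> sets (F t)) \<subseteq> sets (G t)" by (rule sets.sigma_sets_subset)
  then show ?thesis using U_alg_space[of t] G.space_F[of t] by (simp add: subalgebra_def)
qed

lemma subalgebra_U: "subalgebra M (U_alg M F G t)"
  using subalgebra_G_U[of t] subalgebra_G[of t] by (auto simp: subalgebra_def)

lemma F_measurable_imp_U: "X \<in> F t \<rightarrow>\<^sub>M S \<Longrightarrow> X \<in> U_alg M F G t \<rightarrow>\<^sub>M S"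
proof (erule measurable_from_subalg[rotated])
  show "subalgebra (U_alg M F G t) (F t)" using U_alg_space[of t] F.space_F[of t] by (auto simp: subalgebra_def)
qed

text \<open>Given \<open>G t\<close>, state and action are known and the next state follows the transition kernel; given
  the smaller \<open>U_alg M F G t\<close>, the state is known and the action follows the policy. Freezing and the tower rule combine the two.\<close>

lemma step_cond_law:
  assumes t: "t \<ge> 1" and p: "p \<in> markov_policies \<A>" and v: "v \<in> borel_measurable borel"
  shows "is_cond_law M (U_alg M F G t) borel
    (\<lambda>\<omega>. C t (Xp p t \<omega>) (Ap p t \<omega>) (Xp p (Suc t) \<omega>) + \<gamma> * v (Xp p (Suc t) \<omega>))
    (\<lambda>\<omega>. step_law t v (Xp p t \<omega>) (p t (Xp p t \<omega>)))"
proof -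
  interpret S: one_step \<gamma> C P t v using t v by (rule one_step)
  note pp = policy_pair[OF p]
  have pm: "p t \<in> borel \<rightarrow>\<^sub>M prob_algebra borel" using p t by (auto simp: markov_policies_def)
  have XF: "Xp p t \<in> F t \<rightarrow>\<^sub>M borel" using X_adapted[OF pp t] .
  have XG: "Xp p t \<in> G t \<rightarrow>\<^sub>M borel"
    using measurable_from_subalg[OF _ XF, of "G t"] F_sub_G[of t] F.space_F[of t] G.space_F[of t] by (auto simp: subalgebra_def)
  have XU: "Xp p t \<in> U_alg M F G t \<rightarrow>\<^sub>M borel" using XF by (rule F_measurable_imp_U)
  have AG: "Ap p t \<in> G t \<rightarrow>\<^sub>M borel" using A_adapted[OF pp t] .
  have XM: "Xp p (Suc t) \<in> M \<rightarrow>\<^sub>M borel" using measurable_from_subalg[OF subalgebra_F X_adapted[OF pp]] by simp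
  have XAG: "(\<lambda>\<omega>. (Xp p t \<omega>, Ap p t \<omega>)) \<in> G t \<rightarrow>\<^sub>M borel \<Otimes>\<^sub>M borel" using XG AG by simp
  have "(\<lambda>\<omega>. P t (Xp p t \<omega>) (Ap p t \<omega>)) \<in> G t \<rightarrow>\<^sub>M prob_algebra borel"
    using measurable_compose[OF XAG, of "\<lambda>(x, a). P t x a"] kernel[OF t] by (simp add: borel_prod)
  then have 1: "is_cond_law M (G t) borel (Xp p (Suc t)) (\<lambda>\<omega>. P t (Xp p t \<omega>) (Ap p t \<omega>))"
    using X_transition[OF pp t] by (subst is_cond_law_iff_cond_exp[OF subalgebra_G XM]) auto
  from is_cond_law_freeze[OF subalgebra_G 1 XAG S.step_cost_measurable]
  have 2: "is_cond_law M (G t) borel (\<lambda>\<omega>. C t (Xp p t \<omega>) (Ap p t \<omega>) (Xp p (Suc t) \<omega>) + \<gamma> * v (Xp p (Suc t) \<omega>))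
    (\<lambda>\<omega>. (\<lambda>(x, a). S.step_kernel x a) (Xp p t \<omega>, Ap p t \<omega>))"
    by (simp add: S.step_kernel_def)
  have 3: "is_cond_law M (U_alg M F G t) borel (Ap p t) (\<lambda>\<omega>. p t (Xp p t \<omega>))"
    using policy_cond_U[OF p t] measurable_from_subalg[OF subalgebra_G AG] measurable_compose[OF XU pm]
    by (subst is_cond_law_iff_cond_exp[OF subalgebra_U]) auto
  from is_cond_law_tower[OF subalgebra_U subalgebra_G_U 2 XU 3 S.step_kernel_measurable]
  have 4: "is_cond_law M (U_alg M F G t) borel (\<lambda>\<omega>. C t (Xp p t \<omega>) (Ap p t \<omega>) (Xp p (Suc t) \<omega>) + \<gamma> * v (Xp p (Suc t) \<omega>))
    (\<lambda>\<omega>. p t (Xp p t \<omega>) \<bind> S.step_kernel (Xp p t \<omega>))" by simp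
  have "p t x \<in> space (prob_algebra borel)" for x using measurable_space[OF pm] by simp
  then show ?thesis using 4 by (simp add: S.one_step_law_eq_bind)
qed

text \<open>In the recursion for the dynamic risk measure the random variable \<open>Y\<close> is conditioned. By the
  induction hypothesis it agrees almost surely with the cost-to-go built from \<open>J_pol\<close>; completeness of the
  probability space makes it measurable.\<close>

lemma dyn_risk_AE_eq_J_pol:
  assumes p: "p \<in> markov_policies \<A>" and "t \<ge> 1" "t \<le> T"
  shows "AE \<omega> in M. dyn_risk M F G \<gamma> \<sigma> (Xp p) (cost_process C (Xp p) (Ap p)) T t (Xp p t \<omega>) \<omega>
    = pol_value p T t (Xp p t \<omega>)"
  using assms(2,3)
proof (induction "T - t" arbitrary: t rule: less_induct)
  case less
  note t = less.prems(1) and tT = less.prems(2)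
  let ?Z = "cost_process C (Xp p) (Ap p)"
  let ?d = "dyn_risk M F G \<gamma> \<sigma> (Xp p) ?Z T"
  let ?v = "\<lambda>y. real_of_ereal (pol_value p T (Suc t) y)"
  let ?Y' = "\<lambda>\<omega>. C t (Xp p t \<omega>) (Ap p t \<omega>) (Xp p (Suc t) \<omega>) + \<gamma> * ?v (Xp p (Suc t) \<omega>)"
  define Y where "Y = (if t < T then (\<lambda>\<omega>'. ?Z t \<omega>' + \<gamma> * real_of_ereal (?d (Suc t) (Xp p (Suc t) \<omega>') \<omega>')) else ?Z t)"
  have d: "?d t x \<omega> = \<sigma> t x (reg_cond_distr M (U_alg M F G t) Y \<omega>)" for x \<omega>
    by (subst dyn_risk.simps) (simp add: Y_def)
  have Z: "?Z t \<omega> = C t (Xp p t \<omega>) (Ap p t \<omega>) (Xp p (Suc t) \<omega>)" for \<omega> using t by (simp add: cost_process_def)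
  have v: "?v \<in> borel_measurable borel" using J_pol_bounded_measurable[OF _ p, of "Suc t" T] by simp
  note L = step_cond_law[OF t p v]
  have ae: "AE \<omega> in M. Y \<omega> = ?Y' \<omega>"
  proof (cases "t < T")
    case True
    have "AE \<omega> in M. ?d (Suc t) (Xp p (Suc t) \<omega>) \<omega> = pol_value p T (Suc t) (Xp p (Suc t) \<omega>)"
      using True by (intro less.hyps) auto
    then show ?thesis by eventually_elim (use True in \<open>simp add: Y_def Z\<close>)
  next
    case False
    then have "?v y = 0" for y by (subst J_pol.simps) simp
    then show ?thesis using False by (simp add: Y_def Z)
  qed
  have "Y \<in> borel_measurable M"
    by (rule measurable_cong_AE_complete[OF _ ae]) (use L in \<open>auto simp: is_cond_law_def\<close>)
  from reg_cond_distr_AE_eq[OF subalgebra_U is_cond_law_cong_AE[OF subalgebra_U L this ae]]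
  have "AE \<omega> in M. reg_cond_distr M (U_alg M F G t) Y \<omega> = step_law t ?v (Xp p t \<omega>) (p t (Xp p t \<omega>))" .
  then show ?case
  proof eventually_elim
    case (elim \<omega>)
    have "pol_value p T t (Xp p t \<omega>) = \<sigma> t (Xp p t \<omega>) (step_law t ?v (Xp p t \<omega>) (p t (Xp p t \<omega>)))"
      using tT by (subst J_pol.simps) (simp add: H_op_def G_op_def)
    then show ?case using elim by (simp add: d)
  qed
qed

lemma dyn_risk0_eq_J_pol0:
  assumes p: "p \<in> markov_policies \<A>" and T: "T \<ge> 1"
  shows "dyn_risk0 M F G \<gamma> \<sigma>0 \<sigma> (Xp p) (cost_process C (Xp p) (Ap p)) T = J_pol0 \<gamma> C P \<xi> \<sigma>0 \<sigma> p T"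
proof -
  let ?d = "\<lambda>\<omega>. dyn_risk M F G \<gamma> \<sigma> (Xp p) (cost_process C (Xp p) (Ap p)) T 1 (Xp p 1 \<omega>) \<omega>"
  let ?v = "\<lambda>y. \<gamma> * real_of_ereal (pol_value p T 1 y)"
  have v: "?v \<in> borel_measurable borel"
    using J_pol_bounded_measurable[OF order_refl p] by (intro borel_measurable_times borel_measurable_const) blast
  have X: "Xp p 1 \<in> M \<rightarrow>\<^sub>M borel" using measurable_from_subalg[OF subalgebra_F X_adapted[OF policy_pair[OF p]]] by simp
  have ae: "AE \<omega> in M. \<gamma> * real_of_ereal (?d \<omega>) = ?v (Xp p 1 \<omega>)"
    using dyn_risk_AE_eq_J_pol[OF p order_refl T] by eventually_elim simp
  have m: "(\<lambda>\<omega>. ?v (Xp p 1 \<omega>)) \<in> borel_measurable M" using measurable_compose[OF X v] .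
  have "distr M borel (\<lambda>\<omega>. \<gamma> * real_of_ereal (?d \<omega>)) = distr M borel (\<lambda>\<omega>. ?v (Xp p 1 \<omega>))"
    using ae m measurable_cong_AE_complete[OF m ae] by (intro distr_cong_AE) auto
  also have "\<dots> = distr (distr M borel (Xp p 1)) borel ?v" using distr_distr[OF v X] by (simp add: o_def)
  also have "distr M borel (Xp p 1) = \<xi>" by (rule X_initial[OF policy_pair[OF p]])
  finally have "distr M borel (\<lambda>\<omega>. \<gamma> * real_of_ereal (?d \<omega>)) = distr \<xi> borel ?v" .
  moreover have "cost_process C (Xp p) (Ap p) 0 \<omega> = 0" for \<omega> by (simp add: cost_process_def)
  ultimately show ?thesis by (simp add: dyn_risk0_def J_pol0_def H0_op_def)
qed

lemma initial_law_bounded_support: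
  assumes v: "v \<in> borel_measurable borel" and R: "\<And>y. \<bar>v y\<bar> \<le> R"
  shows "distr \<xi> borel (\<lambda>y. \<gamma> * v y) \<in> bounded_support"
proof -
  interpret X: prob_space \<xi> using initial by (rule borel_prob_spaceD)
  have m: "(\<lambda>y. \<gamma> * v y) \<in> borel_measurable \<xi>" using v borel_prob_spaceD(2)[OF initial] by (simp cong: measurable_cong_sets)
  have "\<bar>\<gamma> * v y\<bar> \<le> 1 * R" for y unfolding abs_mult using gamma R[of y] by (intro mult_mono) auto
  then have "AE u in distr \<xi> borel (\<lambda>y. \<gamma> * v y). u \<in> cball 0 R" using m by (subst AE_distr_iff) auto
  moreover have "prob_space (distr \<xi> borel (\<lambda>y. \<gamma> * v y))" using m by (rule X.prob_space_distr)
  ultimately have "distr \<xi> borel (\<lambda>y. \<gamma> * v y) \<in> prob_on (cball 0 R)"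
    by (auto simp: prob_on_iff_AE space_prob_algebra)
  then show ?thesis by (rule bounded_supportI)
qed

lemma H0_op_mono:
  assumes v: "v \<in> borel_measurable borel" "\<And>y. \<bar>v y\<bar> \<le> R" and w: "w \<in> borel_measurable borel" "\<And>y. \<bar>w y\<bar> \<le> R"
    and le: "\<And>y. v y \<le> w y"
  shows "H0_op \<gamma> \<xi> \<sigma>0 v \<le> H0_op \<gamma> \<xi> \<sigma>0 w"
  unfolding H0_op_def
proof (rule sigma0.monotone)
  fix r :: real
  interpret X: prob_space \<xi> using initial by (rule borel_prob_spaceD)
  have m: "(\<lambda>y. \<gamma> * u y) \<in> borel_measurable \<xi>" if "u \<in> borel_measurable borel" for u
    using that borel_prob_spaceD(2)[OF initial] by (simp cong: measurable_cong_sets)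
  have "\<gamma> * v y \<le> \<gamma> * w y" for y using le gamma by (simp add: mult_left_mono)
  then have "(\<lambda>y. \<gamma> * w y) -` {..r} \<inter> space \<xi> \<subseteq> (\<lambda>y. \<gamma> * v y) -` {..r} \<inter> space \<xi>"
    by (auto intro: order_trans)
  then show "measure (distr \<xi> borel (\<lambda>y. \<gamma> * w y)) {..r} \<le> measure (distr \<xi> borel (\<lambda>y. \<gamma> * v y)) {..r}"
    using measurable_sets[OF m[OF v(1)], of "{..r}"] m[OF v(1)] m[OF w(1)]
    by (auto simp: measure_distr intro!: X.finite_measure_mono)
qed (rule initial_law_bounded_support[OF v] initial_law_bounded_support[OF w])+

lemma J_opt0_le_J_pol0:
  assumes p: "p \<in> markov_policies \<A>"
  shows "J_opt0 \<gamma> C P \<xi> \<sigma>0 \<sigma> \<A> T \<le> J_pol0 \<gamma> C P \<xi> \<sigma>0 \<sigma> p T"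
proof -
  let ?v = "\<lambda>y. real_of_ereal (opt_value T 1 y)" and ?w = "\<lambda>y. real_of_ereal (pol_value p T 1 y)"
  obtain R1 where v: "lower_semicontinuous ?v" and R1: "\<And>y. \<bar>opt_value T 1 y\<bar> \<le> ereal R1"
    using J_opt_bounded_lower_semicontinuous[of 1 T] by auto
  obtain R2 where w: "?w \<in> borel_measurable borel" and R2: "\<And>y. \<bar>pol_value p T 1 y\<bar> \<le> ereal R2"
    using J_pol_bounded_measurable[OF _ p, of 1 T] by auto
  have bd: "\<bar>?v y\<bar> \<le> max R1 R2" "\<bar>?w y\<bar> \<le> max R1 R2" "?v y \<le> ?w y" for y
    using R1[of y] R2[of y] J_opt_le_J_pol[OF _ p, of 1 T y]
    by (cases "opt_value T 1 y"; cases "pol_value p T 1 y"; auto)+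
  show ?thesis unfolding J_opt0_def J_pol0_def
    by (rule H0_op_mono[OF lower_semicontinuous_measurable[OF v] bd(1) w bd(2,3)])
qed

end

section \<open>Optimality\<close>

theorem theorem4p2:
  fixes M :: "'w measure" and F G :: "nat \<Rightarrow> 'w measure"
    and \<sigma>0 :: "real measure \<Rightarrow> ereal"
    and \<sigma> :: "nat \<Rightarrow> 'x::polish_space \<Rightarrow> real measure \<Rightarrow> ereal"
    and \<A> :: "nat \<Rightarrow> 'x \<Rightarrow> 'a::polish_space set"
    and P :: "nat \<Rightarrow> 'x \<Rightarrow> 'a \<Rightarrow> 'x measure"
    and \<xi> :: "'x measure"
    and \<Psi> :: "((nat \<Rightarrow> 'w \<Rightarrow> 'x) \<times> (nat \<Rightarrow> 'w \<Rightarrow> 'a)) set"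
    and Xp :: "(nat \<Rightarrow> 'x \<Rightarrow> 'a measure) \<Rightarrow> nat \<Rightarrow> 'w \<Rightarrow> 'x"
    and Ap :: "(nat \<Rightarrow> 'x \<Rightarrow> 'a measure) \<Rightarrow> nat \<Rightarrow> 'w \<Rightarrow> 'a"
    and C :: "nat \<Rightarrow> 'x \<Rightarrow> 'a \<Rightarrow> 'x \<Rightarrow> real"
    and \<gamma> b :: real and T :: nat
  assumes setting: "risk_averse_control M F G \<sigma>0 \<sigma> \<A> P \<xi> \<Psi> Xp Ap C"
    and gamma: "0 \<le> \<gamma>" "\<gamma> \<le> 1"
    and T: "T \<ge> 1"
    and kernel_weakly_continuous:
      "\<And>t xs x0 as a0 (f :: 'x \<Rightarrow> real).
         \<lbrakk>t \<ge> 1; xs \<longlonglongrightarrow> x0; as \<longlonglongrightarrow> a0; continuous_on UNIV f; bounded (range f)\<rbrakk> \<Longrightarrow>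
         (\<lambda>n. \<integral>y. f y \<partial>P t (xs n) (as n)) \<longlonglongrightarrow> (\<integral>y. f y \<partial>P t x0 a0)"
    and actions_compact: "\<And>t. t \<ge> 1 \<Longrightarrow> compact (\<Union>x. \<A> t x)"
    and actions_upper_hemicontinuous:
      "\<And>t x V. \<lbrakk>t \<ge> 1; open V; \<A> t x \<subseteq> V\<rbrakk> \<Longrightarrow> \<exists>W. open W \<and> x \<in> W \<and> (\<forall>z \<in> W. \<A> t z \<subseteq> V)"
    and sigma_lower_semicontinuous:
      "\<And>t K \<mu> \<mu>0 xs x0.
         \<lbrakk>t \<ge> 1; compact K; \<And>n. \<mu> n \<in> prob_on K; \<mu>0 \<in> prob_on K;
          limitin weak_topology \<mu> \<mu>0 sequentially; xs \<longlonglongrightarrow> x0\<rbrakk> \<Longrightarrow>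
         \<sigma> t x0 \<mu>0 \<le> liminf (\<lambda>n. \<sigma> t (xs n) (\<mu> n))"
    and cost_lower_semicontinuous:
      "\<And>t. t \<ge> 1 \<Longrightarrow> lower_semicontinuous (\<lambda>(x, a, y). C t x a y)"
    and cost_bounded: "b > 0" "\<And>t x a y. t \<ge> 1 \<Longrightarrow> \<bar>C t x a y\<bar> \<le> b"
  shows
    "(\<forall>t \<in> {1..T}.
        (\<forall>x. argmin_set \<gamma> C P \<sigma> \<A> T t x \<noteq> {} \<and>
             closedin weak_topology (argmin_set \<gamma> C P \<sigma> \<A> T t x)) \<and>
        (\<exists>\<pi> \<in> borel \<rightarrow>\<^sub>M prob_algebra borel. \<forall>x. \<pi> x \<in> argmin_set \<gamma> C P \<sigma> \<A> T t x)) \<and>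
     (\<forall>p' \<in> markov_policies \<A>.
        (\<forall>t \<in> {1..T}. \<forall>x. p' t x \<in> argmin_set \<gamma> C P \<sigma> \<A> T t x) \<longrightarrow>
        (\<forall>t x. 0 < t \<and> t < T \<longrightarrow>
           J_pol \<gamma> C P \<sigma> p' T t x = J_opt \<gamma> C P \<sigma> \<A> T t x \<and>
           J_opt \<gamma> C P \<sigma> \<A> T t x = (INF p \<in> markov_policies \<A>. J_pol \<gamma> C P \<sigma> p T t x)) \<and>
        J_pol0 \<gamma> C P \<xi> \<sigma>0 \<sigma> p' T = J_opt0 \<gamma> C P \<xi> \<sigma>0 \<sigma> \<A> T \<and>
        J_opt0 \<gamma> C P \<xi> \<sigma>0 \<sigma> \<A> T
          = (INF p \<in> markov_policies \<A>.
               dyn_risk0 M F G \<gamma> \<sigma>0 \<sigma> (Xp p) (cost_process C (Xp p) (Ap p)) T) \<and>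
        dyn_risk0 M F G \<gamma> \<sigma>0 \<sigma> (Xp p') (cost_process C (Xp p') (Ap p')) T
          = (INF p \<in> markov_policies \<A>.
               dyn_risk0 M F G \<gamma> \<sigma>0 \<sigma> (Xp p) (cost_process C (Xp p) (Ap p)) T))"
proof -
  interpret semicontinuous_control M F G \<sigma>0 \<sigma> \<A> P \<xi> \<Psi> Xp Ap C \<gamma> b
    by (intro semicontinuous_control.intro semicontinuous_control_axioms.intro) (fact assms)+
  let ?J = "J_pol \<gamma> C P \<sigma>" and ?J' = "J_opt \<gamma> C P \<sigma> \<A> T"
  have b: "?J p' T t x = ?J' t x \<and> ?J' t x = (INF p \<in> markov_policies \<A>. ?J p T t x)"
    if p': "p' \<in> markov_policies \<A>" "\<And>t x. t \<in> {1..T} \<Longrightarrow> p' t x \<in> argmin_set \<gamma> C P \<sigma> \<A> T t x"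
      and t: "t \<ge> 1" for p' t x
  proof
    show eq: "?J p' T t x = ?J' t x" using J_pol_eq_J_opt[OF t p'(2)] .
    show "?J' t x = (INF p \<in> markov_policies \<A>. ?J p T t x)"
      using J_opt_le_J_pol[OF t] INF_lower[OF p'(1), of "\<lambda>p. ?J p T t x"] eq
      by (intro antisym INF_greatest) auto
  qed
  have c: "J_pol0 \<gamma> C P \<xi> \<sigma>0 \<sigma> p' T = J_opt0 \<gamma> C P \<xi> \<sigma>0 \<sigma> \<A> T \<and>
      J_opt0 \<gamma> C P \<xi> \<sigma>0 \<sigma> \<A> T = (INF p \<in> markov_policies \<A>.
        dyn_risk0 M F G \<gamma> \<sigma>0 \<sigma> (Xp p) (cost_process C (Xp p) (Ap p)) T)"
    if p': "p' \<in> markov_policies \<A>" "\<And>t x. t \<in> {1..T} \<Longrightarrow> p' t x \<in> argmin_set \<gamma> C P \<sigma> \<A> T t x" for p'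
  proof
    have "?J p' T 1 = ?J' 1" using J_pol_eq_J_opt[OF _ p'(2), of 1] by auto
    then show eq: "J_pol0 \<gamma> C P \<xi> \<sigma>0 \<sigma> p' T = J_opt0 \<gamma> C P \<xi> \<sigma>0 \<sigma> \<A> T" by (simp add: J_pol0_def J_opt0_def)
    have "(INF p \<in> markov_policies \<A>. dyn_risk0 M F G \<gamma> \<sigma>0 \<sigma> (Xp p) (cost_process C (Xp p) (Ap p)) T)
        = (INF p \<in> markov_policies \<A>. J_pol0 \<gamma> C P \<xi> \<sigma>0 \<sigma> p T)"
      using dyn_risk0_eq_J_pol0[OF _ T] by (intro INF_cong) auto
    also have "\<dots> = J_opt0 \<gamma> C P \<xi> \<sigma>0 \<sigma> \<A> T"
      using J_opt0_le_J_pol0 INF_lower[OF p'(1), of "\<lambda>p. J_pol0 \<gamma> C P \<xi> \<sigma>0 \<sigma> p T"] eq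
      by (intro antisym INF_greatest) auto
    finally show "J_opt0 \<gamma> C P \<xi> \<sigma>0 \<sigma> \<A> T = (INF p \<in> markov_policies \<A>.
        dyn_risk0 M F G \<gamma> \<sigma>0 \<sigma> (Xp p) (cost_process C (Xp p) (Ap p)) T)" by simp
  qed
  show ?thesis
  proof (intro conjI ballI allI impI)
    fix t x assume "t \<in> {1..T}"
    then have t: "t \<ge> 1" by simp
    show "argmin_set \<gamma> C P \<sigma> \<A> T t x \<noteq> {}" "closedin weak_topology (argmin_set \<gamma> C P \<sigma> \<A> T t x)"
      by (rule argmin_set_properties[OF t])+
  next
    fix t assume "t \<in> {1..T}"
    then show "\<exists>\<pi> \<in> borel \<rightarrow>\<^sub>M prob_algebra borel. \<forall>x. \<pi> x \<in> argmin_set \<gamma> C P \<sigma> \<A> T t x"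
      by (intro argmin_set_properties(3)) simp
  next
    fix p' t x assume p': "p' \<in> markov_policies \<A>" "\<forall>t \<in> {1..T}. \<forall>x. p' t x \<in> argmin_set \<gamma> C P \<sigma> \<A> T t x"
      and "0 < t \<and> t < T"
    then show "?J p' T t x = ?J' t x" "?J' t x = (INF p \<in> markov_policies \<A>. ?J p T t x)"
      using b[of p' t x] by auto
  next
    fix p' assume p': "p' \<in> markov_policies \<A>" "\<forall>t \<in> {1..T}. \<forall>x. p' t x \<in> argmin_set \<gamma> C P \<sigma> \<A> T t x"
    then show "J_pol0 \<gamma> C P \<xi> \<sigma>0 \<sigma> p' T = J_opt0 \<gamma> C P \<xi> \<sigma>0 \<sigma> \<A> T"
      "J_opt0 \<gamma> C P \<xi> \<sigma>0 \<sigma> \<A> T = (INF p \<in> markov_policies \<A>.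
        dyn_risk0 M F G \<gamma> \<sigma>0 \<sigma> (Xp p) (cost_process C (Xp p) (Ap p)) T)"
      using c[of p'] by auto
    then show "dyn_risk0 M F G \<gamma> \<sigma>0 \<sigma> (Xp p') (cost_process C (Xp p') (Ap p')) T
      = (INF p \<in> markov_policies \<A>. dyn_risk0 M F G \<gamma> \<sigma>0 \<sigma> (Xp p) (cost_process C (Xp p) (Ap p)) T)"
      using dyn_risk0_eq_J_pol0[OF p'(1) T] by simp
  qed
qed

end
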